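(* Let $\nu_{\hat D}$ be the law of a nonnegative random variable $\hat D$ with $\mathbb E\hat D=1$, let $\mu=\nu_{\hat D}\boxtimes\sigma_{\mathrm{sc}}$, and let $\mu_{\mathrm{MP}}$, $\widetilde\mu$, $h$, $\boldsymbol\rho_{\mathrm{MP}}$ and $\widetilde{\boldsymbol\rho}$ be as defined in the context. Then: 1. For $x\ne0$ the measure $\mu$ has the density $$\boldsymbol\rho(x):=\frac{d\mu}{dx}=-2\,\Re(h(x^2))\,\widetilde{\boldsymbol\rho}(x),$$ which is continuous, symmetric, and moreover real analytic where positive. 2. The support of $\mu$, understood as $\{x:\boldsymbol\rho(x)>0\}$, equals the support of $\widetilde\mu$, which up to the mapping $x\mapsto x^2$ further matches the support of $\mu_{\mathrm{MP}}$; that is, for $x\neq 0$, $\boldsymbol\rho(x)>0$ iff $\widetilde{\boldsymbol\rho}(x)>0$ iff $\boldsymbol\rho_{\mathrm{MP}}(x^2)>0$. 3. For all $x\ne0$, $$\pi\,\widetilde{\boldsymbol\rho}(x)\le 1\wedge\frac{2}{|x|},\qquad \pi\,\boldsymbol\rho(x)\le(\mathbb E\hat D^{-2})^{1/2}\wedge\frac{4}{|x|^3}.$$ 4. If $\nu_{\hat D}(\{0\})=0$ then $\mu$ is absolutely continuous (i.e., $\mu(\{0\})=0$).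
   Context: $\mathbb C_+=\{z\in\mathbb C:\Im z>0\}$, $\mathbb R_+=[0,\infty)$, $a\wedge b=\min(a,b)$; $\mathbb E\hat D^{-2}\in(0,\infty]$, with value $+\infty$ if $\nu_{\hat D}(\{0\})>0$. $\sigma_{\mathrm{sc}}$ is the standard semicircle law, supported on $[-2,2]$. The Cauchy--Stieltjes transform of a probability measure $\mu$ on $\mathbb R$ is $G_\mu(z)=\int\frac{1}{t-z}\,d\mu(t)$. Let $\nu$ be the size-biasing of $\nu_{\hat D}$: $\frac{d\nu}{d\nu_{\hat D}}(x)=x$ on $\mathbb R_+$. $\mu_{\mathrm{MP}}$ is the Marchenko--Pastur limit (probability measure on $\mathbb R_+$) of the empirical spectral distribution of $n^{-1}\mathbf\Lambda_n^{1/2}\widetilde{\mathbf X}_n\widetilde{\mathbf X}_n^\star\mathbf\Lambda_n^{1/2}$, where $\widetilde{\mathbf X}_n$ is $n\times n$ with standard i.i.d. complex Gaussian entries and $\mathbf\Lambda_n$ are nonnegative diagonal matrices whose empirical spectral distributions converge weakly to $\nu$. It is characterized by its transform $h=G_{\mu_{\mathrm{MP}}}$, the unique $\mathbb C_+$-valued analytic function on $\mathbb C_+$, decaying to zero as $|z|\to\infty$, that solves $h=\big(\mathbb E\big[\tfrac{\hat D^2}{1+h\hat D}\big]-z\big)^{-1}$. It is known (Silverstein--Choi) that $h(x):=\lim_{z\in\mathbb C_+,\,z\to x}h(z)$ exists for every real $x\ne0$ and is continuous on $\mathbb R\setminus\{0\}$, and that $\mu_{\mathrm{MP}}$ has on $\mathbb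 R\setminus\{0\}$ the continuous density $\boldsymbol\rho_{\mathrm{MP}}(x)=\frac1\pi\Im(h(x))$, real analytic at any $x\ne 0$ where it is positive. $\widetilde\mu$ is the law of the symmetric random variable $X$ such that $X^2$ has law $\mu_{\mathrm{MP}}$; its density is $\widetilde{\boldsymbol\rho}(x)=|x|\,\boldsymbol\rho_{\mathrm{MP}}(x^2)$ for $x\neq0$. Free multiplicative convolution: for a probability measure $\varphi$ let $m_\varphi(z)=\int\frac{zt}{1-zt}\,d\varphi(t)$. If $\varphi\ne\delta_0$ is supported on $\mathbb R_+$, $m_\varphi$ is injective on $\{\Re z<0\}$; if $\psi\neq\delta_0$ is symmetric on $\mathbb R$, $m_\psi$ is injective on $\{z:\Im z>|\Re z|\}$. With $m^{-1}$ the inverse of the respective restriction, the $S$-transform is $S(w)=(1+w^{-1})\,m^{-1}(w)$. For $\varphi\ne\delta_0$ on $\mathbb R_+$ and $\psi\ne\delta_0$ symmetric, $\varphi\boxtimes\psi$ is the unique (symmetric) probability measure on $\mathbb R$ with $S_{\varphi\boxtimes\psi}(w)=S_\varphi(w)S_\psi(w)$ on the common domain of these transforms (which contains an interval $(-\varepsilon,0)$). *)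

theory Defs
  imports "HOL-Probability.Probability"
begin

definition upper_half_plane :: "complex set" where
  "upper_half_plane = {z. Im z > 0}"

definition supported_nonneg :: "real measure \<Rightarrow> bool" where
  "supported_nonneg M \<longleftrightarrow> (AE t in M. 0 \<le> t)"

definition symmetric_measure :: "real measure \<Rightarrow> bool" where
  "symmetric_measure M \<longleftrightarrow> distr M borel uminus = M"

definition dirac0 :: "real measure" where
  "dirac0 = return borel 0"

definition semicircle :: "real measure" where
  "semicircle =
     density lborel (\<lambda>x. ennreal (indicator {-2..2} x * sqrt (4 - x\<^sup>2) / (2 * pi)))"

text \<open>Sign convention: the kernel is \<open>1 / (t - z)\<close>, so the transform maps the upper half plane
  to itself.\<close>

definition cauchy_stieltjes :: "real measure \<Rightarrow> complex \<Rightarrow> complex" where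
  "cauchy_stieltjes M z = (\<integral>t. 1 / (complex_of_real t - z) \<partial>M)"


subsection \<open>Free multiplicative convolution\<close>

definition m_transform :: "real measure \<Rightarrow> complex \<Rightarrow> complex" where
  "m_transform M z = (\<integral>t. z * complex_of_real t / (1 - z * complex_of_real t) \<partial>M)"

definition left_half_plane :: "complex set" where
  "left_half_plane = {z. Re z < 0}"

definition upper_sector :: "complex set" where
  "upper_sector = {z. Im z > \<bar>Re z\<bar>}"

text \<open>\<open>S_transform U M\<close> is built from the inverse of the restriction of \<open>m_transform M\<close> to \<open>U\<close>,
  so it is meaningful on \<open>m_transform M ` U\<close> only. For \<open>M \<noteq> dirac0\<close>, this restriction is
  injective with \<open>U = left_half_plane\<close> if \<open>M\<close> lives on the nonnegative reals, and with
  \<open>U = upper_sector\<close> if \<open>M\<close> is symmetric.\<close>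

definition S_transform :: "complex set \<Rightarrow> real measure \<Rightarrow> complex \<Rightarrow> complex" where
  "S_transform U M w = (1 + inverse w) * inv_into U (m_transform M) w"

text \<open>\<open>is_free_mult_conv \<phi> \<psi> \<mu>\<close>: the measure \<open>\<mu>\<close> is the free multiplicative convolution of a law
  \<open>\<phi>\<close> on the nonnegative reals and a symmetric law \<open>\<psi>\<close>. It is a relation; that exactly one such
  \<open>\<mu>\<close> exists is part of the theory of the convolution. The condition \<open>\<mu> \<noteq> dirac0\<close> is
  needed for the S-transform of \<open>\<mu>\<close> to make sense (for \<open>dirac0\<close> the common domain would be
  empty).\<close>

definition is_free_mult_conv :: "real measure \<Rightarrow> real measure \<Rightarrow> real measure \<Rightarrow> bool" where
  "is_free_mult_conv \<phi> \<psi> \<mu> \<longleftrightarrow>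
     real_distribution \<phi> \<and> supported_nonneg \<phi> \<and> \<phi> \<noteq> dirac0 \<and>
     real_distribution \<psi> \<and> symmetric_measure \<psi> \<and> \<psi> \<noteq> dirac0 \<and>
     real_distribution \<mu> \<and> symmetric_measure \<mu> \<and> \<mu> \<noteq> dirac0 \<and>
     (\<forall>w \<in> m_transform \<mu> ` upper_sector \<inter> m_transform \<phi> ` left_half_plane
            \<inter> m_transform \<psi> ` upper_sector.
        S_transform upper_sector \<mu> w
          = S_transform left_half_plane \<phi> w * S_transform upper_sector \<psi> w)"


subsection \<open>The Marchenko--Pastur law\<close>

text \<open>For a law \<open>\<nu>\<close> on the nonnegative reals with mean one, this is the set of conditions that
  singles out the transform of the limiting spectral distribution of
  \<open>n\<^sup>-\<^sup>1 \<Lambda>\<^sup>1\<^sup>/\<^sup>2 X X\<^sup>* \<Lambda>\<^sup>1\<^sup>/\<^sup>2\<close>, where the spectrum of \<open>\<Lambda>\<close> is asymptotically the size-biasing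
  \<open>x d\<nu>(x)\<close>. The integral is \<open>E [D\<^sup>2 / (1 + h D)]\<close> for \<open>D\<close> of law \<open>\<nu>\<close>; one factor \<open>D\<close>
  is the size-biasing density.\<close>

definition solves_MP_equation :: "real measure \<Rightarrow> (complex \<Rightarrow> complex) \<Rightarrow> bool" where
  "solves_MP_equation \<nu> h \<longleftrightarrow>
     h ` upper_half_plane \<subseteq> upper_half_plane \<and>
     h analytic_on upper_half_plane \<and>
     (h \<longlongrightarrow> 0) (inf at_infinity (principal upper_half_plane)) \<and>
     (\<forall>z \<in> upper_half_plane.
        h z = inverse ((\<integral>d. complex_of_real (d\<^sup>2) / (1 + h z * complex_of_real d) \<partial>\<nu>) - z))"

definition is_MP_limit :: "real measure \<Rightarrow> real measure \<Rightarrow> bool" where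
  "is_MP_limit \<nu> M \<longleftrightarrow>
     real_distribution M \<and> supported_nonneg M \<and> solves_MP_equation \<nu> (cauchy_stieltjes M)"

text \<open>Boundary value on the real line from the upper half plane. For a Marchenko--Pastur law it
  is used at \<open>x \<noteq> 0\<close> only, where the limit exists.\<close>

definition h_boundary :: "real measure \<Rightarrow> real \<Rightarrow> complex" where
  "h_boundary M x = Lim (at (complex_of_real x) within upper_half_plane) (cauchy_stieltjes M)"

definition rho_MP :: "real measure \<Rightarrow> real \<Rightarrow> real" where
  "rho_MP M x = Im (h_boundary M x) / pi"

text \<open>If \<open>M\<close> is the law of \<open>X\<^sup>2\<close> with \<open>X\<close> symmetric and \<open>M\<close> has density \<open>rho_MP M\<close> away from
  zero, then this is the density of \<open>X\<close> away from zero.\<close>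

definition rho_tilde :: "real measure \<Rightarrow> real \<Rightarrow> real" where
  "rho_tilde M x = \<bar>x\<bar> * rho_MP M (x\<^sup>2)"


subsection \<open>Densities and regularity\<close>

definition has_density_off_zero :: "real measure \<Rightarrow> (real \<Rightarrow> real) \<Rightarrow> bool" where
  "has_density_off_zero M f \<longleftrightarrow>
     (\<forall>x. x \<noteq> 0 \<longrightarrow> 0 \<le> f x) \<and>
     (\<forall>A \<in> sets borel. 0 \<notin> A \<longrightarrow> emeasure M A = (\<integral>\<^sup>+x\<in>A. ennreal (f x) \<partial>lborel))"

definition real_analytic_at :: "(real \<Rightarrow> real) \<Rightarrow> real \<Rightarrow> bool" where
  "real_analytic_at f x \<longleftrightarrow>
     (\<exists>a. \<exists>r>0. \<forall>y. \<bar>y - x\<bar> < r \<longrightarrow> (\<lambda>n. a n * (y - x) ^ n) sums f y)"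

definition ennreal_sqrt :: "ennreal \<Rightarrow> ennreal" where
  "ennreal_sqrt a = (if a = \<infinity> then \<infinity> else ennreal (sqrt (enn2real a)))"

text \<open>In \<open>ennreal\<close> we have \<open>inverse 0 = \<infinity>\<close>, so an atom at zero makes this infinite.\<close>

definition inv_sq_moment :: "real measure \<Rightarrow> ennreal" where
  "inv_sq_moment \<nu> = (\<integral>\<^sup>+d. inverse (ennreal d) ^ 2 \<partial>\<nu>)"

end

theory Submission
  imports Defs "HOL-Complex_Analysis.Complex_Analysis"
begin

text \<open>
  Write \<open>h\<close> for the transform of the Marchenko--Pastur law and \<open>D\<close> for a variable of law \<open>\<nu>\<close>. Because
  \<open>E [D] = 1\<close>, the Marchenko--Pastur equation is equivalent to each of \<open>E [1 / (1 + h D)] = 1 + z h\<^sup>2\<close> and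
  \<open>E [D / (1 + h D)] = - z h\<close>. The first form says that the \<open>m_transform\<close> of \<open>\<nu>\<close> takes the value \<open>z h\<^sup>2\<close> at
  \<open>- h\<close>. The S-transform of the semicircle law is \<open>1 / sqrt w\<close>, so multiplicativity gives the value \<open>z h\<^sup>2\<close> of
  the \<open>m_transform\<close> of the convolution at \<open>1 / sqrt z\<close>. Hence the transform of the convolution is
  \<open>G(s) = - (1 / s + s h(s\<^sup>2)\<^sup>2)\<close> (\<open>cauchy_stieltjes_free_conv\<close>). It suffices to see this for large negative
  \<open>z\<close>, where everything is real, since both sides are holomorphic. There the preimages used in the
  definition of the S-transform are the right ones because the transforms are injective
  (\<open>m_transform_inj_on\<close>, \<open>m_transform_symmetric_inj_on\<close>).

  The regularity of \<open>h\<close> up to the real axis comes from one estimate (\<open>MP_graph_holder\<close>). For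
  \<open>f = D\<^bsup>3/2\<^esup> h / (1 + h D)\<close> the sign of \<open>Im z\<close> means \<open>E \<bar>f\<bar>\<^sup>2 \<le> 1\<close>, and two solutions satisfy
  \<open>h\<^sub>1 h\<^sub>2 (z\<^sub>1 - z\<^sub>2) = (h\<^sub>1 - h\<^sub>2) (1 - E [f\<^sub>1 f\<^sub>2])\<close>. The distance of \<open>E [f\<^sub>1 f\<^sub>2]\<close> from one is at least half of
  \<open>E \<bar>f\<^sub>1 - cnj f\<^sub>2\<bar>\<^sup>2\<close>, which in turn is at least a multiple of \<open>\<bar>h\<^sub>1 - cnj h\<^sub>2\<bar>\<^sup>2\<close>. So
  \<open>\<bar>h\<^sub>1 - h\<^sub>2\<bar> \<bar>h\<^sub>1 - cnj h\<^sub>2\<bar>\<^sup>2 \<le> C \<bar>z\<^sub>1 - z\<^sub>2\<bar>\<close> away from the origin. Therefore \<open>h\<close> is Hoelder continuous of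
  exponent \<open>1/3\<close> there and has boundary values; and where \<open>Im h > 0\<close> the inverse function of \<open>h\<close> has nonzero
  derivative, so \<open>h\<close> continues holomorphically across the axis. By Stieltjes inversion the convolution has
  density \<open>Im G / \<pi> = - x Im (h(x\<^sup>2)\<^sup>2) / \<pi>\<close> for \<open>x > 0\<close>.

  At a real point \<open>x\<close> with \<open>Im h > 0\<close>, real and imaginary parts of the equation express the moments
  \<open>E [D ^ k / \<bar>1 + h D\<bar>\<^sup>2]\<close> through \<open>h\<close> (\<open>MP_graph_real\<close>): the first is \<open>- 2 x Re h\<close>, which shows \<open>Re h < 0\<close> and hence
  the equality of the supports, and the second is \<open>x\<close>. The bounds follow from these and from
  \<open>E \<bar>f\<bar>\<^sup>2 \<le> 1\<close> by arguments of Cauchy--Schwarz type. Finally the mass of the convolution at zero is the limit of \<open>- s G(s) = E [1 / (1 + h(s\<^sup>2) D)]\<close> as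
  \<open>s = i y\<close> tends to zero; \<open>h(- y\<^sup>2)\<close> then tends to infinity, so the limit is the mass of \<open>\<nu>\<close> at zero.
\<close>

section \<open>Cauchy--Stieltjes transforms\<close>

lemma (in real_distribution) prob_UNIV [simp]: "measure M UNIV = 1"
  using prob_space by simp

lemma (in real_distribution) integrable_boundedI:
  fixes f :: "real \<Rightarrow> 'a :: {banach, second_countable_topology}"
  assumes [measurable]: "f \<in> borel_measurable borel" and "AE t in M. norm (f t) \<le> B"
  shows "integrable M f"
  by (rule integrable_const_bound[OF assms(2)]) measurable

lemma (in prob_space) integral_pos:
  fixes f :: "'a \<Rightarrow> real"
  assumes "integrable M f" "AE t in M. 0 < f t"
  shows "0 < (\<integral>t. f t \<partial>M)"
  using integral_less_AE_space[of "\<lambda>_. 0" f] assms by (simp add: emeasure_space_1)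

lemma integrable_cmult_cancel:
  fixes f :: "'a \<Rightarrow> complex"
  assumes "integrable M (\<lambda>x. c * f x)" "c \<noteq> 0"
  shows "integrable M f"
proof -
  have "integrable M (\<lambda>x. inverse c * (c * f x))" by (rule integrable_mult_right) (rule assms)
  moreover have "(\<lambda>x. inverse c * (c * f x)) = f" using assms(2) by (simp add: fun_eq_iff)
  ultimately show ?thesis by simp
qed

lemma norm_of_real_minus_ge_abs_Im:
  "\<bar>Im z\<bar> \<le> norm (complex_of_real t - z)"
  using abs_Im_le_cmod[of "complex_of_real t - z"] by simp

definition cut_plane :: "complex set" where
  "cut_plane = {z. Im z \<noteq> 0 \<or> Re z < 0}"

lemma open_cut_plane: "open cut_plane"
proof -
  have *: "cut_plane = {z. Im z < 0} \<union> {z. Im z > 0} \<union> {z. Re z < 0}"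
    by (auto simp: cut_plane_def)
  show ?thesis
    unfolding * by (intro open_Un open_halfspace_Re_lt open_halfspace_Im_lt open_halfspace_Im_gt)
qed

lemma cut_plane_distance:
  assumes "z \<in> cut_plane"
  obtains \<delta> where "\<delta> > 0" "\<And>t. t \<ge> 0 \<Longrightarrow> \<delta> \<le> norm (complex_of_real t - z)"
proof (cases "Im z = 0")
  case False
  then show ?thesis using that[of "\<bar>Im z\<bar>"] norm_of_real_minus_ge_abs_Im by auto
next
  case True
  then have "Re z < 0" using assms by (auto simp: cut_plane_def)
  moreover have "- Re z \<le> norm (complex_of_real t - z)" if "t \<ge> 0" for t
    using abs_Re_le_cmod[of "complex_of_real t - z"] that by auto
  ultimately show ?thesis using that[of "- Re z"] by auto
qed

text \<open>Expanding the kernel to second order around \<open>z\<close> leaves the remainder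
  \<open>(w - z)\<^sup>2 / ((t - w) (t - z)\<^sup>2)\<close>, which is at most \<open>2 \<bar>w - z\<bar>\<^sup>2 / \<delta>\<^sup>3\<close> uniformly in \<open>t\<close>.\<close>

lemma (in real_distribution) cauchy_stieltjes_has_field_derivative:
  assumes \<delta>: "\<delta> > 0" and far: "AE t in M. \<delta> \<le> norm (complex_of_real t - z)"
  shows "(cauchy_stieltjes M has_field_derivative
            (\<integral>t. 1 / (complex_of_real t - z)\<^sup>2 \<partial>M)) (at z)"
proof -
  let ?D = "\<integral>t. 1 / (complex_of_real t - z)\<^sup>2 \<partial>M"
  have far': "AE t in M. \<delta> / 2 \<le> norm (complex_of_real t - w)" if "norm (w - z) < \<delta> / 2" for w
    using far
  proof eventually_elim
    case (elim t)
    have "norm (complex_of_real t - z) \<le> norm (complex_of_real t - w) + norm (w - z)"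
      using norm_triangle_ineq[of "complex_of_real t - w" "w - z"] by simp
    then show ?case using elim that by simp
  qed
  have int1: "integrable M (\<lambda>t. 1 / (complex_of_real t - w))" if "norm (w - z) < \<delta> / 2" for w
  proof (rule integrable_boundedI[where B = "2 / \<delta>"])
    show "AE t in M. norm (1 / (complex_of_real t - w)) \<le> 2 / \<delta>"
      using far'[OF that]
    proof eventually_elim
      case (elim t)
      have "1 / norm (complex_of_real t - w) \<le> 1 / (\<delta> / 2)"
        by (rule divide_left_mono) (use elim \<delta> in \<open>auto intro!: mult_pos_pos simp del: zero_less_norm_iff\<close>)
      then show ?case by (simp add: norm_divide)
    qed
  qed measurable
  have int2: "integrable M (\<lambda>t. 1 / (complex_of_real t - z)\<^sup>2)"
  proof (rule integrable_boundedI[where B = "1 / \<delta>\<^sup>2"])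
    show "AE t in M. norm (1 / (complex_of_real t - z)\<^sup>2) \<le> 1 / \<delta>\<^sup>2"
      using far
    proof eventually_elim
      case (elim t)
      have "1 / (norm (complex_of_real t - z))\<^sup>2 \<le> 1 / \<delta>\<^sup>2"
        by (rule divide_left_mono) (use elim \<delta> in \<open>auto intro!: power_mono mult_pos_pos\<close>)
      then show ?case by (simp add: norm_divide norm_power)
    qed
  qed measurable
  have bound: "norm (cauchy_stieltjes M w - cauchy_stieltjes M z - (w - z) * ?D)
      \<le> 2 / \<delta>^3 * (norm (w - z))\<^sup>2" if w: "norm (w - z) < \<delta> / 2" for w
  proof -
    let ?R = "\<lambda>t. (w - z)\<^sup>2 * (1 / ((complex_of_real t - w) * (complex_of_real t - z)\<^sup>2))"
    have z: "norm (z - z) < \<delta> / 2" using \<delta> by simp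
    have lin: "(\<integral>t. f t \<partial>M) - (\<integral>t. g t \<partial>M) - c * (\<integral>t. k t \<partial>M) = (\<integral>t. f t - g t - c * k t \<partial>M)"
      if "integrable M f" "integrable M g" "integrable M k" for f g k and c :: complex
      using that by simp
    have "cauchy_stieltjes M w - cauchy_stieltjes M z - (w - z) * ?D
        = (\<integral>t. 1 / (complex_of_real t - w) - 1 / (complex_of_real t - z)
              - (w - z) * (1 / (complex_of_real t - z)\<^sup>2) \<partial>M)"
      unfolding cauchy_stieltjes_def by (rule lin[OF int1[OF w] int1[OF z] int2])
    also have "\<dots> = (\<integral>t. ?R t \<partial>M)"
    proof (rule integral_cong_AE)
      show "AE t in M. 1 / (complex_of_real t - w) - 1 / (complex_of_real t - z)
          - (w - z) * (1 / (complex_of_real t - z)\<^sup>2) = ?R t"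
        using far far'[OF w]
      proof eventually_elim
        case (elim t)
        then have "complex_of_real t - w \<noteq> 0" "complex_of_real t - z \<noteq> 0"
          using \<delta> by auto
        then show ?case by (simp add: divide_simps power2_eq_square) (simp add: algebra_simps)
      qed
    qed measurable
    also have "norm \<dots> \<le> (\<integral>t. 2 / \<delta>^3 * (norm (w - z))\<^sup>2 \<partial>M)"
    proof (rule order_trans[OF integral_norm_bound], rule integral_mono_AE)
      have *: "AE t in M. norm (?R t) \<le> 2 / \<delta>^3 * (norm (w - z))\<^sup>2"
        using far far'[OF w]
      proof eventually_elim
        case (elim t)
        have "\<delta> / 2 * \<delta>\<^sup>2 \<le> norm (complex_of_real t - w) * (norm (complex_of_real t - z))\<^sup>2"
          by (intro mult_mono power_mono) (use elim \<delta> in auto)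
        then have "1 / (norm (complex_of_real t - w) * (norm (complex_of_real t - z))\<^sup>2)
            \<le> 1 / (\<delta> / 2 * \<delta>\<^sup>2)"
          using \<delta> elim by (intro divide_left_mono) (auto intro!: mult_pos_pos)
        also have "\<dots> = 2 / \<delta>^3" using \<delta> by (simp add: power3_eq_cube power2_eq_square)
        finally have "(norm (w - z))\<^sup>2 * (1 / (norm (complex_of_real t - w) * (norm (complex_of_real t - z))\<^sup>2))
            \<le> (norm (w - z))\<^sup>2 * (2 / \<delta>^3)"
          by (intro mult_left_mono) auto
        then show ?case by (simp add: norm_mult norm_divide norm_power mult.commute)
      qed
      then show "AE t in M. norm (?R t) \<le> 2 / \<delta>^3 * (norm (w - z))\<^sup>2" .
      show "integrable M (\<lambda>t. norm (?R t))"
        by (rule integrable_norm, rule integrable_boundedI[OF _ *]) measurable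
    qed simp
    finally show ?thesis by simp
  qed
  have "((\<lambda>w. (cauchy_stieltjes M w - cauchy_stieltjes M z) / (w - z)) \<longlongrightarrow> ?D) (at z)"
  proof (rule LIM_zero_cancel, rule Lim_null_comparison)
    show "\<forall>\<^sub>F w in at z. norm ((cauchy_stieltjes M w - cauchy_stieltjes M z) / (w - z) - ?D)
        \<le> 2 / \<delta>^3 * norm (w - z)"
      unfolding eventually_at
    proof (intro exI[of _ "\<delta> / 2"] conjI ballI impI)
      fix w assume "w \<noteq> z \<and> dist w z < \<delta> / 2"
      then have w: "w - z \<noteq> 0" "norm (w - z) < \<delta> / 2" by (auto simp: dist_norm)
      have "(cauchy_stieltjes M w - cauchy_stieltjes M z) / (w - z) - ?D
          = (cauchy_stieltjes M w - cauchy_stieltjes M z - (w - z) * ?D) / (w - z)"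
        using w(1) by (simp add: field_simps)
      also have "norm \<dots> \<le> 2 / \<delta>^3 * (norm (w - z))\<^sup>2 / norm (w - z)"
        unfolding norm_divide using bound[OF w(2)] by (intro divide_right_mono) auto
      also have "\<dots> = 2 / \<delta>^3 * norm (w - z)" using w(1) by (simp add: power2_eq_square)
      finally show "norm ((cauchy_stieltjes M w - cauchy_stieltjes M z) / (w - z) - ?D)
        \<le> 2 / \<delta>^3 * norm (w - z)" .
    qed (use \<delta> in auto)
    show "((\<lambda>w. 2 / \<delta>^3 * norm (w - z)) \<longlongrightarrow> 0) (at z)"
      using tendsto_mult_left[OF tendsto_norm[OF LIM_zero[OF tendsto_ident_at]], of "2 / \<delta>^3" z UNIV] by simp
  qed
  then show ?thesis by (simp add: has_field_derivative_iff)
qed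

lemma (in real_distribution) cauchy_stieltjes_holomorphic:
  "cauchy_stieltjes M holomorphic_on {z. Im z > 0}"
proof (rule holomorphic_onI, rule field_differentiable_at_within)
  fix z :: complex assume "z \<in> {z. Im z > 0}"
  then have "Im z > 0" "AE t in M. Im z \<le> norm (complex_of_real t - z)"
    using order_trans[OF abs_ge_self norm_of_real_minus_ge_abs_Im] by auto
  then show "cauchy_stieltjes M field_differentiable at z"
    unfolding field_differentiable_def using cauchy_stieltjes_has_field_derivative by blast
qed

lemma integral_complex_Re_Im:
  fixes f :: "'a \<Rightarrow> complex"
  assumes "integrable M f"
  shows "Re (\<integral>x. f x \<partial>M) = (\<integral>x. Re (f x) \<partial>M)" "Im (\<integral>x. f x \<partial>M) = (\<integral>x. Im (f x) \<partial>M)"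
  using assms by auto

lemma (in real_distribution) integrable_cauchy_kernel:
  assumes "Im z \<noteq> 0"
  shows "integrable M (\<lambda>t. 1 / (complex_of_real t - z))"
proof (rule integrable_boundedI[where B = "1 / \<bar>Im z\<bar>"])
  show "AE t in M. norm (1 / (complex_of_real t - z)) \<le> 1 / \<bar>Im z\<bar>"
    unfolding norm_divide
    by (intro AE_I2)
       (use assms norm_of_real_minus_ge_abs_Im in \<open>auto intro!: divide_left_mono mult_pos_pos\<close>)
qed measurable

lemma (in real_distribution) Im_cauchy_stieltjes:
  assumes "Im z \<noteq> 0"
  shows "Im (cauchy_stieltjes M z) = (\<integral>t. Im z / ((t - Re z)\<^sup>2 + (Im z)\<^sup>2) \<partial>M)"
  unfolding cauchy_stieltjes_def integral_complex_Re_Im(2)[OF integrable_cauchy_kernel[OF assms]]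
  by (simp add: Im_divide)

subsection \<open>Laws on the nonnegative reals\<close>

locale nonneg_distribution = real_distribution +
  assumes nonneg: "supported_nonneg M"
begin

lemma AE_nonneg: "AE t in M. 0 \<le> t"
  using nonneg by (simp add: supported_nonneg_def)

lemma cauchy_stieltjes_holomorphic_cut_plane:
  "cauchy_stieltjes M holomorphic_on cut_plane"
proof (rule holomorphic_onI, rule field_differentiable_at_within)
  fix z assume "z \<in> cut_plane"
  then obtain \<delta> where "\<delta> > 0" "\<And>t. t \<ge> 0 \<Longrightarrow> \<delta> \<le> norm (complex_of_real t - z)"
    using cut_plane_distance by blast
  then have "\<delta> > 0" "AE t in M. \<delta> \<le> norm (complex_of_real t - z)"
    using AE_nonneg by auto
  then show "cauchy_stieltjes M field_differentiable at z"
    unfolding field_differentiable_def using cauchy_stieltjes_has_field_derivative by blast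
qed

lemma cauchy_stieltjes_negative_real:
  assumes "a > 0"
  shows "cauchy_stieltjes M (of_real (- a)) = of_real (\<integral>t. 1 / (t + a) \<partial>M)"
proof -
  have "cauchy_stieltjes M (of_real (- a)) = (\<integral>t. complex_of_real (1 / (t + a)) \<partial>M)"
    unfolding cauchy_stieltjes_def by simp
  then show ?thesis by (simp only: integral_complex_of_real)
qed

lemma integrable_inverse_shift:
  assumes "a > 0"
  shows "integrable M (\<lambda>t. 1 / (t + a))"
proof (rule integrable_boundedI[where B = "1 / a"])
  show "AE t in M. norm (1 / (t + a)) \<le> 1 / a"
    using AE_nonneg by eventually_elim (use assms in \<open>auto intro!: divide_left_mono\<close>)
qed measurable

lemma integral_inverse_shift_pos:
  assumes "a > 0"
  shows "(\<integral>t. 1 / (t + a) \<partial>M) > 0"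
proof -
  have "AE t in M. 0 < 1 / (t + a)"
    using AE_nonneg by eventually_elim (use assms in auto)
  with integrable_inverse_shift[OF assms] show ?thesis
    by (rule integral_pos) 
qed

text \<open>Both the \<open>m_transform\<close> and the Marchenko--Pastur equation are expressed through this integral: the former
  is \<open>resolvent_mean (- z) - 1\<close>, and the latter becomes \<open>resolvent_mean h = 1 + z h\<^sup>2\<close>.\<close>

definition resolvent_mean :: "complex \<Rightarrow> complex" where
  "resolvent_mean w = (\<integral>d. 1 / (1 + w * complex_of_real d) \<partial>M)"

lemma resolvent_mean_eq_cauchy_stieltjes:
  assumes "w \<noteq> 0"
  shows "resolvent_mean w = cauchy_stieltjes M (- 1 / w) / w"
proof -
  have "cauchy_stieltjes M (- 1 / w) / w = (\<integral>d. 1 / (complex_of_real d - (- 1 / w)) / w \<partial>M)"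
    unfolding cauchy_stieltjes_def by (rule integral_divide_zero[symmetric])
  also have "\<dots> = resolvent_mean w"
    unfolding resolvent_mean_def
  proof (rule Bochner_Integration.integral_cong)
    fix d
    have "(complex_of_real d - - 1 / w) * w = 1 + w * complex_of_real d"
      using assms by (simp add: distrib_left mult.commute)
    then show "1 / (complex_of_real d - - 1 / w) / w = 1 / (1 + w * complex_of_real d)"
      by simp
  qed simp
  finally show ?thesis by simp
qed

lemma neg_inverse_in_cut_plane: "Im w \<noteq> 0 \<or> Re w > 0 \<Longrightarrow> - 1 / w \<in> cut_plane"
  by (auto simp: cut_plane_def Re_divide Im_divide add_pos_nonneg sum_power2_gt_zero_iff divide_neg_pos
      zero_less_power2)

lemma resolvent_mean_holomorphic:
  "resolvent_mean holomorphic_on {w. Im w \<noteq> 0 \<or> Re w > 0}"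
proof -
  have "(\<lambda>w. cauchy_stieltjes M (- 1 / w) / w) holomorphic_on {w. Im w \<noteq> 0 \<or> Re w > 0}"
    by (intro holomorphic_intros holomorphic_on_compose_gen[OF _ cauchy_stieltjes_holomorphic_cut_plane,
          of "\<lambda>w. - 1 / w", unfolded o_def])
       (use neg_inverse_in_cut_plane in \<open>auto intro!: holomorphic_intros\<close>)
  then show ?thesis
    by (rule holomorphic_transform) (subst resolvent_mean_eq_cauchy_stieltjes, auto)
qed

end

section \<open>Injectivity of the transforms\<close>

lemma (in real_distribution) eq_dirac0_if_AE_zero:
  assumes "AE t in M. t = 0"
  shows "M = dirac0"
proof (rule measure_eqI)
  fix A assume "A \<in> sets M"
  then have A: "A \<in> sets borel" by simp
  show "emeasure M A = emeasure dirac0 A"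
  proof (cases "0 \<in> A")
    case True
    have "AE t in M. t \<in> A" using assms by eventually_elim (use True in auto)
    then have "emeasure M A = 1" using A by (simp add: emeasure_eq_1_AE)
    then show ?thesis using True A by (simp add: dirac0_def)
  next
    case False
    have "AE t in M. t \<notin> A" using assms by eventually_elim (use False in auto)
    then have "emeasure M A = 0" using A by (simp add: AE_iff_null_sets null_setsD1)
    then show ?thesis using False A by (simp add: dirac0_def)
  qed
qed (simp add: dirac0_def)

lemma Re_mult_square_roots_pos:
  assumes "Re (p\<^sup>2) > 0" "Re (q\<^sup>2) > 0" "Re p > 0" "Re q > 0"
  shows "Re (p * q) > 0" "Re (p * cnj q) > 0"
proof -
  have "\<bar>Im p\<bar> < Re p" "\<bar>Im q\<bar> < Re q"
    using assms power2_less_imp_less[of "\<bar>Im p\<bar>" "Re p"] power2_less_imp_less[of "\<bar>Im q\<bar>" "Re q"]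
    by (simp_all add: Re_power2)
  then have "\<bar>Im p\<bar> * \<bar>Im q\<bar> < Re p * Re q"
    by (intro mult_strict_mono') auto
  then have "\<bar>Im p * Im q\<bar> < Re p * Re q" by (simp add: abs_mult)
  then show "Re (p * q) > 0" "Re (p * cnj q) > 0" by auto
qed

text \<open>Writing \<open>g = p\<^sup>2\<close> and \<open>k = q\<^sup>2\<close>, the reciprocal \<open>(1 + g t) (1 + k t) / (t p q)\<close> is the sum
  \<open>1 / (t p q) + p / q + q / p + t p q\<close>, whose terms all have positive real part because the
  arguments of \<open>p\<close> and \<open>q\<close> are below \<open>\<pi> / 4\<close> in modulus.\<close>

lemma Re_divided_difference_pos:
  assumes pq: "Re (p\<^sup>2) > 0" "Re (q\<^sup>2) > 0" "Re p > 0" "Re q > 0" and t: "t > 0"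
  shows "Re (p * q * (of_real t / ((1 + p\<^sup>2 * of_real t) * (1 + q\<^sup>2 * of_real t)))) > 0"
proof -
  note pos = Re_mult_square_roots_pos[OF pq]
  have ne: "p \<noteq> 0" "q \<noteq> 0" using pq by auto
  have N: "1 + p\<^sup>2 * of_real t \<noteq> 0" "1 + q\<^sup>2 * of_real t \<noteq> 0"
  proof -
    have "Re (1 + p\<^sup>2 * of_real t) > 0" "Re (1 + q\<^sup>2 * of_real t) > 0"
      using pq t by (simp_all add: add_pos_nonneg)
    then show "1 + p\<^sup>2 * of_real t \<noteq> 0" "1 + q\<^sup>2 * of_real t \<noteq> 0"
      by (metis less_irrefl zero_complex.sel(1))+
  qed
  let ?E = "p * q * (of_real t / ((1 + p\<^sup>2 * of_real t) * (1 + q\<^sup>2 * of_real t)))"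
  have inv: "inverse ?E = inverse (of_real t) * inverse (p * q) + p * inverse q + q * inverse p + of_real t * (p * q)"
  proof -
    have "inverse ?E = ((1 + p\<^sup>2 * of_real t) * (1 + q\<^sup>2 * of_real t)) / (p * q * of_real t)"
      by (simp add: field_class.field_divide_inverse mult_ac)
    also have "\<dots> = inverse (of_real t) * inverse (p * q) + p * inverse q + q * inverse p + of_real t * (p * q)"
      using ne t by (simp add: divide_simps power2_eq_square) (simp add: algebra_simps)
    finally show ?thesis .
  qed
  have Re_inv: "Re (inverse c) > 0 \<longleftrightarrow> Re c > 0" for c
  proof (cases "c = 0")
    case False
    then have "(Re c)\<^sup>2 + (Im c)\<^sup>2 > 0" by (simp add: complex_neq_0)
    then show ?thesis by (simp add: zero_less_divide_iff)
  qed simp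
  have Re_div: "Re (a * inverse b) > 0" if "Re (a * cnj b) > 0" for a b
  proof -
    have "b \<noteq> 0" using that by auto
    have "a * inverse b = a * cnj b / of_real ((norm b)\<^sup>2)"
      using complex_div_cnj[of a b] by (simp add: field_class.field_divide_inverse)
    then show ?thesis using that \<open>b \<noteq> 0\<close> by (simp only: Re_divide_of_real) simp
  qed
  have "Re (q * cnj p) > 0" using pos(2) by (simp add: mult.commute)
  moreover have "Re (inverse (of_real t) * inverse (p * q)) > 0"
    using Re_inv[of "of_real t * (p * q)"] pos(1) t by (simp add: mult.assoc)
  moreover have "Re (of_real t * (p * q)) > 0"
    using pos(1) t by simp
  ultimately have "Re (inverse ?E) > 0"
    unfolding inv plus_complex.sel using Re_div pos(2) by (meson add_pos_pos)
  then show ?thesis using Re_inv by blast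
qed

lemma (in nonneg_distribution) m_transform_eq_resolvent_mean:
  assumes "Re z < 0"
  shows "integrable M (\<lambda>t. 1 / (1 - z * complex_of_real t))"
    and "m_transform M z = resolvent_mean (- z) - 1"
proof -
  have ge: "1 \<le> norm (1 - z * complex_of_real t)" if "0 \<le> t" for t
    using order_trans[OF _ complex_Re_le_cmod[of "1 - z * complex_of_real t"], of 1] assms that
    by (simp add: mult_nonpos_nonneg)
  show int: "integrable M (\<lambda>t. 1 / (1 - z * complex_of_real t))"
  proof (rule integrable_boundedI[where B = 1])
    show "AE t in M. norm (1 / (1 - z * complex_of_real t)) \<le> 1"
      using AE_nonneg by eventually_elim (use ge in \<open>auto simp: norm_divide divide_le_eq_1\<close>)
  qed measurable
  have "m_transform M z = (\<integral>t. 1 / (1 - z * complex_of_real t) - 1 \<partial>M)"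
    unfolding m_transform_def
  proof (rule integral_cong_AE)
    show "AE t in M. z * complex_of_real t / (1 - z * complex_of_real t)
        = 1 / (1 - z * complex_of_real t) - 1"
      using AE_nonneg
    proof eventually_elim
      case (elim t)
      then have "1 - z * complex_of_real t \<noteq> 0" using ge[of t] by auto
      then show ?case by (simp add: field_simps)
    qed
  qed measurable
  also have "\<dots> = resolvent_mean (- z) - 1"
    unfolding resolvent_mean_def using int by simp
  finally show "m_transform M z = resolvent_mean (- z) - 1" .
qed

text \<open>The difference of two values is \<open>u - v\<close> times the mean of \<open>t / ((1 - u t) (1 - v t))\<close>. Multiplied by
  \<open>p q\<close>, where \<open>p\<close> and \<open>q\<close> are the square roots of \<open>- u\<close> and \<open>- v\<close>, this kernel has positive real part
  for \<open>t > 0\<close>, so its mean vanishes only if the law sits at zero.\<close>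

lemma (in nonneg_distribution) m_transform_inj_on:
  assumes "M \<noteq> dirac0"
  shows "inj_on (m_transform M) left_half_plane"
proof (rule inj_onI, rule ccontr)
  fix u v assume uv: "u \<in> left_half_plane" "v \<in> left_half_plane" "m_transform M u = m_transform M v" "u \<noteq> v"
  define p q where "p = csqrt (- u)" and "q = csqrt (- v)"
  have neg: "Re u < 0" "Re v < 0" using uv by (auto simp: left_half_plane_def)
  have sq: "p\<^sup>2 = - u" "q\<^sup>2 = - v" by (simp_all add: p_def q_def)
  have "(Re p)\<^sup>2 - (Im p)\<^sup>2 = - Re u" "(Re q)\<^sup>2 - (Im q)\<^sup>2 = - Re v"
    using arg_cong[OF sq(1), of Re] arg_cong[OF sq(2), of Re] by (simp_all add: power2_eq_square)
  then have "(Re p)\<^sup>2 > 0" "(Re q)\<^sup>2 > 0"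
    using neg zero_le_power2[of "Im p"] zero_le_power2[of "Im q"] by linarith+
  then have "Re p \<noteq> 0" "Re q \<noteq> 0" by auto
  moreover have "Re p \<ge> 0" "Re q \<ge> 0" by (simp_all add: p_def q_def csqrt.sel complex_Re_le_cmod)
  ultimately have pq: "Re (p\<^sup>2) > 0" "Re (q\<^sup>2) > 0" "Re p > 0" "Re q > 0"
    using neg by (auto simp: sq)
  let ?k = "\<lambda>t. of_real t / ((1 + p\<^sup>2 * of_real t) * (1 + q\<^sup>2 * of_real t)) :: complex"
  have eq: "1 / (1 - u * complex_of_real t) - 1 / (1 - v * complex_of_real t) = (u - v) * ?k t"
    if "0 \<le> t" for t
  proof -
    have "Re (1 + p\<^sup>2 * of_real t) > 0" "Re (1 + q\<^sup>2 * of_real t) > 0"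
      using pq that by (simp_all add: add_pos_nonneg)
    then have "1 + p\<^sup>2 * of_real t \<noteq> 0" "1 + q\<^sup>2 * of_real t \<noteq> 0"
      by (metis less_irrefl zero_complex.sel(1))+
    then show ?thesis by (simp add: sq field_simps)
  qed
  have int: "integrable M (\<lambda>t. 1 / (1 - u * complex_of_real t) - 1 / (1 - v * complex_of_real t))"
    by (intro Bochner_Integration.integrable_diff m_transform_eq_resolvent_mean(1) neg)
  have "integrable M (\<lambda>t. (u - v) * ?k t)"
    by (rule integrable_cong_AE_imp[OF int]) (use AE_nonneg eq in auto)
  then have intk: "integrable M ?k" using uv(4) integrable_cmult_cancel[of M "u - v" ?k] by auto
  have "(u - v) * (\<integral>t. ?k t \<partial>M) = (\<integral>t. (u - v) * ?k t \<partial>M)"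
    by (rule integral_mult_right_zero[symmetric])
  also have "\<dots> = (\<integral>t. 1 / (1 - u * complex_of_real t) - 1 / (1 - v * complex_of_real t) \<partial>M)"
    by (rule integral_cong_AE) (use AE_nonneg eq in auto)
  also have "\<dots> = m_transform M u - m_transform M v"
    using m_transform_eq_resolvent_mean[OF neg(1)] m_transform_eq_resolvent_mean[OF neg(2)]
    by (simp add: resolvent_mean_def)
  finally have "(\<integral>t. ?k t \<partial>M) = 0" using uv by simp
  then have "Re (\<integral>t. p * q * ?k t \<partial>M) = 0" by (simp only: integral_mult_right_zero) simp
  moreover have intpqk: "integrable M (\<lambda>t. p * q * ?k t)" by (rule integrable_mult_right) (rule intk)
  ultimately have zero: "(\<integral>t. Re (p * q * ?k t) \<partial>M) = 0" by (metis integral_complex_Re_Im(1))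
  have nn: "AE t in M. 0 \<le> Re (p * q * ?k t)"
    using AE_nonneg
  proof eventually_elim
    case (elim t)
    then show ?case using Re_divided_difference_pos[OF pq, of t] by (cases "t = 0") (auto simp: less_imp_le)
  qed
  have "integrable M (\<lambda>t. Re (p * q * ?k t))" using intpqk by (rule integrable_Re)
  then have "AE t in M. Re (p * q * ?k t) = 0"
    using zero nn by (subst (asm) integral_nonneg_eq_0_iff_AE)
  then have "AE t in M. t = 0"
    using AE_nonneg
  proof eventually_elim
    case (elim t)
    then show ?case using Re_divided_difference_pos[OF pq, of t] by (cases "t = 0") auto
  qed
  then show False using eq_dirac0_if_AE_zero assms by blast
qed

lemma (in real_distribution) symmetric_integral_uminus:
  fixes f :: "real \<Rightarrow> 'a :: {banach, second_countable_topology}"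
  assumes "symmetric_measure M" "f \<in> borel_measurable borel"
  shows "(\<integral>t. f (- t) \<partial>M) = (\<integral>t. f t \<partial>M)"
proof -
  have "(\<integral>t. f t \<partial>distr M borel uminus) = (\<integral>t. f (- t) \<partial>M)"
    by (rule integral_distr) (use assms in auto)
  then show ?thesis using assms(1) by (simp add: symmetric_measure_def)
qed

lemma upper_sector_square: "u \<in> upper_sector \<Longrightarrow> Re (u\<^sup>2) < 0"
  using power_strict_mono[of "\<bar>Re u\<bar>" "Im u" 2] by (auto simp: upper_sector_def power2_eq_square)

lemma upper_sector_eq_iff_square_eq:
  "u \<in> upper_sector \<Longrightarrow> v \<in> upper_sector \<Longrightarrow> u\<^sup>2 = v\<^sup>2 \<Longrightarrow> u = v"
  by (auto simp: upper_sector_def power2_eq_iff)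

lemma square_law:
  assumes "real_distribution M"
  shows "nonneg_distribution (distr M borel power2)"
proof -
  interpret real_distribution M by fact
  interpret D: prob_space "distr M borel power2" by (rule prob_space_distr) simp
  show ?thesis
    by unfold_locales (auto simp: supported_nonneg_def AE_distr_iff)
qed

text \<open>Averaging the kernel over \<open>t\<close> and \<open>- t\<close> turns \<open>u t / (1 - u t)\<close> into
  \<open>u\<^sup>2 t\<^sup>2 / (1 - u\<^sup>2 t\<^sup>2)\<close>, so the transform of a symmetric law is the transform of
  the law of the square, at \<open>u\<^sup>2\<close>.\<close>

lemma (in real_distribution) m_transform_symmetric:
  assumes sym: "symmetric_measure M" and u: "u \<in> upper_sector"
  shows "m_transform M u = m_transform (distr M borel power2) (u\<^sup>2)"
proof -
  interpret S: nonneg_distribution "distr M borel power2" by (rule square_law) unfold_locales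
  have Im: "Im u > 0" using u by (auto simp: upper_sector_def)
  have ne: "1 - u * complex_of_real t \<noteq> 0" for t
    using Im by (cases "t = 0") (auto simp: complex_eq_iff)
  have int: "integrable M (\<lambda>t. u * complex_of_real t / (1 - u * complex_of_real t))"
  proof (rule integrable_boundedI[where B = "norm u / Im u"])
    have "norm (u * complex_of_real t / (1 - u * complex_of_real t)) \<le> norm u / Im u" for t
    proof -
      have "\<bar>t\<bar> * Im u \<le> norm (1 - u * complex_of_real t)"
        using abs_Im_le_cmod[of "1 - u * complex_of_real t"] Im by (simp add: abs_mult mult.commute)
      then have "norm u * (\<bar>t\<bar> * Im u) \<le> norm u * norm (1 - u * complex_of_real t)"
        by (rule mult_left_mono) simp
      then show ?thesis using Im ne[of t] by (simp add: norm_divide norm_mult divide_simps mult_ac)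
    qed
    then show "AE t in M. norm (u * complex_of_real t / (1 - u * complex_of_real t)) \<le> norm u / Im u"
      by simp
  qed measurable
  let ?f = "\<lambda>t. u * complex_of_real t / (1 - u * complex_of_real t)"
  have flip: "integrable M (\<lambda>t. ?f (- t))"
  proof -
    have "integrable (distr M borel uminus) ?f"
      using int sym by (simp add: symmetric_measure_def)
    then show ?thesis by (subst (asm) integrable_distr_eq) auto
  qed
  have "2 * m_transform M u = (\<integral>t. ?f t \<partial>M) + (\<integral>t. ?f (- t) \<partial>M)"
    using symmetric_integral_uminus[OF sym, of ?f] by (simp add: m_transform_def)
  also have "\<dots> = (\<integral>t. ?f t + ?f (- t) \<partial>M)"
    by (rule Bochner_Integration.integral_add[symmetric]) (fact int flip)+
  also have "\<dots> = (\<integral>t. 2 * (u\<^sup>2 * complex_of_real (t\<^sup>2) / (1 - u\<^sup>2 * complex_of_real (t\<^sup>2))) \<partial>M)"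
  proof (rule Bochner_Integration.integral_cong)
    fix t
    have a: "1 - u * complex_of_real t \<noteq> 0" "1 + u * complex_of_real t \<noteq> 0"
      using ne[of t] ne[of "- t"] by auto
    have b: "1 - u\<^sup>2 * complex_of_real (t\<^sup>2) = (1 - u * complex_of_real t) * (1 + u * complex_of_real t)"
      by (simp add: power2_eq_square algebra_simps)
    show "?f t + ?f (- t) = 2 * (u\<^sup>2 * complex_of_real (t\<^sup>2) / (1 - u\<^sup>2 * complex_of_real (t\<^sup>2)))"
      unfolding b using a by (simp add: divide_simps power2_eq_square) (simp add: algebra_simps)
  qed simp
  also have "\<dots> = 2 * m_transform (distr M borel power2) (u\<^sup>2)"
    unfolding m_transform_def by (subst integral_distr) (auto simp only: integral_mult_right_zero, simp_all)
  finally show ?thesis by simp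
qed

text \<open>On the sector squaring is injective and lands in the left half plane, so the claim reduces to the law
  of the square.\<close>

lemma (in real_distribution) m_transform_symmetric_inj_on:
  assumes sym: "symmetric_measure M" and ne: "M \<noteq> dirac0"
  shows "inj_on (m_transform M) upper_sector"
proof (rule inj_onI)
  fix u v assume uv: "u \<in> upper_sector" "v \<in> upper_sector" "m_transform M u = m_transform M v"
  interpret S: nonneg_distribution "distr M borel power2" by (rule square_law) unfold_locales
  have "distr M borel power2 \<noteq> dirac0"
  proof
    assume *: "distr M borel power2 = dirac0"
    have "AE x in dirac0. x = (0 :: real)" by (subst dirac0_def, subst AE_return) auto
    then have "AE x in distr M borel power2. x = (0 :: real)" by (simp only: *)
    then have "AE x in M. x\<^sup>2 = 0" by (subst (asm) AE_distr_iff) auto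
    then show False using eq_dirac0_if_AE_zero ne by simp
  qed
  from S.m_transform_inj_on[OF this] have "u\<^sup>2 = v\<^sup>2"
    using uv upper_sector_square[OF uv(1)] upper_sector_square[OF uv(2)]
    by (auto simp: m_transform_symmetric[OF sym] left_half_plane_def dest: inj_onD)
  then show "u = v" using uv upper_sector_eq_iff_square_eq by blast
qed

section \<open>The Marchenko--Pastur equation at a single point\<close>

text \<open>The second bound holds because \<open>cnj w (1 + w d) = cnj w + \<bar>w\<bar>\<^sup>2 d\<close> has imaginary part \<open>- Im w\<close>.\<close>

lemma norm_one_plus_mult_ge:
  assumes "Im w > 0"
  shows "Im w * \<bar>d\<bar> \<le> norm (1 + w * complex_of_real d)"
    and "Im w / norm w \<le> norm (1 + w * complex_of_real d)"
    and "0 < norm (1 + w * complex_of_real d)"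
proof -
  show "Im w * \<bar>d\<bar> \<le> norm (1 + w * complex_of_real d)"
    using abs_Im_le_cmod[of "1 + w * complex_of_real d"] assms by (simp add: abs_mult)
  have "cnj w * (1 + w * complex_of_real d) = cnj w + of_real ((norm w)\<^sup>2 * d)"
    unfolding of_real_mult complex_norm_square by (simp add: distrib_left mult_ac)
  then have "Im (cnj w * (1 + w * complex_of_real d)) = - Im w" by simp
  then have "Im w \<le> norm (cnj w * (1 + w * complex_of_real d))"
    using abs_Im_le_cmod[of "cnj w * (1 + w * complex_of_real d)"] by simp
  then have "Im w \<le> norm w * norm (1 + w * complex_of_real d)" by (simp add: norm_mult)
  moreover have "norm w > 0" using assms by auto
  ultimately show *: "Im w / norm w \<le> norm (1 + w * complex_of_real d)"
    by (simp add: field_simps)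
  have "0 < Im w / norm w" using assms \<open>norm w > 0\<close> by simp
  with * show "0 < norm (1 + w * complex_of_real d)" by linarith
qed

locale mean_one_distribution = nonneg_distribution +
  assumes mean: "has_bochner_integral M (\<lambda>d. d) 1"
begin

lemma integrable_id: "integrable M (\<lambda>d. d)" and integral_id: "(\<integral>d. d \<partial>M) = 1"
  using mean by (auto simp: has_bochner_integral_iff)

lemma integrable_linear_boundI:
  fixes f :: "real \<Rightarrow> 'a :: {banach, second_countable_topology}"
  assumes "f \<in> borel_measurable borel" and "\<And>d. 0 \<le> d \<Longrightarrow> norm (f d) \<le> A + B * d"
  shows "integrable M f"
proof (rule Bochner_Integration.integrable_bound)
  show "integrable M (\<lambda>d. A + B * d)" using integrable_id by simp
  show "f \<in> borel_measurable M" using assms(1) by simp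
  show "AE d in M. norm (f d) \<le> norm (A + B * d)"
    using AE_nonneg
  proof eventually_elim
    case (elim d)
    then show ?case using assms(2)[of d] by (simp add: order_trans[OF _ abs_ge_self])
  qed
qed

lemma not_AE_zero: "\<not> (AE d in M. d = 0)"
proof
  assume "AE d in M. d = 0"
  then have "(\<integral>d. d \<partial>M) = (\<integral>d. 0 \<partial>M)" by (intro integral_cong_AE) auto
  then show False by (simp add: integral_id)
qed

lemma integral_pos_of_pos:
  fixes f :: "real \<Rightarrow> real"
  assumes int: "integrable M f" and nn: "\<And>d. 0 \<le> d \<Longrightarrow> 0 \<le> f d" and pos: "\<And>d. 0 < d \<Longrightarrow> 0 < f d"
  shows "0 < (\<integral>d. f d \<partial>M)"
proof -
  have AEnn: "AE d in M. 0 \<le> f d" using AE_nonneg by eventually_elim (use nn in auto)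
  have "(\<integral>d. f d \<partial>M) \<noteq> 0"
  proof
    assume "(\<integral>d. f d \<partial>M) = 0"
    then have "AE d in M. f d = 0" using integral_nonneg_eq_0_iff_AE[OF int AEnn] by simp
    then have "AE d in M. d = 0"
      using AE_nonneg
    proof eventually_elim
      case (elim d)
      then show ?case using pos[of d] by (cases "d = 0") auto
    qed
    then show False using not_AE_zero by simp
  qed
  moreover have "(\<integral>d. f d \<partial>M) \<ge> 0" using AEnn by (rule integral_nonneg_AE)
  ultimately show ?thesis by linarith
qed

text \<open>For \<open>w = h z\<close> the imaginary parts of the integrals \<open>E [D ^ k / (1 + w D)]\<close> occurring in the
  Marchenko--Pastur equation are multiples of these real moments.\<close>

definition moment :: "nat \<Rightarrow> complex \<Rightarrow> real" where
  "moment k w = (\<integral>d. d ^ k / (norm (1 + w * complex_of_real d))\<^sup>2 \<partial>M)"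

definition cmoment :: "nat \<Rightarrow> complex \<Rightarrow> complex" where
  "cmoment k w = (\<integral>d. complex_of_real (d ^ k) / (1 + w * complex_of_real d) \<partial>M)"

context
  fixes w :: complex
  assumes w: "Im w > 0"
begin

lemma integrable_cmoment:
  assumes "k \<le> 2"
  shows "integrable M (\<lambda>d. complex_of_real (d ^ k) / (1 + w * complex_of_real d))"
proof -
  note pos = norm_one_plus_mult_ge(3)[OF w]
  have b: "d / norm (1 + w * complex_of_real d) \<le> 1 / Im w" if "0 \<le> d" for d
    using norm_one_plus_mult_ge(1)[OF w, of d] w pos[of d] that by (simp add: field_simps)
  have b0: "1 / norm (1 + w * complex_of_real d) \<le> norm w / Im w" for d
  proof -
    have "norm w > 0" using w by auto
    then show ?thesis
      using norm_one_plus_mult_ge(2)[OF w, of d] w pos[of d] by (simp add: field_simps)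
  qed
  have "k = 0 \<or> k = 1 \<or> k = 2" using assms by auto
  then show ?thesis
  proof (elim disjE)
    assume "k = 0"
    then show ?thesis using b0
      by (intro integrable_linear_boundI[where A = "norm w / Im w" and B = 0]) (auto simp: norm_divide)
  next
    assume "k = 1"
    then show ?thesis using b
      by (intro integrable_linear_boundI[where A = "1 / Im w" and B = 0]) (auto simp: norm_divide)
  next
    assume k: "k = 2"
    have "norm (complex_of_real (d\<^sup>2) / (1 + w * complex_of_real d)) \<le> 0 + 1 / Im w * d" if "0 \<le> d" for d
      using mult_right_mono[OF b[OF that] that] by (simp add: norm_divide power2_eq_square norm_mult that)
    then show ?thesis unfolding k by (intro integrable_linear_boundI[where A = 0 and B = "1 / Im w"]) (auto simp del: of_real_power)
  qed
qed

lemma integrable_moment: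
  assumes "k \<le> 3"
  shows "integrable M (\<lambda>d. d ^ k / (norm (1 + w * complex_of_real d))\<^sup>2)"
proof -
  note pos = norm_one_plus_mult_ge(3)[OF w]
  have b: "d / norm (1 + w * complex_of_real d) \<le> 1 / Im w" if "0 \<le> d" for d
    using norm_one_plus_mult_ge(1)[OF w, of d] w pos[of d] that by (simp add: field_simps)
  have b0: "1 / norm (1 + w * complex_of_real d) \<le> norm w / Im w" for d
  proof -
    have "norm w > 0" using w by auto
    then show ?thesis
      using norm_one_plus_mult_ge(2)[OF w, of d] w pos[of d] by (simp add: field_simps)
  qed
  have sq0: "1 / (norm (1 + w * complex_of_real d))\<^sup>2 \<le> (norm w / Im w)\<^sup>2" for d
    using power_mono[OF b0[of d], of 2] by (simp add: power_divide)
  have sq2: "d\<^sup>2 / (norm (1 + w * complex_of_real d))\<^sup>2 \<le> (1 / Im w)\<^sup>2" if "0 \<le> d" for d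
    using power_mono[OF b[OF that], of 2] that by (simp add: power_divide)
  have b1: "norm (d ^ 1 / (norm (1 + w * complex_of_real d))\<^sup>2) \<le> 0 + (norm w / Im w)\<^sup>2 * d"
    and b3: "norm (d ^ 3 / (norm (1 + w * complex_of_real d))\<^sup>2) \<le> 0 + (1 / Im w)\<^sup>2 * d" if d: "0 \<le> d" for d
    using mult_right_mono[OF sq0[of d] d] mult_right_mono[OF sq2[OF d] d] d
    by (simp_all add: power3_eq_cube power2_eq_square)
  have "k = 0 \<or> k = 1 \<or> k = 2 \<or> k = 3" using assms by auto
  then show ?thesis
  proof (elim disjE)
    assume k: "k = 0"
    show ?thesis unfolding k
      by (rule integrable_linear_boundI[where A = "(norm w / Im w)\<^sup>2" and B = 0]) (use sq0 in auto)
  next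
    assume k: "k = 1"
    show ?thesis unfolding k by (rule integrable_linear_boundI[OF _ b1]) auto
  next
    assume k: "k = 2"
    show ?thesis unfolding k
      by (rule integrable_linear_boundI[where A = "(1 / Im w)\<^sup>2" and B = 0]) (use sq2 in auto)
  next
    assume k: "k = 3"
    show ?thesis unfolding k by (rule integrable_linear_boundI[OF _ b3]) auto
  qed
qed

lemma cmoment_eq_moments:
  assumes "k \<le> 2"
  shows "cmoment k w = of_real (moment k w) + cnj w * of_real (moment (Suc k) w)"
proof -
  have eq: "complex_of_real (d ^ k) / (1 + w * complex_of_real d)
      = of_real (d ^ k / (norm (1 + w * complex_of_real d))\<^sup>2)
        + cnj w * of_real (d ^ Suc k / (norm (1 + w * complex_of_real d))\<^sup>2)" for d
    using complex_div_cnj[of "complex_of_real (d ^ k)" "1 + w * complex_of_real d"]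
    by (simp add: add_divide_distrib distrib_left mult_ac)
  have int: "integrable M (\<lambda>d. complex_of_real (d ^ k / (norm (1 + w * complex_of_real d))\<^sup>2))"
    "integrable M (\<lambda>d. cnj w * complex_of_real (d ^ Suc k / (norm (1 + w * complex_of_real d))\<^sup>2))"
    using integrable_moment[of k] integrable_moment[of "Suc k"] assms
    by (auto intro: integrable_mult_right integrable_of_real simp del: power_Suc of_real_divide)
  have "cmoment k w = (\<integral>d. complex_of_real (d ^ k / (norm (1 + w * complex_of_real d))\<^sup>2) \<partial>M)
      + (\<integral>d. cnj w * complex_of_real (d ^ Suc k / (norm (1 + w * complex_of_real d))\<^sup>2) \<partial>M)"
    unfolding cmoment_def eq by (rule Bochner_Integration.integral_add[OF int])
  also have "\<dots> = of_real (moment k w) + cnj w * of_real (moment (Suc k) w)"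
    unfolding moment_def by (simp only: integral_mult_right_zero integral_complex_of_real)
  finally show ?thesis .
qed

lemma moment_recurrence:
  assumes "k \<le> 1"
  shows "moment k w + 2 * Re w * moment (Suc k) w + (norm w)\<^sup>2 * moment (Suc (Suc k)) w = 1"
proof -
  let ?n = "\<lambda>d. (norm (1 + w * complex_of_real d))\<^sup>2"
  have "d ^ k = d ^ k / ?n d + 2 * Re w * (d ^ Suc k / ?n d) + (norm w)\<^sup>2 * (d ^ Suc (Suc k) / ?n d)" for d
  proof -
    have n: "?n d > 0" using norm_one_plus_mult_ge(3)[OF w, of d] by simp
    have "?n d = 1 + 2 * Re w * d + (norm w)\<^sup>2 * d\<^sup>2"
      unfolding cmod_power2 by (simp add: power2_eq_square algebra_simps)
    then have "d ^ k * ?n d = d ^ k + 2 * Re w * d ^ Suc k + (norm w)\<^sup>2 * d ^ Suc (Suc k)"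
      by (simp add: algebra_simps power2_eq_square)
    then have "(d ^ k * ?n d) / ?n d = (d ^ k + 2 * Re w * d ^ Suc k + (norm w)\<^sup>2 * d ^ Suc (Suc k)) / ?n d"
      by (simp only:)
    moreover have "(d ^ k * ?n d) / ?n d = d ^ k" using n by simp
    ultimately show ?thesis by (simp only: add_divide_distrib times_divide_eq_right)
  qed
  then have "(\<integral>d. d ^ k \<partial>M)
      = (\<integral>d. d ^ k / ?n d + 2 * Re w * (d ^ Suc k / ?n d) + (norm w)\<^sup>2 * (d ^ Suc (Suc k) / ?n d) \<partial>M)"
    by (intro Bochner_Integration.integral_cong) auto
  also have "\<dots> = moment k w + 2 * Re w * moment (Suc k) w + (norm w)\<^sup>2 * moment (Suc (Suc k)) w"
  proof -
    have lin: "(\<integral>d. f d + a * g d + b * k d \<partial>M) = (\<integral>d. f d \<partial>M) + a * (\<integral>d. g d \<partial>M) + b * (\<integral>d. k d \<partial>M)"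
      if "integrable M f" "integrable M g" "integrable M k" for f g k and a b :: real
      using that by simp
    show ?thesis unfolding moment_def
      by (rule lin; rule integrable_moment) (use assms in auto)
  qed
  also have "(\<integral>d. d ^ k \<partial>M) = 1"
  proof (cases "k = 0")
    case False
    then have "k = 1" using assms by simp
    then show ?thesis by (simp add: integral_id)
  qed simp
  finally show ?thesis by simp
qed

text \<open>From \<open>D ^ k = D ^ k / (1 + w D) + w D ^ (k + 1) / (1 + w D)\<close>; the mean of \<open>D ^ k\<close> is one for both \<open>k = 0\<close>
  and \<open>k = 1\<close>.\<close>

lemma cmoment_recurrence:
  assumes "k \<le> 1"
  shows "cmoment k w = 1 - w * cmoment (Suc k) w"
proof -
  have eq: "complex_of_real (d ^ k) = complex_of_real (d ^ k) / (1 + w * complex_of_real d)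
      + w * (complex_of_real (d ^ Suc k) / (1 + w * complex_of_real d))" for d
  proof -
    have n: "1 + w * complex_of_real d \<noteq> 0" using norm_one_plus_mult_ge(3)[OF w, of d] by auto
    then show ?thesis by (simp add: divide_simps) (simp add: algebra_simps)
  qed
  have "(\<integral>d. complex_of_real (d ^ k) \<partial>M) = (\<integral>d. complex_of_real (d ^ k) / (1 + w * complex_of_real d)
      + w * (complex_of_real (d ^ Suc k) / (1 + w * complex_of_real d)) \<partial>M)"
    by (rule Bochner_Integration.integral_cong[OF refl eq])
  also have "\<dots> = cmoment k w + w * cmoment (Suc k) w"
  proof -
    have lin: "(\<integral>d. f d + a * g d \<partial>M) = (\<integral>d. f d \<partial>M) + a * (\<integral>d. g d \<partial>M)"
      if "integrable M f" "integrable M g" for f g and a :: complex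
      using that by simp
    show ?thesis unfolding cmoment_def
      by (rule lin; rule integrable_cmoment) (use assms in auto)
  qed
  also have "(\<integral>d. complex_of_real (d ^ k) \<partial>M) = 1"
  proof (cases "k = 0")
    case False
    then have "k = 1" using assms by simp
    then show ?thesis by (simp add: integral_id)
  qed simp
  finally show ?thesis by (simp add: algebra_simps)
qed

lemma moment_pos: "k \<le> 3 \<Longrightarrow> 0 < moment k w"
  unfolding moment_def
  using norm_one_plus_mult_ge(3)[OF w]
  by (intro integral_pos_of_pos integrable_moment) (auto intro!: divide_pos_pos)

end

lemma resolvent_mean_eq_cmoment: "resolvent_mean w = cmoment 0 w"
  by (simp add: resolvent_mean_def cmoment_def)

text \<open>The graph of the solution of the Marchenko--Pastur equation, in the form
  \<open>E [1 / (1 + w D)] = 1 + z w\<^sup>2\<close>.\<close>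

definition MP_graph :: "complex \<Rightarrow> complex \<Rightarrow> bool" where
  "MP_graph z w \<longleftrightarrow> Im w > 0 \<and> resolvent_mean w = 1 + z * w\<^sup>2"

lemma MP_graphD:
  assumes "MP_graph z w"
  shows "Im w > 0" "w \<noteq> 0" "cmoment 1 w = - z * w" "w * cmoment 2 w = 1 + z * w"
proof -
  show w: "Im w > 0" using assms by (simp add: MP_graph_def)
  then show ne: "w \<noteq> 0" by auto
  have "w * cmoment 1 w = w * (- z * w)"
    using assms cmoment_recurrence[OF w, of 0]
    by (simp add: MP_graph_def resolvent_mean_eq_cmoment power2_eq_square algebra_simps eq_neg_iff_add_eq_0)
  then show 1: "cmoment 1 w = - z * w" by (rule mult_left_cancel[OF ne, THEN iffD1])
  show "w * cmoment 2 w = 1 + z * w"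
    using cmoment_recurrence[OF w, of 1] 1 by (simp add: numeral_2_eq_2 algebra_simps)
qed

lemma MP_graph_fixed_pointI:
  assumes w: "Im w > 0" and eq: "w = inverse (cmoment 2 w - z)"
  shows "MP_graph z w"
proof -
  have ne: "w \<noteq> 0" using w by auto
  have "inverse w = cmoment 2 w - z" using eq by (metis inverse_inverse_eq)
  then have "w * cmoment 2 w = 1 + z * w" using ne by (simp add: field_simps)
  then have "cmoment 1 w = - z * w"
    using cmoment_recurrence[OF w, of 1] by (simp add: numeral_2_eq_2 algebra_simps)
  then have "cmoment 0 w = 1 + z * w\<^sup>2"
    using cmoment_recurrence[OF w, of 0] by (simp add: power2_eq_square algebra_simps)
  then show ?thesis using w by (simp add: MP_graph_def resolvent_mean_eq_cmoment)
qed

text \<open>The imaginary part of \<open>z = E [D\<^sup>2 / (1 + w D)] - 1 / w\<close>. Its sign turns \<open>Im z \<ge> 0\<close> into a bound on the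
  third moment, on which the Hoelder estimate rests.\<close>

lemma MP_graph_Im:
  assumes "MP_graph z w"
  shows "Im z * (norm w)\<^sup>2 = Im w * (1 - (norm w)\<^sup>2 * moment 3 w)"
proof -
  note w = MP_graphD[OF assms]
  have "z = cmoment 2 w - 1 / w" using w by (simp add: field_simps)
  moreover have "Im (1 / w) = - Im w / (norm w)\<^sup>2" by (simp add: Im_divide cmod_power2)
  moreover have "Im (cmoment 2 w) = - Im w * moment 3 w"
    using cmoment_eq_moments[OF w(1), of 2] by (simp add: numeral_3_eq_3 numeral_2_eq_2)
  ultimately have "Im z = Im w / (norm w)\<^sup>2 - Im w * moment 3 w" by simp
  then show ?thesis using w(2) by (simp add: field_simps)
qed

lemma MP_graph_moment3_le:
  assumes "MP_graph z w" "Im z \<ge> 0"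
  shows "(norm w)\<^sup>2 * moment 3 w \<le> 1"
proof -
  have "0 \<le> Im w * (1 - (norm w)\<^sup>2 * moment 3 w)"
    using MP_graph_Im[OF assms(1)] assms(2) by (metis mult_nonneg_nonneg zero_le_power2)
  then show ?thesis using MP_graphD(1)[OF assms(1)] by (simp add: zero_le_mult_iff)
qed

text \<open>By the arithmetic--geometric mean inequality
  \<open>\<bar>w\<bar> D\<^sup>2 / \<bar>1 + w D\<bar> \<le> (D + \<bar>w\<bar>\<^sup>2 D\<^sup>3 / \<bar>1 + w D\<bar>\<^sup>2) / 2\<close>, and the right side has mean at most one.\<close>

lemma MP_graph_norm_le:
  assumes "MP_graph z w" "Im z \<ge> 0"
  shows "norm (z * w) \<le> 2"
proof -
  note w = MP_graphD[OF assms(1)]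
  let ?n = "\<lambda>d. norm (1 + w * complex_of_real d)"
  have int3: "integrable M (\<lambda>d. d ^ 3 / (?n d)\<^sup>2)" by (rule integrable_moment[OF w(1)]) simp
  have "norm (w * cmoment 2 w) = norm w * norm (cmoment 2 w)" by (rule norm_mult)
  also have "\<dots> \<le> norm w * (\<integral>d. norm (complex_of_real (d ^ 2) / (1 + w * complex_of_real d)) \<partial>M)"
    unfolding cmoment_def by (intro mult_left_mono integral_norm_bound) auto
  also have "\<dots> = (\<integral>d. norm w * norm (complex_of_real (d ^ 2) / (1 + w * complex_of_real d)) \<partial>M)"
    by simp
  also have "\<dots> \<le> (\<integral>d. (1 / 2) * d + (norm w)\<^sup>2 / 2 * (d ^ 3 / (?n d)\<^sup>2) \<partial>M)"
  proof (rule integral_mono_AE)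
    show "integrable M (\<lambda>d. norm w * norm (complex_of_real (d ^ 2) / (1 + w * complex_of_real d)))"
      by (intro integrable_mult_right integrable_norm integrable_cmoment w) simp
    show "integrable M (\<lambda>d. (1 / 2) * d + (norm w)\<^sup>2 / 2 * (d ^ 3 / (?n d)\<^sup>2))"
      by (intro Bochner_Integration.integrable_add integrable_mult_right integrable_id int3)
    show "AE d in M. norm w * norm (complex_of_real (d ^ 2) / (1 + w * complex_of_real d))
        \<le> (1 / 2) * d + (norm w)\<^sup>2 / 2 * (d ^ 3 / (?n d)\<^sup>2)"
      using AE_nonneg
    proof eventually_elim
      case (elim d)
      define q where "q = norm w * d / ?n d"
      have "2 * q \<le> 1 + q\<^sup>2" using zero_le_power2[of "1 - q"] by (simp add: power2_diff)
      then have "d * (2 * q) \<le> d * (1 + q\<^sup>2)" using elim by (rule mult_left_mono)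
      moreover have "norm w * norm (complex_of_real (d ^ 2) / (1 + w * complex_of_real d)) = d * q"
        by (simp only: q_def norm_divide norm_of_real abs_power2) (simp add: power2_eq_square)
      moreover have "(norm w)\<^sup>2 / 2 * (d ^ 3 / (?n d)\<^sup>2) = d * q\<^sup>2 / 2"
        by (simp add: q_def power_divide power_mult_distrib power3_eq_cube power2_eq_square mult_ac)
      ultimately show ?case by (simp add: distrib_left)
    qed
  qed
  also have "\<dots> = 1 / 2 + (norm w)\<^sup>2 / 2 * moment 3 w"
  proof -
    have lin: "(\<integral>d. a * f d + b * g d \<partial>M) = a * (\<integral>d. f d \<partial>M) + b * (\<integral>d. g d \<partial>M)"
      if "integrable M f" "integrable M g" for f g and a b :: real
      using that by simp
    show ?thesis unfolding moment_def lin[OF integrable_id int3] by (simp add: integral_id)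
  qed
  also have "\<dots> \<le> 1" using MP_graph_moment3_le[OF assms] by simp
  finally have "norm (1 + z * w) \<le> 1" by (simp only: w(4))
  then show ?thesis using norm_triangle_ineq4[of "1 + z * w" 1] by simp
qed

text \<open>At a real point the imaginary part of \<open>E [D / (1 + w D)] = - x w\<close> determines the second moment and its
  real part the first. The last bound is \<open>0 \<le> E [(1 + 2 Re w D)\<^sup>2 / \<bar>1 + w D\<bar>\<^sup>2] = 1 - x \<bar>w\<bar>\<^sup>2\<close>.\<close>

lemma MP_graph_real:
  assumes "MP_graph (of_real x) w" "x > 0"
  shows "moment 2 w = x" "moment 1 w = - 2 * x * Re w" "Re w < 0" "x * (norm w)\<^sup>2 \<le> 1"
proof -
  note w = MP_graphD[OF assms(1)]
  have eq: "of_real (moment 1 w) + cnj w * of_real (moment 2 w) = - of_real x * w"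
    using cmoment_eq_moments[OF w(1), of 1] w(3) by (simp add: numeral_2_eq_2)
  from arg_cong[OF eq, of Im] show m2: "moment 2 w = x" using w(1) by simp
  from arg_cong[OF eq, of Re] have "moment 1 w + Re w * moment 2 w = - (x * Re w)" by simp
  then have "moment 1 w = - (x * Re w) - Re w * x" unfolding m2 by linarith
  also have "\<dots> = - 2 * x * Re w" by (simp add: algebra_simps)
  finally show m1: "moment 1 w = - 2 * x * Re w" .
  show "Re w < 0" using moment_pos[OF w(1), of 1] m1 assms(2) by (simp add: mult_less_0_iff)
  let ?n = "\<lambda>d. (norm (1 + w * complex_of_real d))\<^sup>2"
  have "0 \<le> (\<integral>d. (1 + 2 * Re w * d)\<^sup>2 / ?n d \<partial>M)" by (intro Bochner_Integration.integral_nonneg) simp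
  also have "(\<integral>d. (1 + 2 * Re w * d)\<^sup>2 / ?n d \<partial>M)
      = (\<integral>d. d ^ 0 / ?n d + 4 * Re w * (d ^ 1 / ?n d) + 4 * (Re w)\<^sup>2 * (d ^ 2 / ?n d) \<partial>M)"
    by (intro Bochner_Integration.integral_cong)
       (simp_all add: power2_eq_square add_divide_distrib algebra_simps)
  also have "\<dots> = moment 0 w + 4 * Re w * moment 1 w + 4 * (Re w)\<^sup>2 * moment 2 w"
  proof -
    have lin: "(\<integral>d. f d + a * g d + b * k d \<partial>M) = (\<integral>d. f d \<partial>M) + a * (\<integral>d. g d \<partial>M) + b * (\<integral>d. k d \<partial>M)"
      if "integrable M f" "integrable M g" "integrable M k" for f g k and a b :: real
      using that by simp
    show ?thesis unfolding moment_def
      by (rule lin; rule integrable_moment[OF w(1)]) auto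
  qed
  finally have nn: "0 \<le> moment 0 w + 4 * Re w * moment 1 w + 4 * (Re w)\<^sup>2 * moment 2 w" .
  have "moment 0 w = 1 - 2 * Re w * moment 1 w - (norm w)\<^sup>2 * moment 2 w"
    using moment_recurrence[OF w(1), of 0] by (simp add: numeral_2_eq_2)
  then have "0 \<le> 1 + 2 * Re w * moment 1 w + 4 * (Re w)\<^sup>2 * moment 2 w - (norm w)\<^sup>2 * moment 2 w"
    using nn by (simp add: algebra_simps)
  then show "x * (norm w)\<^sup>2 \<le> 1" unfolding m1 m2 by (simp add: algebra_simps power2_eq_square)
qed

text \<open>A lower bound for the mean of \<open>D\<^sup>3 / (\<bar>1 + w\<^sub>1 D\<bar>\<^sup>2 \<bar>1 + w\<^sub>2 D\<bar>\<^sup>2)\<close> when \<open>\<bar>w\<^sub>1\<bar>\<close> and \<open>\<bar>w\<^sub>2\<bar>\<close> are at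
  most \<open>R\<close>.\<close>

definition holder_const :: "real \<Rightarrow> real" where
  "holder_const R = (\<integral>d. d ^ 3 / (1 + R * d) ^ 4 \<partial>M)"

lemma integrable_holder_const:
  assumes "R \<ge> 1"
  shows "integrable M (\<lambda>d. d ^ 3 / (1 + R * d) ^ 4)"
proof (rule integrable_boundedI[where B = 1])
  show "AE d in M. norm (d ^ 3 / (1 + R * d) ^ 4) \<le> 1"
    using AE_nonneg
  proof eventually_elim
    case (elim d)
    have "d \<le> R * d" using mult_right_mono[OF assms elim] by simp
    then have "d ^ 3 \<le> (1 + R * d) ^ 3" using elim by (intro power_mono) auto
    also have "\<dots> \<le> (1 + R * d) ^ 4" using elim assms by (intro power_increasing) auto
    finally show ?case using elim assms by (simp add: divide_le_eq_1 add_pos_nonneg)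
  qed
qed measurable

lemma holder_const_pos: "R \<ge> 1 \<Longrightarrow> holder_const R > 0"
  unfolding holder_const_def
proof (intro integral_pos_of_pos integrable_holder_const)
  fix d :: real assume "1 \<le> R" "0 < d"
  moreover from this have "0 < 1 + R * d" by (intro add_pos_pos mult_pos_pos) auto
  ultimately show "0 < d ^ 3 / (1 + R * d) ^ 4" by (intro divide_pos_pos zero_less_power)
qed auto

text \<open>The difference of two solutions: \<open>w\<^sub>1 w\<^sub>2 (z\<^sub>1 - z\<^sub>2) = (w\<^sub>1 - w\<^sub>2) (1 - E [f\<^sub>1 f\<^sub>2])\<close> with
  \<open>f\<^sub>i = D\<^bsup>3/2\<^esup> w\<^sub>i / (1 + w\<^sub>i D)\<close>. Since \<open>E \<bar>f\<^sub>i\<bar>\<^sup>2 \<le> 1\<close>, one has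
  \<open>2 \<bar>1 - E [f\<^sub>1 f\<^sub>2]\<bar> \<ge> E \<bar>f\<^sub>1 - cnj f\<^sub>2\<bar>\<^sup>2\<close>, and
  \<open>\<bar>f\<^sub>1 - cnj f\<^sub>2\<bar> = D\<^bsup>3/2\<^esup> \<bar>w\<^sub>1 - cnj w\<^sub>2\<bar> / (\<bar>1 + w\<^sub>1 D\<bar> \<bar>1 + w\<^sub>2 D\<bar>)\<close> is bounded below in terms of a
  bound on the \<open>w\<^sub>i\<close>. This makes the solution Hoelder continuous up to the boundary.\<close>

lemma MP_graph_holder:
  assumes g1: "MP_graph z1 w1" and g2: "MP_graph z2 w2" and Im: "Im z1 \<ge> 0" "Im z2 \<ge> 0"
    and R: "R \<ge> 1" "norm w1 \<le> R" "norm w2 \<le> R"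
  shows "holder_const R * (norm (w1 - cnj w2))\<^sup>2 * norm (w1 - w2) \<le> 2 * R\<^sup>2 * norm (z1 - z2)"
proof -
  note w1 = MP_graphD[OF g1] and w2 = MP_graphD[OF g2]
  let ?a1 = "\<lambda>d. 1 + w1 * complex_of_real d" and ?a2 = "\<lambda>d. 1 + w2 * complex_of_real d"
  have ne: "?a1 d \<noteq> 0" "?a2 d \<noteq> 0" for d
    using norm_one_plus_mult_ge(3)[OF w1(1), of d] norm_one_plus_mult_ge(3)[OF w2(1), of d] by auto
  have ne': "1 + cnj w2 * complex_of_real d \<noteq> 0" for d
  proof -
    have "cnj (?a2 d) \<noteq> 0" by (simp only: complex_cnj_zero_iff ne not_False_eq_True)
    then show ?thesis by simp
  qed
  let ?k = "\<lambda>d. complex_of_real (d ^ 3) / (?a1 d * ?a2 d)"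
  define P where "P = w1 * w2 * (\<integral>d. ?k d \<partial>M)"
  have eq: "complex_of_real (d ^ 2) / ?a2 d - complex_of_real (d ^ 2) / ?a1 d = (w1 - w2) * ?k d" for d
    using ne[of d] by (simp add: divide_simps) (simp add: algebra_simps power2_eq_square power3_eq_cube)
  have intk0: "integrable M (\<lambda>d. (w1 - w2) * ?k d)"
    unfolding eq[symmetric] using integrable_cmoment[OF w1(1), of 2] integrable_cmoment[OF w2(1), of 2] by simp
  have intk': "integrable M ?k" if "w1 \<noteq> w2" using intk0 that integrable_cmult_cancel[of M "w1 - w2" ?k] by auto
  have intk: "integrable M ?k"
  proof (cases "w1 = w2")
    case True
    have "norm (?k d) \<le> norm (d ^ 3 / (norm (?a1 d))\<^sup>2)" for d
      using True by (simp add: norm_divide norm_mult norm_power power2_eq_square power_abs)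
    then show ?thesis
      using integrable_moment[OF w1(1), of 3] by (intro Bochner_Integration.integrable_bound[of M _ ?k]) auto
  qed (use intk' in auto)
  have "(w1 - w2) * (\<integral>d. ?k d \<partial>M) = (\<integral>d. complex_of_real (d ^ 2) / ?a2 d - complex_of_real (d ^ 2) / ?a1 d \<partial>M)"
    unfolding eq by (rule integral_mult_right_zero[symmetric])
  also have "\<dots> = cmoment 2 w2 - cmoment 2 w1"
    unfolding cmoment_def
    by (rule Bochner_Integration.integral_diff; rule integrable_cmoment) (use w1 w2 in auto)
  finally have k: "(w1 - w2) * (\<integral>d. ?k d \<partial>M) = cmoment 2 w2 - cmoment 2 w1" .
  have "(w1 - w2) * P = w1 * w2 * ((w1 - w2) * (\<integral>d. ?k d \<partial>M))"
    by (simp add: P_def mult_ac)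
  also have "\<dots> = w1 * (w2 * cmoment 2 w2) - w2 * (w1 * cmoment 2 w1)"
    unfolding k by (simp add: algebra_simps)
  also have "\<dots> = (w1 - w2) - w1 * w2 * (z1 - z2)"
    unfolding w1(4) w2(4) by (simp add: algebra_simps)
  finally have diff: "w1 * w2 * (z1 - z2) = (w1 - w2) * (1 - P)" by (simp add: algebra_simps)
  have int1: "integrable M (\<lambda>d. d ^ 3 / (norm (?a1 d))\<^sup>2)" and int2: "integrable M (\<lambda>d. d ^ 3 / (norm (?a2 d))\<^sup>2)"
    by (rule integrable_moment; use w1 w2 in simp)+
  have intP: "integrable M (\<lambda>d. Re (w1 * w2 * ?k d))"
    using intk by (intro integrable_Re integrable_mult_right)
  have ReP: "Re P = (\<integral>d. Re (w1 * w2 * ?k d) \<partial>M)"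
    using integral_complex_Re_Im(1)[of M "\<lambda>d. w1 * w2 * ?k d"] intk
    by (simp only: P_def integral_mult_right_zero integrable_mult_right)
  have ptw: "(norm (w1 - cnj w2))\<^sup>2 * (d ^ 3 / (1 + R * d) ^ 4)
      \<le> (norm w1)\<^sup>2 * (d ^ 3 / (norm (?a1 d))\<^sup>2) + (norm w2)\<^sup>2 * (d ^ 3 / (norm (?a2 d))\<^sup>2)
        - 2 * Re (w1 * w2 * ?k d)" (is "?l \<le> ?r") if d: "0 \<le> d" for d
  proof -
    define q1 q2 where "q1 = w1 / ?a1 d" and "q2 = w2 / ?a2 d"
    have up: "norm (?a1 d) \<le> 1 + R * d" "norm (?a2 d) \<le> 1 + R * d"
      using norm_triangle_ineq[of 1 "w1 * complex_of_real d"] norm_triangle_ineq[of 1 "w2 * complex_of_real d"]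
        mult_right_mono[OF R(2) d] mult_right_mono[OF R(3) d] d by (simp_all add: norm_mult)
    have "(norm (?a1 d))\<^sup>2 * (norm (?a2 d))\<^sup>2 \<le> (1 + R * d)\<^sup>2 * (1 + R * d)\<^sup>2"
      by (intro mult_mono power_mono up) auto
    also have "\<dots> = (1 + R * d) ^ 4" by (simp flip: power_add)
    finally have den: "(norm (?a1 d))\<^sup>2 * (norm (?a2 d))\<^sup>2 \<le> (1 + R * d) ^ 4" .
    have "?l \<le> (norm (w1 - cnj w2))\<^sup>2 * (d ^ 3 / ((norm (?a1 d))\<^sup>2 * (norm (?a2 d))\<^sup>2))"
    proof (intro mult_left_mono divide_left_mono den)
      show "0 < (1 + R * d) ^ 4 * ((norm (?a1 d))\<^sup>2 * (norm (?a2 d))\<^sup>2)"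
        using ne[of d] R(1) d by (intro mult_pos_pos zero_less_power) (auto intro: add_pos_nonneg)
    qed (use d in auto)
    also have "\<dots> = d ^ 3 * (norm (q1 - cnj q2))\<^sup>2"
    proof -
      have "q1 - cnj q2 = (w1 - cnj w2) / (?a1 d * cnj (?a2 d))"
        using ne[of d] ne'[of d] by (simp add: q1_def q2_def divide_simps) (simp add: algebra_simps)
      then have "norm (q1 - cnj q2) = norm (w1 - cnj w2) / (norm (?a1 d) * norm (?a2 d))"
        by (simp only: norm_divide norm_mult complex_mod_cnj)
      then show ?thesis by (simp add: power_divide power_mult_distrib)
    qed
    also have "(norm (q1 - cnj q2))\<^sup>2 = (norm q1)\<^sup>2 + (norm q2)\<^sup>2 - 2 * Re (q1 * q2)"
      unfolding cmod_power2 by (simp add: power2_eq_square algebra_simps)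
    also have "d ^ 3 * ((norm q1)\<^sup>2 + (norm q2)\<^sup>2 - 2 * Re (q1 * q2)) = ?r"
    proof -
      have "w1 * w2 * ?k d = of_real (d ^ 3) * (q1 * q2)" by (simp add: q1_def q2_def)
      then have "Re (w1 * w2 * ?k d) = d ^ 3 * Re (q1 * q2)" 
        by (simp only: times_complex.sel Re_complex_of_real Im_complex_of_real mult_zero_left diff_zero)
      moreover have "(norm w1)\<^sup>2 * (d ^ 3 / (norm (?a1 d))\<^sup>2) = d ^ 3 * (norm q1)\<^sup>2"
        "(norm w2)\<^sup>2 * (d ^ 3 / (norm (?a2 d))\<^sup>2) = d ^ 3 * (norm q2)\<^sup>2"
        by (simp_all add: q1_def q2_def norm_divide power_divide)
      ultimately show ?thesis by (simp only: right_diff_distrib distrib_left)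
    qed
    finally show ?thesis .
  qed
  have "(norm (w1 - cnj w2))\<^sup>2 * holder_const R = (\<integral>d. (norm (w1 - cnj w2))\<^sup>2 * (d ^ 3 / (1 + R * d) ^ 4) \<partial>M)"
    unfolding holder_const_def by (rule integral_mult_right_zero[symmetric])
  also have "\<dots> \<le> (\<integral>d. (norm w1)\<^sup>2 * (d ^ 3 / (norm (?a1 d))\<^sup>2) + (norm w2)\<^sup>2 * (d ^ 3 / (norm (?a2 d))\<^sup>2)
        - 2 * Re (w1 * w2 * ?k d) \<partial>M)"
  proof (rule integral_mono_AE)
    show "AE d in M. (norm (w1 - cnj w2))\<^sup>2 * (d ^ 3 / (1 + R * d) ^ 4)
      \<le> (norm w1)\<^sup>2 * (d ^ 3 / (norm (?a1 d))\<^sup>2) + (norm w2)\<^sup>2 * (d ^ 3 / (norm (?a2 d))\<^sup>2)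
        - 2 * Re (w1 * w2 * ?k d)"
      using AE_nonneg by eventually_elim (rule ptw)
  qed (intro Bochner_Integration.integrable_diff Bochner_Integration.integrable_add integrable_mult_right
        integrable_holder_const R int1 int2 intP)+
  also have "\<dots> = (norm w1)\<^sup>2 * moment 3 w1 + (norm w2)\<^sup>2 * moment 3 w2 - 2 * Re P"
  proof -
    have lin: "(\<integral>d. a * f d + b * g d - 2 * k d \<partial>M) = a * (\<integral>d. f d \<partial>M) + b * (\<integral>d. g d \<partial>M) - 2 * (\<integral>d. k d \<partial>M)"
      if "integrable M f" "integrable M g" "integrable M k" for f g k and a b :: real
      using that by simp
    show ?thesis unfolding moment_def ReP by (rule lin[OF int1 int2 intP])
  qed
  also have "\<dots> \<le> 2 * (1 - Re P)"
    using MP_graph_moment3_le[OF g1 Im(1)] MP_graph_moment3_le[OF g2 Im(2)] by simp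
  also have "\<dots> \<le> 2 * norm (1 - P)" using complex_Re_le_cmod[of "1 - P"] by simp
  finally have "holder_const R * (norm (w1 - cnj w2))\<^sup>2 * norm (w1 - w2) \<le> 2 * norm (1 - P) * norm (w1 - w2)"
    by (intro mult_right_mono) (simp_all add: mult.commute)
  also have "\<dots> = 2 * norm ((w1 - w2) * (1 - P))" by (simp add: norm_mult)
  also have "\<dots> = 2 * (norm w1 * norm w2) * norm (z1 - z2)"
    unfolding diff[symmetric] by (simp add: norm_mult)
  also have "\<dots> \<le> 2 * R\<^sup>2 * norm (z1 - z2)"
    unfolding power2_eq_square using R by (intro mult_right_mono mult_left_mono mult_mono) auto
  finally show ?thesis .
qed

end

section \<open>The transform of the free convolution\<close>

lemma imaginary_in_upper_sector: "y > 0 \<Longrightarrow> \<i> * complex_of_real y \<in> upper_sector"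
  by (simp add: upper_sector_def)

lemma (in real_distribution) m_transform_imaginary:
  assumes sym: "symmetric_measure M" and y: "y > 0"
  shows "m_transform M (\<i> * complex_of_real y) = of_real ((\<integral>t. 1 / (1 + y\<^sup>2 * t\<^sup>2) \<partial>M) - 1)"
proof -
  have pos: "1 + y\<^sup>2 * t\<^sup>2 > 0" for t by (simp add: add_pos_nonneg)
  have int: "integrable M (\<lambda>t. 1 / (1 + y\<^sup>2 * t\<^sup>2))"
    by (rule integrable_boundedI[where B = 1]) (use pos in \<open>auto intro!: AE_I2\<close>)
  have "m_transform M (\<i> * complex_of_real y)
      = (\<integral>t. (\<i> * complex_of_real y)\<^sup>2 * complex_of_real (t\<^sup>2) / (1 - (\<i> * complex_of_real y)\<^sup>2 * complex_of_real (t\<^sup>2)) \<partial>M)"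
    unfolding m_transform_symmetric[OF sym imaginary_in_upper_sector[OF y]]
    by (subst m_transform_def, subst integral_distr) auto
  also have "\<dots> = (\<integral>t. complex_of_real (1 / (1 + y\<^sup>2 * t\<^sup>2) - 1) \<partial>M)"
  proof (rule Bochner_Integration.integral_cong)
    fix t
    have "(\<i> * complex_of_real y)\<^sup>2 = complex_of_real (- y\<^sup>2)" by (simp add: power_mult_distrib)
    then have "(\<i> * complex_of_real y)\<^sup>2 * complex_of_real (t\<^sup>2) / (1 - (\<i> * complex_of_real y)\<^sup>2 * complex_of_real (t\<^sup>2))
        = complex_of_real (- y\<^sup>2 * t\<^sup>2 / (1 + y\<^sup>2 * t\<^sup>2))"
      by simp
    also have "- y\<^sup>2 * t\<^sup>2 / (1 + y\<^sup>2 * t\<^sup>2) = 1 / (1 + y\<^sup>2 * t\<^sup>2) - 1"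
      using pos[of t] by (simp add: field_simps)
    finally show "(\<i> * complex_of_real y)\<^sup>2 * complex_of_real (t\<^sup>2) / (1 - (\<i> * complex_of_real y)\<^sup>2 * complex_of_real (t\<^sup>2))
        = complex_of_real (1 / (1 + y\<^sup>2 * t\<^sup>2) - 1)" .
  qed simp
  also have "\<dots> = of_real (\<integral>t. 1 / (1 + y\<^sup>2 * t\<^sup>2) - 1 \<partial>M)"
    by (rule integral_complex_of_real)
  also have "(\<integral>t. 1 / (1 + y\<^sup>2 * t\<^sup>2) - 1 \<partial>M) = (\<integral>t. 1 / (1 + y\<^sup>2 * t\<^sup>2) \<partial>M) - 1"
    using int by simp
  finally show ?thesis .
qed

lemma (in real_distribution) cauchy_stieltjes_imaginary:
  assumes sym: "symmetric_measure M" and b: "b > 0"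
  shows "cauchy_stieltjes M (\<i> * complex_of_real b)
    = \<i> / of_real b * (1 + m_transform M (\<i> * complex_of_real (1 / b)))"
proof -
  let ?z = "\<i> * complex_of_real b"
  have Im: "Im ?z \<noteq> 0" using b by simp
  have "Re (cauchy_stieltjes M ?z) = (\<integral>t. t / (t\<^sup>2 + b\<^sup>2) \<partial>M)"
    unfolding cauchy_stieltjes_def integral_complex_Re_Im(1)[OF integrable_cauchy_kernel[OF Im]]
    by (simp add: Re_divide)
  moreover have "(\<integral>t. t / (t\<^sup>2 + b\<^sup>2) \<partial>M) = - (\<integral>t. t / (t\<^sup>2 + b\<^sup>2) \<partial>M)"
    using symmetric_integral_uminus[OF sym, of "\<lambda>t. t / (t\<^sup>2 + b\<^sup>2)"] by simp
  ultimately have Re0: "Re (cauchy_stieltjes M ?z) = 0" by simp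
  have "Im (cauchy_stieltjes M ?z) = (\<integral>t. (1 / b) * (1 / (1 + (1 / b)\<^sup>2 * t\<^sup>2)) \<partial>M)"
    unfolding Im_cauchy_stieltjes[OF Im]
  proof (rule Bochner_Integration.integral_cong)
    fix t
    have "t\<^sup>2 + b\<^sup>2 > 0" using b by (simp add: add_nonneg_pos)
    moreover have "1 + (1 / b)\<^sup>2 * t\<^sup>2 = (t\<^sup>2 + b\<^sup>2) / b\<^sup>2" using b by (simp add: field_simps)
    ultimately show "Im ?z / ((t - Re ?z)\<^sup>2 + (Im ?z)\<^sup>2) = (1 / b) * (1 / (1 + (1 / b)\<^sup>2 * t\<^sup>2))"
      using b by (simp add: power2_eq_square)
  qed simp
  also have "\<dots> = (1 / b) * (\<integral>t. 1 / (1 + (1 / b)\<^sup>2 * t\<^sup>2) \<partial>M)" by (rule integral_mult_right_zero)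
  finally have Im: "Im (cauchy_stieltjes M ?z) = (1 / b) * (\<integral>t. 1 / (1 + (1 / b)\<^sup>2 * t\<^sup>2) \<partial>M)" .
  have m: "1 + m_transform M (\<i> * complex_of_real (1 / b)) = of_real (\<integral>t. 1 / (1 + (1 / b)\<^sup>2 * t\<^sup>2) \<partial>M)"
    using m_transform_imaginary[OF sym, of "1 / b"] b by simp
  show ?thesis unfolding m
    by (rule complex_eqI) (simp only: Re0, simp, simp only: Im, simp)
qed

text \<open>On the imaginary axis the transform of a symmetric law is real, continuous, tends to zero at the origin
  and is negative unless the law is \<open>dirac0\<close>; the claim is the intermediate value theorem.\<close>

lemma (in real_distribution) m_transform_imaginary_attains:
  assumes sym: "symmetric_measure M" and ne: "M \<noteq> dirac0"
  obtains \<epsilon> where "\<epsilon> > 0"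
    "\<And>w. - \<epsilon> < w \<Longrightarrow> w < 0 \<Longrightarrow> \<exists>y>0. m_transform M (\<i> * complex_of_real y) = of_real w"
proof -
  interpret S: nonneg_distribution "distr M borel power2" by (rule square_law) unfold_locales
  define \<phi> where "\<phi> y = (\<integral>t. 1 / (1 + y\<^sup>2 * t\<^sup>2) \<partial>M)" for y
  have pos: "1 + y\<^sup>2 * t\<^sup>2 > 0" for t y :: real by (simp add: add_pos_nonneg)
  have int: "integrable M (\<lambda>t. 1 / (1 + y\<^sup>2 * t\<^sup>2))" for y :: real
    by (rule integrable_boundedI[where B = 1]) (use pos in \<open>auto intro!: AE_I2\<close>)
  have m: "m_transform M (\<i> * complex_of_real y) = of_real (\<phi> y - 1)" if "y > 0" for y
    using m_transform_imaginary[OF sym that] by (simp add: \<phi>_def)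
  have cont: "continuous_on {y0..} \<phi>" if "y0 > 0" for y0
  proof -
    have eq: "\<phi> y = Re (S.resolvent_mean (of_real (y\<^sup>2)))" if "y > 0" for y
    proof -
      have "complex_of_real (\<phi> y - 1) = m_transform (distr M borel power2) ((\<i> * complex_of_real y)\<^sup>2)"
        using m[OF that] m_transform_symmetric[OF sym imaginary_in_upper_sector[OF that]] by simp
      also have "\<dots> = S.resolvent_mean (- ((\<i> * complex_of_real y)\<^sup>2)) - 1"
        using that by (intro S.m_transform_eq_resolvent_mean) (simp add: power_mult_distrib)
      finally have "complex_of_real (\<phi> y - 1) = S.resolvent_mean (of_real (y\<^sup>2)) - 1"
        by (simp add: power_mult_distrib)
      from arg_cong[OF this, of Re] show ?thesis by simp
    qed
    have "continuous_on {y0..} (\<lambda>y. Re (S.resolvent_mean (of_real (y\<^sup>2))))"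
      by (intro continuous_intros continuous_on_compose2[OF holomorphic_on_imp_continuous_on[OF S.resolvent_mean_holomorphic]])
         (use that in auto)
    then show ?thesis by (rule continuous_on_eq) (use eq that in auto)
  qed
  have lim: "(\<lambda>n. \<phi> (1 / real (Suc n))) \<longlonglongrightarrow> 1"
  proof -
    have "(\<lambda>n. \<integral>t. 1 / (1 + (1 / real (Suc n))\<^sup>2 * t\<^sup>2) \<partial>M) \<longlonglongrightarrow> (\<integral>t. 1 \<partial>M)"
    proof (rule integral_dominated_convergence[where w = "\<lambda>_. 1"])
      show "AE t in M. (\<lambda>n. 1 / (1 + (1 / real (Suc n))\<^sup>2 * t\<^sup>2)) \<longlonglongrightarrow> 1"
      proof (intro AE_I2)
        fix t :: real
        have "(\<lambda>n. 1 / real (Suc n)) \<longlonglongrightarrow> 0" using LIMSEQ_Suc[OF lim_1_over_n] by simp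
        then have "(\<lambda>n. 1 / (1 + (1 / real (Suc n))\<^sup>2 * t\<^sup>2)) \<longlonglongrightarrow> 1 / (1 + 0\<^sup>2 * t\<^sup>2)"
          by (intro tendsto_intros) auto
        then show "(\<lambda>n. 1 / (1 + (1 / real (Suc n))\<^sup>2 * t\<^sup>2)) \<longlonglongrightarrow> 1" by simp
      qed
      show "AE t in M. norm (1 / (1 + (1 / real (Suc n))\<^sup>2 * t\<^sup>2)) \<le> 1" for n
        using pos[of "1 / real (Suc n)"] by (intro AE_I2) (simp add: add_pos_nonneg)
    qed auto
    then show ?thesis by (simp add: \<phi>_def)
  qed
  have "\<phi> 1 < 1"
  proof -
    have "(\<integral>t. 1 - 1 / (1 + 1\<^sup>2 * t\<^sup>2) \<partial>M) \<noteq> 0"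
    proof
      assume 0: "(\<integral>t. 1 - 1 / (1 + 1\<^sup>2 * t\<^sup>2) \<partial>M) = 0"
      have "AE t in M. 1 - 1 / (1 + 1\<^sup>2 * t\<^sup>2) = 0"
        using 0 integral_nonneg_eq_0_iff_AE[of M "\<lambda>t. 1 - 1 / (1 + 1\<^sup>2 * t\<^sup>2)"] int[of 1] by (simp add: add_pos_nonneg)
      then have "AE t in M. t = 0"
      proof eventually_elim
        case (elim t)
        then show ?case using pos[of 1 t] by (simp add: field_simps)
      qed
      then show False using eq_dirac0_if_AE_zero ne by blast
    qed
    moreover have "0 \<le> (\<integral>t. 1 - 1 / (1 + 1\<^sup>2 * t\<^sup>2) \<partial>M)"
      by (intro Bochner_Integration.integral_nonneg) (simp add: add_pos_nonneg)
    moreover have "(\<integral>t. 1 - 1 / (1 + 1\<^sup>2 * t\<^sup>2) \<partial>M) = 1 - \<phi> 1"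
      using int[of 1] by (simp add: \<phi>_def)
    ultimately show ?thesis by linarith
  qed
  show ?thesis
  proof (rule that[of "1 - \<phi> 1"])
    fix w assume w: "- (1 - \<phi> 1) < w" "w < 0"
    from order_tendstoD(1)[OF lim, of "1 + w"] w(2)
    obtain n where n: "1 + w < \<phi> (1 / real (Suc n))" by (auto simp: eventually_sequentially)
    have "\<exists>y. 1 / real (Suc n) \<le> y \<and> y \<le> 1 \<and> \<phi> y = 1 + w"
      by (rule IVT2') (use n w in \<open>auto intro: continuous_on_subset[OF cont[of "1 / real (Suc n)"]]\<close>)
    then obtain y where "1 / real (Suc n) \<le> y" "\<phi> y = 1 + w" by blast
    moreover have "0 < 1 / real (Suc n)" by simp
    ultimately have "y > 0" "\<phi> y = 1 + w" by linarith+
    then show "\<exists>y>0. m_transform M (\<i> * complex_of_real y) = of_real w"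
      using m[of y] by auto
  qed (use \<open>\<phi> 1 < 1\<close> in auto)
qed

subsection \<open>The semicircle law\<close>

text \<open>With \<open>c = sqrt (1 + 4 y\<^sup>2)\<close>, an antiderivative of \<open>sqrt (4 - t\<^sup>2) / (1 + y\<^sup>2 t\<^sup>2)\<close> is
  \<open>(c arcsin (c t / (2 sqrt (1 + y\<^sup>2 t\<^sup>2))) - arcsin (t / 2)) / y\<^sup>2\<close>. It is continuous up to the
  endpoints \<open>\<plusminus>2\<close>, where both arguments of \<open>arcsin\<close> are \<open>\<plusminus>1\<close>.\<close>

lemma semicircle_integral:
  assumes y: "y > 0"
  shows "((\<lambda>t. sqrt (4 - t\<^sup>2) / (1 + y\<^sup>2 * t\<^sup>2)) has_integral pi * (sqrt (1 + 4 * y\<^sup>2) - 1) / y\<^sup>2) {-2..2}"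
proof -
  define c where "c = sqrt (1 + 4 * y\<^sup>2)"
  define r where "r t = sqrt (1 + y\<^sup>2 * t\<^sup>2)" for t
  define v where "v t = t * c / (2 * r t)" for t
  define F where "F t = (c * arcsin (v t) - arcsin (t / 2)) / y\<^sup>2" for t
  have pos: "1 + y\<^sup>2 * t\<^sup>2 > 0" for t by (simp add: add_pos_nonneg)
  have c: "c > 0" "c\<^sup>2 = 1 + 4 * y\<^sup>2" by (simp_all add: c_def add_pos_nonneg)
  have r: "r t > 0" "(r t)\<^sup>2 = 1 + y\<^sup>2 * t\<^sup>2" for t
    using pos[of t] by (auto simp: r_def)
  have v2: "1 - (v t)\<^sup>2 = (4 - t\<^sup>2) / (2 * r t)\<^sup>2" for t
  proof -
    have "(2 * r t)\<^sup>2 - (t * c)\<^sup>2 = 4 - t\<^sup>2" by (simp add: power_mult_distrib r c algebra_simps)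
    moreover have "(2 * r t)\<^sup>2 \<noteq> 0" using r(1)[of t] by simp
    ultimately show ?thesis unfolding v_def power_divide
      by (metis diff_divide_distrib divide_self)
  qed
  have v_le: "- 1 \<le> v t" "v t \<le> 1" if "t \<in> {-2..2}" for t
  proof -
    have "t\<^sup>2 \<le> 2\<^sup>2" using that by (intro power2_le_iff_abs_le[THEN iffD2]) auto
    then have "0 \<le> 1 - (v t)\<^sup>2" unfolding v2 by simp
    then have "\<bar>v t\<bar> \<le> 1" by (simp add: abs_square_le_1)
    then show "- 1 \<le> v t" "v t \<le> 1" by auto
  qed
  have F: "((\<lambda>t. sqrt (4 - t\<^sup>2) / (1 + y\<^sup>2 * t\<^sup>2)) has_integral F 2 - F (- 2)) {-2..2}"
  proof (rule fundamental_theorem_of_calculus_interior)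
    have "continuous_on {-2..2} v"
      unfolding v_def r_def using pos by (intro continuous_intros) (auto simp: less_imp_neq[symmetric])
    then show "continuous_on {-2..2} F"
      unfolding F_def by (intro continuous_intros) (use v_le y in auto)
    fix t :: real assume t: "t \<in> {- 2<..<2}"
    define s where "s = sqrt (4 - t\<^sup>2)"
    have t4: "t\<^sup>2 < 2\<^sup>2" using t power_strict_mono[of "\<bar>t\<bar>" 2 2] by (simp add: abs_less_iff)
    from t4 have s: "s > 0" "s\<^sup>2 = 4 - t\<^sup>2" by (auto simp: s_def)
    have "0 < 1 - (v t)\<^sup>2" unfolding v2 using t4 r(1)[of t] by (intro divide_pos_pos) auto
    then have "\<bar>v t\<bar> < 1" by (simp add: abs_square_less_1)
    then have v: "- 1 < v t" "v t < 1" by auto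
    have sqrt_v: "sqrt (1 - (v t)\<^sup>2) = s / (2 * r t)"
      unfolding v2 s_def using r(1)[of t] by (simp only: real_sqrt_divide real_sqrt_abs)
    have "(r has_real_derivative y\<^sup>2 * t / r t) (at t)"
      unfolding r_def using pos[of t] by (auto intro!: derivative_eq_intros simp: field_simps)
    then have "(v has_real_derivative (c * (2 * r t) - (t * c) * (2 * (y\<^sup>2 * t / r t))) / (2 * r t * (2 * r t))) (at t)"
      unfolding v_def using r(1)[of t] by (auto intro!: derivative_eq_intros)
    also have "(c * (2 * r t) - (t * c) * (2 * (y\<^sup>2 * t / r t))) / (2 * r t * (2 * r t))
        = c * ((r t)\<^sup>2 - y\<^sup>2 * t\<^sup>2) / (2 * r t ^ 3)"
      using r(1)[of t] by (simp add: field_simps power2_eq_square power3_eq_cube)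
    also have "\<dots> = c / (2 * r t ^ 3)" by (simp add: r)
    finally have dv: "(v has_real_derivative c / (2 * r t ^ 3)) (at t)" .
    have d1: "((\<lambda>t. arcsin (v t)) has_real_derivative inverse (s / (2 * r t)) * (c / (2 * r t ^ 3))) (at t)"
      using DERIV_chain2[OF DERIV_arcsin[OF v] dv] unfolding sqrt_v .
    have sqrt_t: "sqrt (1 - (t / 2)\<^sup>2) = s / 2"
    proof -
      have e: "1 - (t / 2)\<^sup>2 = (4 - t\<^sup>2) / 2\<^sup>2" by (simp add: power_divide field_simps)
      show ?thesis unfolding s_def e real_sqrt_divide real_sqrt_abs by simp
    qed
    have "(arcsin has_real_derivative inverse (s / 2)) (at (t / 2))"
      using DERIV_arcsin[of "t / 2"] t unfolding sqrt_t by simp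
    moreover have "((\<lambda>t. t / 2) has_real_derivative 1 / 2) (at t)"
      by (auto intro!: derivative_eq_intros)
    ultimately have d2: "((\<lambda>t. arcsin (t / 2)) has_real_derivative inverse (s / 2) * (1 / 2)) (at t)"
      by (rule DERIV_chain2)
    have "(F has_real_derivative (c * (inverse (s / (2 * r t)) * (c / (2 * r t ^ 3))) - inverse (s / 2) * (1 / 2)) / y\<^sup>2) (at t)"
      unfolding F_def using y by (intro DERIV_cdivide DERIV_diff DERIV_cmult d1 d2)
    also have "(c * (inverse (s / (2 * r t)) * (c / (2 * r t ^ 3))) - inverse (s / 2) * (1 / 2)) / y\<^sup>2
        = (c\<^sup>2 - (r t)\<^sup>2) / (y\<^sup>2 * (r t)\<^sup>2 * s)"
      using r(1)[of t] s(1) y by (simp add: field_simps power2_eq_square power3_eq_cube)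
    also have "c\<^sup>2 - (r t)\<^sup>2 = y\<^sup>2 * s\<^sup>2" by (simp add: c r s algebra_simps)
    also have "y\<^sup>2 * s\<^sup>2 / (y\<^sup>2 * (r t)\<^sup>2 * s) = s / (r t)\<^sup>2"
      using r(1)[of t] s(1) y by (simp add: field_simps power2_eq_square)
    finally show "(F has_vector_derivative sqrt (4 - t\<^sup>2) / (1 + y\<^sup>2 * t\<^sup>2)) (at t)"
      by (simp add: r s_def has_real_derivative_iff_has_vector_derivative)
  qed simp
  have v_ends: "v 2 = 1" "v (- 2) = - 1"
  proof -
    have "r 2 = c" "r (- 2) = c" by (simp_all add: r_def c_def mult.commute)
    then show "v 2 = 1" "v (- 2) = - 1" using c(1) by (simp_all add: v_def)
  qed
  have "F 2 = (c - 1) * (pi / 2) / y\<^sup>2" "F (- 2) = - ((c - 1) * (pi / 2) / y\<^sup>2)"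
    unfolding F_def v_ends by (simp_all add: algebra_simps diff_divide_distrib)
  then have "F 2 - F (- 2) = pi * (sqrt (1 + 4 * y\<^sup>2) - 1) / y\<^sup>2"
    by (simp add: c_def field_simps)
  with F show ?thesis by simp
qed

lemma semicircle_m_transform_imaginary:
  assumes sc: "real_distribution semicircle" "symmetric_measure semicircle" and y: "y > 0"
  shows "m_transform semicircle (\<i> * complex_of_real y)
    = of_real ((sqrt (1 + 4 * y\<^sup>2) - 1) / (2 * y\<^sup>2) - 1)"
proof -
  interpret real_distribution semicircle by fact
  have pos: "1 + y\<^sup>2 * t\<^sup>2 > 0" for t by (simp add: add_pos_nonneg)
  let ?g = "\<lambda>x. indicator {-2..2} x * sqrt (4 - x\<^sup>2) / (2 * pi)"
  have "(\<integral>t. 1 / (1 + y\<^sup>2 * t\<^sup>2) \<partial>semicircle) = (\<integral>t. ?g t *\<^sub>R (1 / (1 + y\<^sup>2 * t\<^sup>2)) \<partial>lborel)"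
    unfolding semicircle_def
  proof (rule integral_density)
    have "0 \<le> 4 - x\<^sup>2" if "- 2 \<le> x" "x \<le> 2" for x :: real
      using power_mono[of "\<bar>x\<bar>" 2 2] that by simp
    then show "AE x in lborel. 0 \<le> ?g x" by (auto simp: indicator_def)
  qed auto
  also have "\<dots> = (\<integral>t. (1 / (2 * pi)) * (indicator {-2..2} t *\<^sub>R (sqrt (4 - t\<^sup>2) / (1 + y\<^sup>2 * t\<^sup>2))) \<partial>lborel)"
    by (intro Bochner_Integration.integral_cong) auto
  also have "\<dots> = (1 / (2 * pi)) * (LINT t:{-2..2}|lborel. sqrt (4 - t\<^sup>2) / (1 + y\<^sup>2 * t\<^sup>2))"
    unfolding set_lebesgue_integral_def by (rule integral_mult_right_zero)
  also have "(LINT t:{-2..2}|lborel. sqrt (4 - t\<^sup>2) / (1 + y\<^sup>2 * t\<^sup>2)) = pi * (sqrt (1 + 4 * y\<^sup>2) - 1) / y\<^sup>2"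
  proof -
    have "continuous_on {-2..2} (\<lambda>t. sqrt (4 - t\<^sup>2) / (1 + y\<^sup>2 * t\<^sup>2))"
      using pos by (intro continuous_intros) (auto simp: less_imp_neq[symmetric])
    then have *: "set_integrable lborel {-2..2} (\<lambda>t. sqrt (4 - t\<^sup>2) / (1 + y\<^sup>2 * t\<^sup>2))"
      by (rule borel_integrable_atLeastAtMost')
    show ?thesis
      unfolding set_borel_integral_eq_integral(2)[OF *] by (rule integral_unique[OF semicircle_integral[OF y]])
  qed
  finally have "(\<integral>t. 1 / (1 + y\<^sup>2 * t\<^sup>2) \<partial>semicircle) = (sqrt (1 + 4 * y\<^sup>2) - 1) / (2 * y\<^sup>2)"
    by simp
  then show ?thesis using m_transform_imaginary[OF sc(2) y] by simp
qed

text \<open>The semicircle transform \<open>w\<close> at \<open>u\<close> satisfies \<open>w = u\<^sup>2 (1 + w)\<^sup>2\<close>, whence \<open>u = sqrt w / (1 + w)\<close>.\<close>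

lemma semicircle_m_transform_inverse:
  assumes sc: "real_distribution semicircle" "symmetric_measure semicircle" and w: "- 1 < w" "w < 0"
  shows "m_transform semicircle (\<i> * complex_of_real (sqrt (- w) / (1 + w))) = of_real w"
proof -
  define y where "y = sqrt (- w) / (1 + w)"
  have y: "y > 0" using w by (simp add: y_def)
  have y2: "y\<^sup>2 = - w / (1 + w)\<^sup>2" using w by (simp add: y_def power_divide)
  have w1: "1 + w \<noteq> 0" using w by simp
  have "1 + 4 * y\<^sup>2 = ((1 - w) / (1 + w))\<^sup>2"
    unfolding y2 using w1 by (simp add: power_divide field_simps) (simp add: power2_eq_square algebra_simps)
  then have "sqrt (1 + 4 * y\<^sup>2) = (1 - w) / (1 + w)" using w by simp
  then have "(sqrt (1 + 4 * y\<^sup>2) - 1) / (2 * y\<^sup>2) = ((1 - w) / (1 + w) - 1) / (2 * (- w / (1 + w)\<^sup>2))"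
    using y2 by simp
  also have "(1 - w) / (1 + w) - 1 = - (2 * w) / (1 + w)" using w1 by (simp add: field_simps)
  also have "- (2 * w) / (1 + w) / (2 * (- w / (1 + w)\<^sup>2)) = 1 + w"
    using w w1 by (simp add: divide_simps power2_eq_square)
  finally show ?thesis
    using semicircle_m_transform_imaginary[OF sc y] by (simp add: y_def)
qed

subsection \<open>Transforms along the negative real axis\<close>

locale MP_pair = N: mean_one_distribution \<nu> + L: nonneg_distribution M for \<nu> M :: "real measure" +
  assumes MP: "solves_MP_equation \<nu> (cauchy_stieltjes M)"
begin

abbreviation h :: "complex \<Rightarrow> complex" where
  "h \<equiv> cauchy_stieltjes M"

lemma MP_graph_h:
  assumes "Im z > 0"
  shows "N.MP_graph z (h z)"
proof (rule N.MP_graph_fixed_pointI)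
  have z: "z \<in> upper_half_plane" using assms by (simp add: upper_half_plane_def)
  then show "Im (h z) > 0" using MP by (auto simp: solves_MP_equation_def upper_half_plane_def)
  have "h z = inverse ((\<integral>d. complex_of_real (d\<^sup>2) / (1 + h z * complex_of_real d) \<partial>\<nu>) - z)"
    using z MP by (simp only: solves_MP_equation_def)
  then show "h z = inverse (N.cmoment 2 (h z) - z)" by (simp only: N.cmoment_def)
qed

text \<open>The equation is given on the upper half plane only; on the negative axis, where \<open>h\<close> is continuous and
  positive, it follows by passing to the limit \<open>z = - a + i / n\<close>.\<close>

lemma resolvent_mean_h_negative:
  assumes a: "a > 0"
  shows "N.resolvent_mean (h (of_real (- a))) = 1 - of_real a * (h (of_real (- a)))\<^sup>2"
proof -
  define z where "z n = Complex (- a) (1 / real (Suc n))" for n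
  have lim: "z \<longlonglongrightarrow> of_real (- a)"
  proof -
    have "(\<lambda>n. 1 / real (Suc n)) \<longlonglongrightarrow> 0" using LIMSEQ_Suc[OF lim_1_over_n] by simp
    then have "z \<longlonglongrightarrow> Complex (- a) 0" unfolding z_def by (intro tendsto_Complex tendsto_const)
    then show ?thesis by (simp add: complex_of_real_def)
  qed
  have cut: "of_real (- a) \<in> cut_plane" using a by (simp add: cut_plane_def)
  have "isCont h (of_real (- a))"
    using L.cauchy_stieltjes_holomorphic_cut_plane cut open_cut_plane
    by (simp add: holomorphic_on_imp_continuous_on continuous_on_eq_continuous_at[symmetric]
        field_differentiable_imp_continuous_at holomorphic_on_imp_differentiable_at)
  then have lh: "(\<lambda>n. h (z n)) \<longlonglongrightarrow> h (of_real (- a))"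
    using lim by (rule isCont_tendsto_compose)
  have pos: "Re (h (of_real (- a))) > 0"
    using L.cauchy_stieltjes_negative_real[OF a] L.integral_inverse_shift_pos[OF a] by simp
  have "open {w. Im w \<noteq> 0 \<or> Re w > 0}"
  proof -
    have "{w. Im w \<noteq> 0 \<or> Re w > 0} = {z. Im z < 0} \<union> {z. Im z > 0} \<union> {z. Re z > 0}" by auto
    then show ?thesis by (simp only:) (intro open_Un open_halfspace_Re_gt open_halfspace_Im_lt open_halfspace_Im_gt)
  qed
  then have "isCont N.resolvent_mean (h (of_real (- a)))"
    using N.resolvent_mean_holomorphic pos
    by (intro field_differentiable_imp_continuous_at holomorphic_on_imp_differentiable_at) auto
  then have "(\<lambda>n. N.resolvent_mean (h (z n))) \<longlonglongrightarrow> N.resolvent_mean (h (of_real (- a)))"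
    using lh by (rule isCont_tendsto_compose)
  moreover have "N.resolvent_mean (h (z n)) = 1 + z n * (h (z n))\<^sup>2" for n
    using MP_graph_h[of "z n"] by (simp add: N.MP_graph_def z_def)
  moreover have "(\<lambda>n. 1 + z n * (h (z n))\<^sup>2) \<longlonglongrightarrow> 1 + of_real (- a) * (h (of_real (- a)))\<^sup>2"
    by (intro tendsto_intros lim lh)
  ultimately show ?thesis by (simp add: LIMSEQ_unique)
qed

text \<open>For large \<open>a\<close> the number \<open>w = - a h(- a)\<^sup>2\<close> lies in the images of all three transforms. Its
  preimage for \<open>\<nu>\<close> is \<open>- h(- a)\<close> by the Marchenko--Pastur equation, and that for the semicircle law
  is \<open>i sqrt (- w) / (1 + w)\<close>; multiplicativity of the S-transform then gives the preimage
  \<open>i / sqrt a\<close> for the convolution.\<close>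

lemma m_transform_free_conv:
  assumes conv: "is_free_mult_conv \<nu> semicircle \<mu>"
  obtains A where "\<And>b. b > A \<Longrightarrow> b > 0 \<and>
    m_transform \<mu> (\<i> * complex_of_real (1 / b)) = - of_real (b\<^sup>2) * (h (of_real (- b\<^sup>2)))\<^sup>2"
proof -
  note conv' = conv[unfolded is_free_mult_conv_def]
  interpret \<mu>: real_distribution \<mu> using conv' by auto
  interpret SC: real_distribution semicircle using conv' by auto
  have sym: "symmetric_measure \<mu>" "symmetric_measure semicircle" using conv' by auto
  obtain \<epsilon> where \<epsilon>: "\<epsilon> > 0"
    "\<And>w. - \<epsilon> < w \<Longrightarrow> w < 0 \<Longrightarrow> \<exists>y>0. m_transform \<mu> (\<i> * complex_of_real y) = of_real w"
    using \<mu>.m_transform_imaginary_attains[OF sym(1)] conv' by metis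
  show ?thesis
  \<comment> \<open>a bound on \<open>b\<close> that makes \<open>\<bar>w\<bar> \<le> 1 / b\<^sup>2\<close> smaller than both one and \<open>\<epsilon>\<close>\<close>
  proof (rule that[of "max 1 (1 / \<epsilon>)"])
    fix b assume "b > max 1 (1 / \<epsilon>)"
    then have b: "b > 1" "b > 1 / \<epsilon>" by auto
    define a where "a = b\<^sup>2"
    have "b * 1 < b * b" using b by (intro mult_strict_left_mono) auto
    then have a: "a > 0" "1 / a < \<epsilon>" "1 / a < 1"
      using b \<epsilon>(1) by (auto simp: a_def power2_eq_square field_simps intro: less_trans)
    define H where "H = (\<integral>t. 1 / (t + a) \<partial>M)"
    have h: "h (of_real (- a)) = of_real H"
      unfolding H_def by (rule L.cauchy_stieltjes_negative_real[OF a(1)])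
    have H: "H > 0" unfolding H_def by (rule L.integral_inverse_shift_pos[OF a(1)])
    have "H \<le> (\<integral>t. 1 / a \<partial>M)"
      unfolding H_def
    proof (rule integral_mono_AE[OF L.integrable_inverse_shift[OF a(1)]])
      show "AE t in M. 1 / (t + a) \<le> 1 / a"
        using L.AE_nonneg by eventually_elim (use a in \<open>auto intro!: divide_left_mono\<close>)
    qed simp
    then have Ha: "H \<le> 1 / a" by simp
    define w where "w = - (a * H\<^sup>2)"
    have "a * H\<^sup>2 = (a * H) * H" by (simp add: power2_eq_square)
    also have "\<dots> \<le> 1 * H" using H Ha a(1) by (intro mult_right_mono) (auto simp: field_simps)
    finally have "a * H\<^sup>2 \<le> 1 / a" using Ha by simp
    then have "- (1 / a) \<le> w" by (simp add: w_def)
    then have w: "- \<epsilon> < w" "- 1 < w" using a(2,3) by linarith+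
    have w: "- \<epsilon> < w" "- 1 < w" "w < 0" using w a H by (auto simp: w_def)
    have w_ne: "complex_of_real w \<noteq> 0" "1 + complex_of_real w \<noteq> 0"
    proof -
      have "1 + complex_of_real w = of_real (1 + w)" by simp
      then show "complex_of_real w \<noteq> 0" "1 + complex_of_real w \<noteq> 0"
        using w by (simp_all only: of_real_eq_0_iff)
    qed
    let ?w = "complex_of_real w"
    have u\<nu>: "- complex_of_real H \<in> left_half_plane" using H by (simp add: left_half_plane_def)
    have m\<nu>: "m_transform \<nu> (- complex_of_real H) = ?w"
      using N.m_transform_eq_resolvent_mean(2)[of "- complex_of_real H"] H
        resolvent_mean_h_negative[OF a(1), unfolded h] by (simp add: w_def)
    have inv\<nu>: "inv_into left_half_plane (m_transform \<nu>) ?w = - complex_of_real H"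
      using inv_into_f_f[OF N.m_transform_inj_on u\<nu>] conv' m\<nu> by simp
    define y where "y = sqrt (- w) / (1 + w)"
    have "y > 0" using w by (simp add: y_def)
    then have uS: "\<i> * complex_of_real y \<in> upper_sector" by (rule imaginary_in_upper_sector)
    have mS: "m_transform semicircle (\<i> * complex_of_real y) = ?w"
      unfolding y_def by (rule semicircle_m_transform_inverse) (use w sym in \<open>auto intro: SC.real_distribution_axioms\<close>)
    have invS: "inv_into upper_sector (m_transform semicircle) ?w = \<i> * complex_of_real y"
      using inv_into_f_f[OF SC.m_transform_symmetric_inj_on uS] sym conv' mS by simp
    obtain v where "v > 0" "m_transform \<mu> (\<i> * complex_of_real v) = ?w" using \<epsilon>(2)[OF w(1,3)] by blast
    then have im\<mu>: "?w \<in> m_transform \<mu> ` upper_sector"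
      using imaginary_in_upper_sector[of v] by (metis image_eqI)
    define u where "u = inv_into upper_sector (m_transform \<mu>) ?w"
    have mu: "m_transform \<mu> u = ?w" unfolding u_def by (rule f_inv_into_f[OF im\<mu>])
    have "?w \<in> m_transform \<mu> ` upper_sector \<inter> m_transform \<nu> ` left_half_plane \<inter> m_transform semicircle ` upper_sector"
      using im\<mu> m\<nu> u\<nu> mS uS by (metis IntI image_eqI)
    then have "S_transform upper_sector \<mu> ?w = S_transform left_half_plane \<nu> ?w * S_transform upper_sector semicircle ?w"
      using conv' by blast
    then have S: "(1 + inverse ?w) * u = ((1 + inverse ?w) * (- of_real H)) * ((1 + inverse ?w) * (\<i> * of_real y))"
      unfolding S_transform_def inv\<nu> invS u_def .
    have f: "1 + inverse ?w = (1 + ?w) / ?w" using w_ne by (simp add: field_simps)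
    have ne: "1 + inverse ?w \<noteq> 0" unfolding f using w_ne by simp
    have "(1 + inverse ?w) * u = (1 + inverse ?w) * (- of_real H * ((1 + inverse ?w) * (\<i> * of_real y)))"
      unfolding S by (simp only: mult.assoc)
    then have "u = - of_real H * ((1 + inverse ?w) * (\<i> * of_real y))"
      by (rule mult_left_cancel[OF ne, THEN iffD1])
    also have "\<dots> = \<i> * of_real (- H * ((1 + w) / w * y))" unfolding f by simp
    also have "- H * ((1 + w) / w * y) = 1 / b"
    proof -
      have "(1 + w) * y = sqrt (- w)" using w by (simp add: y_def)
      also have "\<dots> = b * H" unfolding w_def a_def using b H by (simp add: real_sqrt_mult)
      finally have "- H * ((1 + w) / w * y) = - H * (b * H) / w" by simp
      also have "\<dots> = 1 / b" using H b by (simp add: w_def a_def power2_eq_square)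
      finally show ?thesis .
    qed
    finally have "u = \<i> * complex_of_real (1 / b)" .
    then have "m_transform \<mu> (\<i> * complex_of_real (1 / b)) = ?w" using mu by simp
    also have "?w = - of_real (b\<^sup>2) * (h (of_real (- b\<^sup>2)))\<^sup>2"
      using h by (simp add: w_def a_def)
    finally show "b > 0 \<and> m_transform \<mu> (\<i> * complex_of_real (1 / b)) = - of_real (b\<^sup>2) * (h (of_real (- b\<^sup>2)))\<^sup>2"
      using b by simp
  qed
qed

lemma square_in_cut_plane: "Im s > 0 \<Longrightarrow> s\<^sup>2 \<in> cut_plane"
  by (auto simp: cut_plane_def power2_eq_square)

text \<open>Both sides are holomorphic on the upper half plane and agree far up on the imaginary axis.\<close>

lemma cauchy_stieltjes_free_conv:
  assumes conv: "is_free_mult_conv \<nu> semicircle \<mu>" and s: "Im s > 0"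
  shows "cauchy_stieltjes \<mu> s = - (1 / s + s * (h (s\<^sup>2))\<^sup>2)"
proof -
  note conv' = conv[unfolded is_free_mult_conv_def]
  interpret \<mu>: real_distribution \<mu> using conv' by auto
  have sym: "symmetric_measure \<mu>" using conv' by auto
  obtain A where A: "\<And>b. b > A \<Longrightarrow> b > 0 \<and>
    m_transform \<mu> (\<i> * complex_of_real (1 / b)) = - of_real (b\<^sup>2) * (h (of_real (- b\<^sup>2)))\<^sup>2"
    using m_transform_free_conv[OF conv] by blast
  define f where "f s = cauchy_stieltjes \<mu> s + (1 / s + s * (h (s\<^sup>2))\<^sup>2)" for s
  have "f s = 0"
  proof (rule analytic_continuation[of f "{s. Im s > 0}" "(\<lambda>b. \<i> * complex_of_real b) ` {A<..}" "\<i> * complex_of_real (\<bar>A\<bar> + 1)"])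
    show "f holomorphic_on {s. Im s > 0}"
      unfolding f_def
      by (intro holomorphic_intros \<mu>.cauchy_stieltjes_holomorphic
            holomorphic_on_compose_gen[OF _ L.cauchy_stieltjes_holomorphic_cut_plane, of "\<lambda>s. s\<^sup>2", unfolded o_def])
         (auto intro!: holomorphic_intros square_in_cut_plane)
    show "open {s. Im s > 0}" by (rule open_halfspace_Im_gt)
    show "connected {s. Im s > 0}" by (intro convex_connected convex_halfspace_Im_gt)
    show "(\<lambda>b. \<i> * complex_of_real b) ` {A<..} \<subseteq> {s. Im s > 0}" using A by auto
    show "\<i> * complex_of_real (\<bar>A\<bar> + 1) \<in> {s. Im s > 0}" by (simp add: add_nonneg_pos)
    show "s \<in> {s. Im s > 0}" using s by simp
    show "\<i> * complex_of_real (\<bar>A\<bar> + 1) islimpt (\<lambda>b. \<i> * complex_of_real b) ` {A<..}"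
      unfolding islimpt_approachable
    proof (intro allI impI bexI conjI)
      fix e :: real assume e: "e > 0"
      show "\<i> * complex_of_real (\<bar>A\<bar> + 1 + e / 2) \<in> (\<lambda>b. \<i> * complex_of_real b) ` {A<..}"
        using e by (intro imageI) auto
      show "\<i> * complex_of_real (\<bar>A\<bar> + 1 + e / 2) \<noteq> \<i> * complex_of_real (\<bar>A\<bar> + 1)" using e by simp
      have "dist (\<i> * complex_of_real (\<bar>A\<bar> + 1 + e / 2)) (\<i> * complex_of_real (\<bar>A\<bar> + 1)) = e / 2"
        using e by (simp add: dist_norm norm_mult algebra_simps)
      then show "dist (\<i> * complex_of_real (\<bar>A\<bar> + 1 + e / 2)) (\<i> * complex_of_real (\<bar>A\<bar> + 1)) < e"
        using e by simp
    qed
    fix z assume "z \<in> (\<lambda>b. \<i> * complex_of_real b) ` {A<..}"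
    then obtain b where z: "z = \<i> * complex_of_real b" and "b > A" by auto
    with A have b: "b > 0" "m_transform \<mu> (\<i> * complex_of_real (1 / b)) = - of_real (b\<^sup>2) * (h (of_real (- b\<^sup>2)))\<^sup>2"
      by blast+
    have z2: "z\<^sup>2 = of_real (- b\<^sup>2)" by (simp add: z power_mult_distrib)
    have "cauchy_stieltjes \<mu> z = \<i> / of_real b * (1 - of_real (b\<^sup>2) * (h (z\<^sup>2))\<^sup>2)"
      unfolding z2 unfolding z \<mu>.cauchy_stieltjes_imaginary[OF sym b(1)] b(2) by simp
    also have "\<dots> = - (1 / z + z * (h (z\<^sup>2))\<^sup>2)"
      unfolding z using b(1) by (simp add: field_simps power2_eq_square)
    finally show "f z = 0" by (simp add: f_def)
  qed
  then show ?thesis by (simp only: f_def eq_neg_iff_add_eq_0)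
qed

section \<open>Boundary values\<close>

text \<open>The continuous extension of \<open>h\<close> to the closed upper half plane without the origin.\<close>

definition h_ext :: "complex \<Rightarrow> complex" where
  "h_ext z = Lim (at z within upper_half_plane) h"

lemma norm_h_le: "Im z > 0 \<Longrightarrow> norm (h z) \<le> 2 / norm z"
  using N.MP_graph_norm_le[OF MP_graph_h, of z] by (cases "z = 0") (auto simp: norm_mult field_simps)

lemma norm_h_diff_le:
  assumes "\<delta> > 0"
  obtains C where "C > 0" "\<And>z1 z2. Im z1 > 0 \<Longrightarrow> Im z2 > 0 \<Longrightarrow> norm z1 \<ge> \<delta> \<Longrightarrow> norm z2 \<ge> \<delta> \<Longrightarrow>
    (norm (h z1 - cnj (h z2)))\<^sup>2 * norm (h z1 - h z2) \<le> C * norm (z1 - z2)"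
proof -
  define R where "R = max 1 (2 / \<delta>)"
  have R: "R \<ge> 1" by (simp add: R_def)
  note c = N.holder_const_pos[OF R]
  have hR: "norm (h z) \<le> R" if "Im z > 0" "norm z \<ge> \<delta>" for z
  proof -
    have d: "0 < norm z * \<delta>" using that assms by (intro mult_pos_pos) linarith+
    have "norm (h z) \<le> 2 / norm z" by (rule norm_h_le[OF that(1)])
    also have "2 / norm z \<le> 2 / \<delta>" using that d by (intro divide_left_mono) auto
    finally show ?thesis by (simp add: R_def)
  qed
  show ?thesis
  proof (rule that[of "2 * R\<^sup>2 / N.holder_const R"])
    show "2 * R\<^sup>2 / N.holder_const R > 0" using c R by simp
    fix z1 z2 assume z: "Im z1 > 0" "Im z2 > 0" "norm z1 \<ge> \<delta>" "norm z2 \<ge> \<delta>"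
    have "N.holder_const R * (norm (h z1 - cnj (h z2)))\<^sup>2 * norm (h z1 - h z2) \<le> 2 * R\<^sup>2 * norm (z1 - z2)"
      by (rule N.MP_graph_holder[OF MP_graph_h MP_graph_h]) (use z R hR in auto)
    then show "(norm (h z1 - cnj (h z2)))\<^sup>2 * norm (h z1 - h z2) \<le> 2 * R\<^sup>2 / N.holder_const R * norm (z1 - z2)"
      using c by (simp add: field_simps)
  qed
qed

lemma Im_h_pos: "Im z > 0 \<Longrightarrow> Im (h z) > 0"
  using MP_graph_h N.MP_graphD(1) by blast

lemma norm_diff_le_norm_diff_cnj:
  assumes "Im w1 \<ge> 0" "Im w2 \<ge> 0"
  shows "norm (w1 - w2) \<le> norm (w1 - cnj w2)"
proof -
  have "\<bar>Im w1 - Im w2\<bar> \<le> \<bar>Im w1 + Im w2\<bar>" using assms by auto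
  then have "(Im w1 - Im w2)\<^sup>2 \<le> (Im w1 + Im w2)\<^sup>2" by (simp only: abs_le_square_iff)
  then show ?thesis by (simp add: cmod_def)
qed

text \<open>Since \<open>\<bar>w\<^sub>1 - w\<^sub>2\<bar> \<le> \<bar>w\<^sub>1 - cnj w\<^sub>2\<bar>\<close> in the upper half plane, the estimate above gives
  \<open>\<bar>h z\<^sub>1 - h z\<^sub>2\<bar>\<^sup>3 \<le> C \<bar>z\<^sub>1 - z\<^sub>2\<bar>\<close>.\<close>

lemma uniformly_continuous_on_h:
  assumes "\<delta> > 0"
  shows "uniformly_continuous_on {z. Im z > 0 \<and> norm z > \<delta>} h"
proof -
  obtain C where C: "C > 0" "\<And>z1 z2. Im z1 > 0 \<Longrightarrow> Im z2 > 0 \<Longrightarrow> norm z1 \<ge> \<delta> \<Longrightarrow> norm z2 \<ge> \<delta> \<Longrightarrow>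
    (norm (h z1 - cnj (h z2)))\<^sup>2 * norm (h z1 - h z2) \<le> C * norm (z1 - z2)"
    using norm_h_diff_le[OF assms] by blast
  show ?thesis
    unfolding uniformly_continuous_on_def
  proof (intro allI impI)
    fix e :: real assume e: "e > 0"
    show "\<exists>d>0. \<forall>x\<in>{z. Im z > 0 \<and> norm z > \<delta>}. \<forall>x'\<in>{z. Im z > 0 \<and> norm z > \<delta>}.
        dist x' x < d \<longrightarrow> dist (h x') (h x) < e"
    proof (intro exI[of _ "e ^ 3 / C"] conjI ballI impI)
      show "e ^ 3 / C > 0" using e C(1) by simp
      fix x x' assume x: "x \<in> {z. Im z > 0 \<and> norm z > \<delta>}" "x' \<in> {z. Im z > 0 \<and> norm z > \<delta>}"
        and d: "dist x' x < e ^ 3 / C"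
      have "(norm (h x' - h x)) ^ 3 = (norm (h x' - h x))\<^sup>2 * norm (h x' - h x)"
        by (simp add: power3_eq_cube power2_eq_square)
      also have "\<dots> \<le> (norm (h x' - cnj (h x)))\<^sup>2 * norm (h x' - h x)"
        using x Im_h_pos by (intro mult_right_mono power_mono norm_diff_le_norm_diff_cnj) (auto simp: less_imp_le)
      also have "\<dots> \<le> C * norm (x' - x)" using x by (intro C(2)) auto
      also have "\<dots> < e ^ 3" using d C(1) by (simp add: dist_norm field_simps)
      finally have "norm (h x' - h x) < e" using e by (metis not_less power_mono less_imp_le norm_ge_zero)
      then show "dist (h x') (h x) < e" by (simp add: dist_norm)
    qed
  qed
qed

lemma closed_upper_half_plane_in_closure:
  assumes "Im z \<ge> 0" "norm z > \<delta>"
  shows "z \<in> closure {z. Im z > 0 \<and> norm z > \<delta>}"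
proof (rule closure_sequential[THEN iffD2], intro exI conjI allI)
  let ?u = "\<lambda>n. z + \<i> * of_real (1 / real (Suc n))"
  have "(\<lambda>n. 1 / real (Suc n)) \<longlonglongrightarrow> 0" using LIMSEQ_Suc[OF lim_1_over_n] by simp
  then have "?u \<longlonglongrightarrow> z + \<i> * of_real 0" by (intro tendsto_intros)
  then show "?u \<longlonglongrightarrow> z" by simp
  fix n
  have Im: "Im (?u n) > Im z" by simp
  have "Re (?u n) = Re z" by simp
  moreover have "(Im z)\<^sup>2 \<le> (Im (?u n))\<^sup>2" using assms(1) Im by (intro power_mono) auto
  ultimately have "(norm z)\<^sup>2 \<le> (norm (?u n))\<^sup>2" by (simp only: cmod_power2 add_left_mono)
  then have "norm z \<le> norm (?u n)" by (rule power2_le_imp_le) simp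
  moreover have "Im (?u n) > 0" using assms(1) Im by linarith
  ultimately show "?u n \<in> {z. Im z > 0 \<and> norm z > \<delta>}"
    using assms(2) by (intro CollectI conjI) linarith+
qed

lemma upper_half_plane_at_neq_bot:
  assumes "Im z \<ge> 0"
  shows "at z within upper_half_plane \<noteq> bot"
proof -
  have "z islimpt upper_half_plane"
    unfolding islimpt_approachable
  proof (intro allI impI bexI conjI)
    fix e :: real assume "e > 0"
    then show "z + \<i> * of_real (e / 2) \<in> upper_half_plane" "z + \<i> * of_real (e / 2) \<noteq> z"
      "dist (z + \<i> * of_real (e / 2)) z < e"
      using assms by (auto simp: upper_half_plane_def dist_norm norm_mult)
  qed
  then show ?thesis by (simp add: trivial_limit_within)
qed

lemma h_ext_props:
  assumes "\<delta> > 0"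
  shows "continuous_on {z. Im z \<ge> 0 \<and> norm z > \<delta>} h_ext"
    and "\<And>z. Im z \<ge> 0 \<Longrightarrow> norm z > \<delta> \<Longrightarrow> (h \<longlongrightarrow> h_ext z) (at z within upper_half_plane)"
proof -
  let ?X = "{z. Im z > 0 \<and> norm z > \<delta>}"
  obtain g where g: "uniformly_continuous_on (closure ?X) g" "\<And>x. x \<in> ?X \<Longrightarrow> h x = g x"
    using uniformly_continuous_on_extension_on_closure[OF uniformly_continuous_on_h[OF assms]] by metis
  have contg: "continuous_on (closure ?X) g" using g(1) by (rule uniformly_continuous_imp_continuous)
  have lim: "(h \<longlongrightarrow> g z) (at z within upper_half_plane)" if z: "Im z \<ge> 0" "norm z > \<delta>" for z
  proof -
    have zc: "z \<in> closure ?X" using closed_upper_half_plane_in_closure z by blast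
    then have "(g \<longlongrightarrow> g z) (at z within closure ?X)" using contg by (simp add: continuous_on_def)
    then have "(g \<longlongrightarrow> g z) (at z within ?X)" by (rule tendsto_within_subset) (rule closure_subset)
    then have "(h \<longlongrightarrow> g z) (at z within ?X)"
      by (rule Lim_transform_eventually) (use g(2) in \<open>auto simp: eventually_at_filter\<close>)
    moreover have "at z within ?X = at z within upper_half_plane"
    proof (rule at_within_nhd[of z "{z. norm z > \<delta>}"])
      show "open {z :: complex. norm z > \<delta>}" by (intro open_Collect_less continuous_intros)
    qed (use z in \<open>auto simp: upper_half_plane_def\<close>)
    ultimately show ?thesis by simp
  qed
  have eq: "h_ext z = g z" if "Im z \<ge> 0" "norm z > \<delta>" for z
    unfolding h_ext_def by (rule tendsto_Lim[OF upper_half_plane_at_neq_bot lim]) (use that in auto)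
  then show "\<And>z. Im z \<ge> 0 \<Longrightarrow> norm z > \<delta> \<Longrightarrow> (h \<longlongrightarrow> h_ext z) (at z within upper_half_plane)"
    using lim by simp
  have "continuous_on {z. Im z \<ge> 0 \<and> norm z > \<delta>} g"
    by (rule continuous_on_subset[OF contg]) (use closed_upper_half_plane_in_closure in blast)
  then show "continuous_on {z. Im z \<ge> 0 \<and> norm z > \<delta>} h_ext"
    by (rule continuous_on_eq) (use eq in auto)
qed

lemma h_ext_tendsto:
  assumes "Im z \<ge> 0" "z \<noteq> 0"
  shows "(h \<longlongrightarrow> h_ext z) (at z within upper_half_plane)"
  using h_ext_props(2)[of "norm z / 2" z] assms by simp

lemma continuous_on_h_ext: "continuous_on {z. Im z \<ge> 0 \<and> z \<noteq> 0} h_ext"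
  unfolding continuous_on_eq_continuous_within
proof
  fix z assume z: "z \<in> {z. Im z \<ge> 0 \<and> z \<noteq> 0}"
  let ?T = "{w. Im w \<ge> 0 \<and> norm w > norm z / 2}"
  have "continuous (at z within ?T) h_ext"
    using h_ext_props(1)[of "norm z / 2"] z by (auto simp: continuous_on_eq_continuous_within)
  moreover have "at z within ?T = at z within {z. Im z \<ge> 0 \<and> z \<noteq> 0}"
  proof (rule at_within_nhd[of z "{w. norm w > norm z / 2}"])
    show "open {w :: complex. norm w > norm z / 2}" by (intro open_Collect_less continuous_intros)
  qed (use z in auto)
  ultimately show "continuous (at z within {z. Im z \<ge> 0 \<and> z \<noteq> 0}) h_ext" by simp
qed

lemma h_ext_eq: "Im z > 0 \<Longrightarrow> h_ext z = h z"
proof -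
  assume z: "Im z > 0"
  have "isCont h z"
    using L.cauchy_stieltjes_holomorphic z
    by (intro field_differentiable_imp_continuous_at holomorphic_on_imp_differentiable_at[of _ "{z. Im z > 0}"])
       (auto intro: open_halfspace_Im_gt)
  then have "(h \<longlongrightarrow> h z) (at z within upper_half_plane)"
    by (simp add: isCont_def tendsto_within_subset[OF _ subset_UNIV])
  then show ?thesis
    unfolding h_ext_def using z by (intro tendsto_Lim upper_half_plane_at_neq_bot) auto
qed

lemma h_boundary_eq: "h_boundary M x = h_ext (of_real x)"
  by (simp add: h_boundary_def h_ext_def)

lemma Im_h_ext_nonneg:
  assumes "Im z \<ge> 0" "z \<noteq> 0"
  shows "Im (h_ext z) \<ge> 0"
proof (rule tendsto_lowerbound[OF tendsto_Im[OF h_ext_tendsto[OF assms]]])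
  show "\<forall>\<^sub>F x in at z within upper_half_plane. 0 \<le> Im (h x)"
    using Im_h_pos by (auto simp: eventually_at_filter upper_half_plane_def less_imp_le)
qed (rule upper_half_plane_at_neq_bot[OF assms(1)])

lemma isCont_resolvent_mean: "Im w \<noteq> 0 \<Longrightarrow> isCont N.resolvent_mean w"
proof -
  assume "Im w \<noteq> 0"
  moreover have "open {w. Im w \<noteq> (0 :: real)}" by (intro open_Collect_neq continuous_intros)
  moreover have "N.resolvent_mean holomorphic_on {w. Im w \<noteq> 0}"
    by (rule holomorphic_on_subset[OF N.resolvent_mean_holomorphic]) auto
  ultimately show ?thesis
    by (intro field_differentiable_imp_continuous_at holomorphic_on_imp_differentiable_at[of _ "{w. Im w \<noteq> 0}"]) auto
qed

lemma MP_graph_h_ext: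
  assumes "Im z \<ge> 0" "z \<noteq> 0" "Im (h_ext z) > 0"
  shows "N.MP_graph z (h_ext z)"
proof -
  let ?F = "at z within upper_half_plane"
  have "isCont N.resolvent_mean (h_ext z)" using isCont_resolvent_mean assms(3) by simp
  then have 1: "((\<lambda>u. N.resolvent_mean (h u)) \<longlongrightarrow> N.resolvent_mean (h_ext z)) ?F"
    using h_ext_tendsto[OF assms(1,2)] by (rule isCont_tendsto_compose)
  have "((\<lambda>u. 1 + u * (h u)\<^sup>2) \<longlongrightarrow> 1 + z * (h_ext z)\<^sup>2) ?F"
    by (intro tendsto_intros h_ext_tendsto[OF assms(1,2)])
  then have 2: "((\<lambda>u. N.resolvent_mean (h u)) \<longlongrightarrow> 1 + z * (h_ext z)\<^sup>2) ?F"
    by (rule Lim_transform_eventually)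
       (use MP_graph_h in \<open>auto simp: eventually_at_filter N.MP_graph_def upper_half_plane_def\<close>)
  have "N.resolvent_mean (h_ext z) = 1 + z * (h_ext z)\<^sup>2"
    by (rule tendsto_unique[OF upper_half_plane_at_neq_bot[OF assms(1)] 1 2])
  then show ?thesis using assms(3) by (simp add: N.MP_graph_def)
qed

end

section \<open>Stieltjes inversion\<close>

lemma (in real_distribution) continuous_on_Im_cauchy_stieltjes:
  assumes "y > 0"
  shows "continuous_on UNIV (\<lambda>x. Im (cauchy_stieltjes M (Complex x y)))"
  by (intro continuous_intros continuous_on_compose2[OF holomorphic_on_imp_continuous_on[OF cauchy_stieltjes_holomorphic]])
     (use assms in \<open>auto simp: Complex_eq intro!: continuous_intros\<close>)

text \<open>By Tonelli's theorem: the imaginary part is the mean of the kernel \<open>y / ((t - x)\<^sup>2 + y\<^sup>2)\<close>, whose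
  antiderivative in \<open>x\<close> is \<open>arctan ((x - t) / y)\<close>.\<close>

lemma (in real_distribution) poisson_integral_interval:
  assumes y: "y > 0" and ab: "a \<le> b"
  shows "(\<integral>x. indicator {a..b} x * Im (cauchy_stieltjes M (Complex x y)) \<partial>lborel)
    = (\<integral>t. arctan ((b - t) / y) - arctan ((a - t) / y) \<partial>M)"
proof -
  define P where "P x t = y / ((t - x)\<^sup>2 + y\<^sup>2)" for x t
  have pos: "0 < (t - x)\<^sup>2 + y\<^sup>2" for x t using y by (simp add: add_nonneg_pos)
  have P_nonneg: "0 \<le> P x t" for x t using pos[of t x] y by (simp add: P_def)
  have P_meas: "(\<lambda>(x, t). P x t) \<in> borel_measurable (borel \<Otimes>\<^sub>M borel)"
    unfolding P_def by measurable
  have intP: "integrable M (\<lambda>t. P x t)" for x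
  proof (rule integrable_boundedI[where B = "1 / y"])
    have "P x t \<le> y / y\<^sup>2" for t
      unfolding P_def using y pos[of t x] by (intro divide_left_mono mult_pos_pos) auto
    then show "AE t in M. norm (P x t) \<le> 1 / y" using P_nonneg y by (simp add: power2_eq_square)
  qed (simp add: P_def)
  have Im: "Im (cauchy_stieltjes M (Complex x y)) = (\<integral>t. P x t \<partial>M)" for x
    using Im_cauchy_stieltjes[of "Complex x y"] y by (simp add: P_def)
  have Im_nn: "ennreal (Im (cauchy_stieltjes M (Complex x y))) = (\<integral>\<^sup>+t. ennreal (P x t) \<partial>M)" for x
    unfolding Im by (rule nn_integral_eq_integral[symmetric, OF intP]) (simp add: P_nonneg)
  have Im_nonneg: "0 \<le> Im (cauchy_stieltjes M (Complex x y))" for x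
    unfolding Im by (intro Bochner_Integration.integral_nonneg P_nonneg)
  interpret pair: pair_sigma_finite lborel M
    by (intro pair_sigma_finite.intro sigma_finite_lborel sigma_finite_measure_axioms)
  have inner: "(\<integral>\<^sup>+x. ennreal (P x t) * indicator {a..b} x \<partial>lborel) = ennreal (arctan ((b - t) / y) - arctan ((a - t) / y))" for t
  proof (rule nn_integral_FTC_Icc)
    show "(\<lambda>x. P x t) \<in> borel_measurable borel" unfolding P_def by measurable
    show "0 \<le> P x t" for x by (rule P_nonneg)
    fix x
    have "((\<lambda>x. (x - t) / y) has_real_derivative 1 / y) (at x)"
      using y by (auto intro!: derivative_eq_intros)
    from DERIV_chain2[OF DERIV_arctan this]
    have "((\<lambda>x. arctan ((x - t) / y)) has_real_derivative inverse (1 + ((x - t) / y)\<^sup>2) * (1 / y)) (at x)" .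
    also have "inverse (1 + ((x - t) / y)\<^sup>2) * (1 / y) = P x t"
    proof -
      have "1 + ((x - t) / y)\<^sup>2 = ((t - x)\<^sup>2 + y\<^sup>2) / y\<^sup>2"
        using y by (simp add: field_simps power2_commute[of x t])
      then show ?thesis using y pos[of t x] by (simp add: P_def power2_eq_square)
    qed
    finally show "((\<lambda>x. arctan ((x - t) / y)) has_real_derivative P x t) (at x)" .
  qed (rule ab)
  have mono: "0 \<le> arctan ((b - t) / y) - arctan ((a - t) / y)" for t
    using ab y by (simp add: arctan_le_iff divide_right_mono)
  have "(\<integral>\<^sup>+x. ennreal (indicator {a..b} x * Im (cauchy_stieltjes M (Complex x y))) \<partial>lborel)
      = (\<integral>\<^sup>+x. (\<integral>\<^sup>+t. ennreal (P x t) * indicator {a..b} x \<partial>M) \<partial>lborel)"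
  proof (rule nn_integral_cong)
    fix x
    have "(\<integral>\<^sup>+t. ennreal (P x t) * indicator {a..b} x \<partial>M) = (\<integral>\<^sup>+t. ennreal (P x t) \<partial>M) * indicator {a..b} x"
      by (rule nn_integral_multc) (simp add: P_def)
    then show "ennreal (indicator {a..b} x * Im (cauchy_stieltjes M (Complex x y)))
        = (\<integral>\<^sup>+t. ennreal (P x t) * indicator {a..b} x \<partial>M)"
      by (simp add: Im_nn[symmetric] indicator_def)
  qed
  also have "\<dots> = (\<integral>\<^sup>+t. (\<integral>\<^sup>+x. ennreal (P x t) * indicator {a..b} x \<partial>lborel) \<partial>M)"
  proof (rule pair.Fubini'[symmetric])
    show "(\<lambda>(x, t). ennreal (P x t) * indicator {a..b} x) \<in> borel_measurable (lborel \<Otimes>\<^sub>M M)"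
      unfolding P_def by measurable
  qed
  also have "\<dots> = (\<integral>\<^sup>+t. ennreal (arctan ((b - t) / y) - arctan ((a - t) / y)) \<partial>M)"
    unfolding inner ..
  finally have eq: "(\<integral>\<^sup>+x. ennreal (indicator {a..b} x * Im (cauchy_stieltjes M (Complex x y))) \<partial>lborel)
    = (\<integral>\<^sup>+t. ennreal (arctan ((b - t) / y) - arctan ((a - t) / y)) \<partial>M)" .
  have meas: "(\<lambda>x. Im (cauchy_stieltjes M (Complex x y))) \<in> borel_measurable borel"
    using continuous_on_Im_cauchy_stieltjes[OF y] by (rule borel_measurable_continuous_onI)
  have "(\<integral>x. indicator {a..b} x * Im (cauchy_stieltjes M (Complex x y)) \<partial>lborel)
      = enn2real (\<integral>\<^sup>+x. ennreal (indicator {a..b} x * Im (cauchy_stieltjes M (Complex x y))) \<partial>lborel)"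
    using meas by (intro integral_eq_nn_integral) (auto simp: Im_nonneg)
  also have "\<dots> = (\<integral>t. arctan ((b - t) / y) - arctan ((a - t) / y) \<partial>M)"
    unfolding eq by (rule integral_eq_nn_integral[symmetric]) (measurable, intro AE_I2 mono)
  finally show ?thesis .
qed

lemma arctan_mult_Suc_tendsto: "(\<lambda>n. arctan (c * real (Suc n))) \<longlonglongrightarrow> sgn c * (pi / 2)"
proof -
  have top: "filterlim (\<lambda>n. real (Suc n)) at_top sequentially"
    using filterlim_compose[OF filterlim_real_sequentially filterlim_Suc] .
  consider "c = 0" | "c > 0" | "c < 0" by linarith
  then show ?thesis
  proof cases
    case 2
    have "(\<lambda>n. arctan (c * real (Suc n))) \<longlonglongrightarrow> pi / 2"
      by (rule filterlim_compose[OF tendsto_arctan_at_top])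
         (rule filterlim_tendsto_pos_mult_at_top[OF tendsto_const 2 top])
    then show ?thesis using 2 by simp
  next
    case 3
    have "(\<lambda>n. arctan (c * real (Suc n))) \<longlonglongrightarrow> - (pi / 2)"
      by (rule filterlim_compose[OF tendsto_arctan_at_bot])
         (rule filterlim_tendsto_neg_mult_at_bot[OF tendsto_const 3 top])
    then show ?thesis using 3 by simp
  qed simp
qed

text \<open>In the limit \<open>y \<rightarrow> 0\<close> an endpoint of the interval carries half of its mass.\<close>

lemma (in real_distribution) stieltjes_inversion_interval:
  assumes ab: "a < b"
    and cont: "continuous_on (cbox (Complex a 0) (Complex b 1)) g"
    and g: "\<And>z. Im z > 0 \<Longrightarrow> Re z \<in> {a..b} \<Longrightarrow> g z = cauchy_stieltjes M z"
  shows "(\<integral>x. indicator {a..b} x * Im (g (of_real x)) \<partial>lborel)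
    = (\<integral>t. (sgn (b - t) - sgn (a - t)) * (pi / 2) \<partial>M)"
proof -
  let ?K = "cbox (Complex a 0) (Complex b 1)"
  define y where "y n = 1 / real (Suc n)" for n
  have y: "0 < y n" "y n \<le> 1" for n by (auto simp: y_def)
  have K: "Complex x v \<in> ?K \<longleftrightarrow> x \<in> {a..b} \<and> v \<in> {0..1}" for x v
    by (simp add: in_cbox_complex_iff)
  have "compact (g ` ?K)" by (rule compact_continuous_image[OF cont compact_cbox])
  then obtain C where C: "\<And>z. z \<in> ?K \<Longrightarrow> norm (g z) \<le> C"
    by (meson bounded_iff compact_imp_bounded imageI)
  have lhs: "(\<lambda>n. \<integral>x. indicator {a..b} x * Im (cauchy_stieltjes M (Complex x (y n))) \<partial>lborel)
      \<longlonglongrightarrow> (\<integral>x. indicator {a..b} x * Im (g (of_real x)) \<partial>lborel)"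
  proof (rule integral_dominated_convergence[where w = "\<lambda>x. indicator {a..b} x * C"])
    have "continuous_on {a..b} (\<lambda>x. Im (g (of_real x)))"
      by (intro continuous_intros continuous_on_compose2[OF cont]) (auto simp: complex_of_real_def K)
    then have "set_borel_measurable borel {a..b} (\<lambda>x. Im (g (of_real x)))"
      by (rule borel_measurable_continuous_on_indicator[unfolded set_borel_measurable_def, rotated, folded set_borel_measurable_def]) simp
    then show "(\<lambda>x. indicator {a..b} x * Im (g (of_real x))) \<in> borel_measurable lborel"
      by (simp add: set_borel_measurable_def)
    show "(\<lambda>x. indicator {a..b} x * Im (cauchy_stieltjes M (Complex x (y n)))) \<in> borel_measurable lborel" for n
      using borel_measurable_continuous_onI[OF continuous_on_Im_cauchy_stieltjes[OF y(1)]] by simp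
    show "integrable lborel (\<lambda>x. indicator {a..b} x * C)"
      using ab by (intro integrable_mult_left integrable_real_indicator) auto
    show "AE x in lborel. (\<lambda>n. indicator {a..b} x * Im (cauchy_stieltjes M (Complex x (y n))))
        \<longlonglongrightarrow> indicator {a..b} x * Im (g (of_real x))"
    proof (intro AE_I2)
      fix x
      show "(\<lambda>n. indicator {a..b} x * Im (cauchy_stieltjes M (Complex x (y n))))
        \<longlonglongrightarrow> indicator {a..b} x * Im (g (of_real x))"
      proof (cases "x \<in> {a..b}")
        case True
        have "y \<longlonglongrightarrow> 0" unfolding y_def using LIMSEQ_Suc[OF lim_1_over_n] by simp
        then have "(\<lambda>n. Complex x (y n)) \<longlonglongrightarrow> of_real x"
          unfolding complex_of_real_def by (intro tendsto_Complex tendsto_const)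
        then have "(\<lambda>n. g (Complex x (y n))) \<longlonglongrightarrow> g (of_real x)"
          using True y by (intro continuous_on_tendsto_compose[OF cont]) (auto simp: complex_of_real_def K less_imp_le)
        moreover have "g (Complex x (y n)) = cauchy_stieltjes M (Complex x (y n))" for n
          using True y(1)[of n] by (intro g) auto
        ultimately show ?thesis using True by (auto intro: tendsto_Im)
      qed simp
    qed
    show "AE x in lborel. norm (indicator {a..b} x * Im (cauchy_stieltjes M (Complex x (y n)))) \<le> indicator {a..b} x * C" for n
    proof (intro AE_I2)
      fix x
      show "norm (indicator {a..b} x * Im (cauchy_stieltjes M (Complex x (y n)))) \<le> indicator {a..b} x * C"
      proof (cases "x \<in> {a..b}")
        case True
        then have "norm (g (Complex x (y n))) \<le> C" using y[of n] by (intro C) (simp add: K)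
        moreover have "g (Complex x (y n)) = cauchy_stieltjes M (Complex x (y n))"
          using True y(1)[of n] by (intro g) auto
        ultimately show ?thesis using True abs_Im_le_cmod[of "cauchy_stieltjes M (Complex x (y n))"] by simp
      qed simp
    qed
  qed
  have rhs: "(\<lambda>n. \<integral>t. arctan ((b - t) / y n) - arctan ((a - t) / y n) \<partial>M)
      \<longlonglongrightarrow> (\<integral>t. (sgn (b - t) - sgn (a - t)) * (pi / 2) \<partial>M)"
  proof (rule integral_dominated_convergence[where w = "\<lambda>_. pi"])
    show "AE t in M. (\<lambda>n. arctan ((b - t) / y n) - arctan ((a - t) / y n)) \<longlonglongrightarrow> (sgn (b - t) - sgn (a - t)) * (pi / 2)"
      unfolding left_diff_distrib using tendsto_diff[OF arctan_mult_Suc_tendsto arctan_mult_Suc_tendsto]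
      by (intro AE_I2) (simp add: y_def del: of_nat_Suc)
    show "AE t in M. norm (arctan ((b - t) / y n) - arctan ((a - t) / y n)) \<le> pi" for n
    proof (intro AE_I2)
      fix t
      show "norm (arctan ((b - t) / y n) - arctan ((a - t) / y n)) \<le> pi"
        using arctan_bounded[of "(b - t) / y n"] arctan_bounded[of "(a - t) / y n"] by (simp add: abs_le_iff)
    qed
  qed auto
  show ?thesis
    by (rule LIMSEQ_unique[OF lhs]) (use rhs in \<open>simp add: poisson_integral_interval[OF y(1)] less_imp_le[OF ab]\<close>)
qed

text \<open>Laws whose transform extends continuously to the positive real axis. The extension is asked for over the
  right half plane only, because that of a symmetric law need not be continuous at the origin and the
  negative axis follows by symmetry.\<close>

locale stieltjes_boundary = real_distribution +
  fixes g :: "complex \<Rightarrow> complex"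
  assumes g_continuous: "continuous_on {z. Re z > 0 \<and> Im z \<ge> 0} g"
    and g_eq: "\<And>z. Re z > 0 \<Longrightarrow> Im z > 0 \<Longrightarrow> g z = cauchy_stieltjes M z"
    and g_nonneg: "\<And>x. x > 0 \<Longrightarrow> 0 \<le> Im (g (of_real x))"
begin

lemma inversion:
  assumes "0 < a" "a < b"
  shows "(\<integral>x. indicator {a..b} x * Im (g (of_real x)) \<partial>lborel)
    = (\<integral>t. (sgn (b - t) - sgn (a - t)) * (pi / 2) \<partial>M)"
proof (rule stieltjes_inversion_interval[OF assms(2)])
  show "continuous_on (cbox (Complex a 0) (Complex b 1)) g"
    by (rule continuous_on_subset[OF g_continuous]) (use assms in \<open>auto simp: in_cbox_complex_iff\<close>)
qed (use assms g_eq in auto)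

lemma continuous_on_density: "continuous_on {0<..} (\<lambda>x. Im (g (of_real x)))"
  by (intro continuous_intros continuous_on_compose2[OF g_continuous]) auto

lemma sgn_kernel_bounds:
  assumes "a < b"
  shows "integrable M (\<lambda>t. (sgn (b - t) - sgn (a - t)) * (pi / 2))"
    and "(pi / 2) * measure M {a} \<le> (\<integral>t. (sgn (b - t) - sgn (a - t)) * (pi / 2) \<partial>M)"
proof -
  show int: "integrable M (\<lambda>t. (sgn (b - t) - sgn (a - t)) * (pi / 2))"
    by (rule integrable_boundedI[where B = pi]) (auto simp: sgn_if)
  have "(\<integral>t. (pi / 2) * indicator {a} t \<partial>M) \<le> (\<integral>t. (sgn (b - t) - sgn (a - t)) * (pi / 2) \<partial>M)"
  proof (rule integral_mono[OF _ int])
    show "integrable M (\<lambda>t. (pi / 2) * indicator {a} t)"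
      by (intro integrable_mult_right integrable_real_indicator) (auto simp: emeasure_eq_measure)
  qed (use assms in \<open>auto simp: sgn_if indicator_def\<close>)
  then show "(pi / 2) * measure M {a} \<le> (\<integral>t. (sgn (b - t) - sgn (a - t)) * (pi / 2) \<partial>M)" by simp
qed

text \<open>The interval \<open>[a, a + e]\<close> contains half of the mass at \<open>a\<close>, while the integral of the bounded density
  over it is \<open>O(e)\<close>.\<close>

lemma no_atom:
  assumes a: "a > 0"
  shows "measure M {a} = 0"
proof -
  have "compact ((\<lambda>x. Im (g (of_real x))) ` {a..a + 1})"
    by (rule compact_continuous_image[OF continuous_on_subset[OF continuous_on_density]]) (use a in auto)
  then obtain C where C: "\<And>x. x \<in> {a..a + 1} \<Longrightarrow> norm (Im (g (of_real x))) \<le> C"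
    by (meson bounded_iff compact_imp_bounded imageI)
  have bound: "(pi / 2) * measure M {a} \<le> C * e" if e: "0 < e" "e \<le> 1" for e
  proof -
    have "(pi / 2) * measure M {a} \<le> (\<integral>t. (sgn (a + e - t) - sgn (a - t)) * (pi / 2) \<partial>M)"
      by (rule sgn_kernel_bounds(2)) (use e in simp)
    also have "\<dots> = (\<integral>x. indicator {a..a + e} x * Im (g (of_real x)) \<partial>lborel)"
      by (rule inversion[symmetric]) (use a e in auto)
    also have "\<dots> \<le> (\<integral>x. C * indicator {a..a + e} x \<partial>lborel)"
    proof (rule integral_mono)
      have "set_integrable lborel {a..a + e} (\<lambda>x. Im (g (of_real x)))"
        by (rule borel_integrable_atLeastAtMost', rule continuous_on_subset[OF continuous_on_density]) (use a in auto)
      then show "integrable lborel (\<lambda>x. indicator {a..a + e} x * Im (g (of_real x)))"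
        by (simp add: set_integrable_def)
      show "indicator {a..a + e} x * Im (g (of_real x)) \<le> C * indicator {a..a + e} x" for x
        using C[of x] e by (auto simp: indicator_def abs_le_iff)
    qed (use e in \<open>auto intro!: integrable_mult_right integrable_real_indicator\<close>)
    also have "\<dots> = C * e" using e by simp
    finally show ?thesis .
  qed
  have "(\<lambda>n. C * (1 / real (Suc n))) \<longlonglongrightarrow> C * 0"
    using LIMSEQ_Suc[OF lim_1_over_n] by (intro tendsto_intros) simp
  moreover have "(pi / 2) * measure M {a} \<le> C * (1 / real (Suc n))" for n
    by (rule bound) auto
  ultimately have "(pi / 2) * measure M {a} \<le> C * 0" by (intro LIMSEQ_le_const) auto
  then show ?thesis using measure_nonneg[of M "{a}"] pi_gt_zero by (auto simp: mult_le_0_iff)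
qed

lemma emeasure_interval:
  assumes "0 < a" "a < b"
  shows "emeasure M {a<..<b} = (\<integral>\<^sup>+x\<in>{a<..<b}. ennreal (Im (g (of_real x)) / pi) \<partial>lborel)"
proof -
  have set_int: "set_integrable lborel {a..b} (\<lambda>x. Im (g (of_real x)))"
    by (rule borel_integrable_atLeastAtMost', rule continuous_on_subset[OF continuous_on_density]) (use assms in auto)
  then have int: "integrable lborel (\<lambda>x. indicator {a..b} x * Im (g (of_real x)))"
    by (simp add: set_integrable_def)
  have AE_ne: "AE t in M. t \<noteq> c" if "c > 0" for c
    using no_atom[OF that] by (intro AE_I[of _ _ "{c}"]) (auto simp: emeasure_eq_measure)
  have "(\<integral>t. (sgn (b - t) - sgn (a - t)) * (pi / 2) \<partial>M) = (\<integral>t. pi * indicator {a<..<b} t \<partial>M)"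
  proof (rule integral_cong_AE)
    show "AE t in M. (sgn (b - t) - sgn (a - t)) * (pi / 2) = pi * indicator {a<..<b} t"
      using AE_ne[OF assms(1)] AE_ne[OF less_trans[OF assms]]
      by eventually_elim (use assms in \<open>auto simp: sgn_if indicator_def\<close>)
  qed auto
  then have eq: "pi * measure M {a<..<b} = (\<integral>x. indicator {a..b} x * Im (g (of_real x)) \<partial>lborel)"
    using inversion[OF assms] by simp
  have "(\<integral>\<^sup>+x\<in>{a<..<b}. ennreal (Im (g (of_real x)) / pi) \<partial>lborel)
      = (\<integral>\<^sup>+x. ennreal ((1 / pi) * (indicator {a..b} x * Im (g (of_real x)))) \<partial>lborel)"
  proof (rule nn_integral_cong_AE)
    have "AE x in lborel. x \<noteq> a" "AE x in lborel. x \<noteq> b" by (rule AE_lborel_singleton)+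
    then show "AE x in lborel. ennreal (Im (g (of_real x)) / pi) * indicator {a<..<b} x
        = ennreal ((1 / pi) * (indicator {a..b} x * Im (g (of_real x))))"
      by eventually_elim (auto simp: indicator_def)
  qed
  also have "\<dots> = ennreal (\<integral>x. (1 / pi) * (indicator {a..b} x * Im (g (of_real x))) \<partial>lborel)"
    using assms g_nonneg by (intro nn_integral_eq_integral integrable_mult_right int) (auto simp: indicator_def)
  also have "(\<integral>x. (1 / pi) * (indicator {a..b} x * Im (g (of_real x))) \<partial>lborel) = measure M {a<..<b}"
    unfolding integral_mult_right_zero eq[symmetric] by simp
  finally show ?thesis by (simp add: emeasure_eq_measure)
qed

lemma density_measurable: "(\<lambda>x. ennreal (Im (g (of_real x)) / pi) * indicator {0<..} x) \<in> borel_measurable borel"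
proof -
  have "(\<lambda>x. indicator {0<..} x *\<^sub>R Im (g (of_real x))) \<in> borel_measurable borel"
    by (rule borel_measurable_continuous_on_indicator[OF _ continuous_on_density]) simp
  then have "(\<lambda>x. ennreal ((indicator {0<..} x *\<^sub>R Im (g (of_real x))) / pi)) \<in> borel_measurable borel"
    by measurable
  also have "(\<lambda>x. ennreal ((indicator {0<..} x *\<^sub>R Im (g (of_real x))) / pi))
      = (\<lambda>x. ennreal (Im (g (of_real x)) / pi) * indicator {0<..} x)"
    by (auto simp: fun_eq_iff indicator_def)
  finally show ?thesis .
qed

text \<open>Both measures agree on open intervals with positive endpoints, and every ray cut at zero is an
  increasing union of these.\<close>

lemma emeasure_positive_part:
  assumes A: "A \<in> sets borel"
  shows "emeasure M (A \<inter> {0<..}) = (\<integral>\<^sup>+x\<in>A \<inter> {0<..}. ennreal (Im (g (of_real x)) / pi) \<partial>lborel)"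
proof -
  let ?r = "\<lambda>x. ennreal (Im (g (of_real x)) / pi) * indicator {0<..} x"
  define N1 where "N1 = density M (indicator {0<..})"
  define N2 where "N2 = density lborel ?r"
  have N1: "emeasure N1 B = emeasure M (B \<inter> {0<..})" if "B \<in> sets borel" for B
    using that by (simp add: N1_def emeasure_density mult.commute flip: indicator_inter_arith)
  have N2: "emeasure N2 B = (\<integral>\<^sup>+x\<in>B \<inter> {0<..}. ennreal (Im (g (of_real x)) / pi) \<partial>lborel)" if "B \<in> sets borel" for B
    using that density_measurable
    by (simp add: N2_def emeasure_density indicator_inter_arith mult_ac)
  have "N1 = N2"
  proof (rule measure_eqI_lessThan)
    show "sets N1 = sets borel" "sets N2 = sets borel" by (simp_all add: N1_def N2_def)
    fix x :: real
    show "emeasure N1 {x<..} < \<infinity>" using N1[of "{x<..}"] by (simp add: less_top[symmetric] emeasure_eq_measure)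
    define c where "c = max x 0"
    define I where "I n = {c + 1 / real (Suc n)<..<c + real (Suc (Suc n))}" for n
    have U: "(\<Union>n. I n) = {x<..} \<inter> {0<..}"
    proof (intro equalityI subsetI)
      fix t assume "t \<in> {x<..} \<inter> {0<..}"
      then have t: "t - c > 0" by (auto simp: c_def)
      obtain n1 where n1: "1 / real (Suc n1) < t - c" using t nat_approx_posE by blast
      obtain n2 where n2: "t - c < real n2" using reals_Archimedean2 by blast
      have "1 / real (Suc (max n1 n2)) \<le> 1 / real (Suc n1)" by (intro divide_left_mono) auto
      moreover have "real n2 \<le> real (Suc (Suc (max n1 n2)))" by simp
      ultimately have "t \<in> I (max n1 n2)" using n1 n2 by (simp only: I_def greaterThanLessThan_iff) linarith
      then show "t \<in> (\<Union>n. I n)" by blast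
    next
      fix t assume "t \<in> (\<Union>n. I n)"
      then obtain n where "c + 1 / real (Suc n) < t" by (auto simp: I_def)
      moreover have "1 / real (Suc n) > 0" by simp
      ultimately have "c < t" by linarith
      then show "t \<in> {x<..} \<inter> {0<..}" by (auto simp: c_def)
    qed
    have inc: "incseq I"
      unfolding I_def incseq_def
    proof (intro allI impI subsetI)
      fix m n :: nat and t assume mn: "m \<le> n" and t: "t \<in> {c + 1 / real (Suc m)<..<c + real (Suc (Suc m))}"
      have "1 / real (Suc n) \<le> 1 / real (Suc m)" using mn by (intro divide_left_mono) auto
      then show "t \<in> {c + 1 / real (Suc n)<..<c + real (Suc (Suc n))}" using mn t by auto
    qed
    have eqI: "emeasure N1 (I n) = emeasure N2 (I n)" for n
    proof -
      have sub: "I n \<inter> {0<..} = I n"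
      proof -
        have "1 / real (Suc n) > 0" "c \<ge> 0" by (auto simp: c_def)
        then have "t > 0" if "t \<in> I n" for t
          using that unfolding I_def greaterThanLessThan_iff by linarith
        then show ?thesis by auto
      qed
      have "1 / real (Suc n) \<le> 1" "1 < real (Suc (Suc n))" by simp_all
      then have "c + 1 / real (Suc n) < c + real (Suc (Suc n))" by linarith
      moreover have "0 < c + 1 / real (Suc n)" by (simp add: c_def add_nonneg_pos)
      ultimately show ?thesis
        using emeasure_interval N1[of "I n"] N2[of "I n"] unfolding sub by (simp add: I_def)
    qed
    have "emeasure N1 ({x<..} \<inter> {0<..}) = emeasure N2 ({x<..} \<inter> {0<..})"
    proof -
      have sets: "range I \<subseteq> sets N1" "range I \<subseteq> sets N2" by (auto simp: I_def N1_def N2_def)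
      show ?thesis
        using SUP_emeasure_incseq[OF sets(1) inc] SUP_emeasure_incseq[OF sets(2) inc] eqI by (simp add: U)
    qed
    then show "emeasure N1 {x<..} = emeasure N2 {x<..}"
      using N1[of "{x<..}"] N1[of "{x<..} \<inter> {0<..}"] N2[of "{x<..}"] N2[of "{x<..} \<inter> {0<..}"] by (simp add: Int_assoc)
  qed
  then show ?thesis using N1[OF A] N2[OF A] by simp
qed

lemma symmetric_density:
  assumes sym: "symmetric_measure M"
    and r: "\<And>x. x > 0 \<Longrightarrow> r x = Im (g (of_real x)) / pi" "\<And>x. x \<noteq> 0 \<Longrightarrow> r (- x) = r x"
  shows "has_density_off_zero M r"
  unfolding has_density_off_zero_def
proof (intro conjI allI impI ballI)
  show "0 \<le> r x" if "x \<noteq> 0" for x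
    using r(1)[of x] r(1)[of "- x"] r(2)[of x] g_nonneg[of x] g_nonneg[of "- x"] that
    by (cases "x > 0") auto
  fix A :: "real set" assume A: "A \<in> sets borel" "0 \<notin> A"
  let ?r = "\<lambda>x. ennreal (Im (g (of_real x)) / pi) * indicator {0<..} x"
  have pos: "emeasure M (B \<inter> {0<..}) = (\<integral>\<^sup>+x\<in>B \<inter> {0<..}. ennreal (r x) \<partial>lborel)" if "B \<in> sets borel" for B
    unfolding emeasure_positive_part[OF that] by (intro nn_integral_cong) (auto simp: indicator_def r(1))
  define B where "B = uminus -` A"
  have "(uminus :: real \<Rightarrow> real) \<in> borel_measurable borel" by measurable
  from measurable_sets[OF this A(1)] have B: "B \<in> sets borel" by (simp add: B_def)
  have rB: "(\<lambda>x. ennreal (r x) * indicator (B \<inter> {0<..}) x) \<in> borel_measurable borel"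
  proof -
    have "(\<lambda>x. ?r x * indicator B x) \<in> borel_measurable borel" using density_measurable B by simp
    also have "(\<lambda>x. ?r x * indicator B x) = (\<lambda>x. ennreal (r x) * indicator (B \<inter> {0<..}) x)"
      by (auto simp: fun_eq_iff indicator_def r(1))
    finally show ?thesis .
  qed
  have "emeasure M (A \<inter> {..<0}) = emeasure (distr M borel uminus) (A \<inter> {..<0})"
    using sym by (simp add: symmetric_measure_def)
  also have "\<dots> = emeasure M (uminus -` (A \<inter> {..<0}) \<inter> space M)"
    using A(1) by (intro emeasure_distr) auto
  also have "uminus -` (A \<inter> {..<0}) \<inter> space M = B \<inter> {0<..}" by (auto simp: B_def)
  also have "emeasure M (B \<inter> {0<..}) = (\<integral>\<^sup>+x\<in>B \<inter> {0<..}. ennreal (r x) \<partial>lborel)" by (rule pos[OF B])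
  also have "\<dots> = (\<integral>\<^sup>+x\<in>B \<inter> {0<..}. ennreal (r x) \<partial>distr lborel borel uminus)"
    by (simp add: lborel_distr_uminus)
  also have "\<dots> = (\<integral>\<^sup>+x. ennreal (r (- x)) * indicator (B \<inter> {0<..}) (- x) \<partial>lborel)"
    by (rule nn_integral_distr) (use rB in auto)
  also have "\<dots> = (\<integral>\<^sup>+x\<in>A \<inter> {..<0}. ennreal (r x) \<partial>lborel)"
    by (intro nn_integral_cong) (auto simp: indicator_def B_def r(2))
  finally have neg: "emeasure M (A \<inter> {..<0}) = (\<integral>\<^sup>+x\<in>A \<inter> {..<0}. ennreal (r x) \<partial>lborel)" .
  have rA: "(\<lambda>x. ennreal (r x) * indicator (A \<inter> {0<..}) x) \<in> borel_measurable borel"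
  proof -
    have "(\<lambda>x. ?r x * indicator A x) \<in> borel_measurable borel" using density_measurable A(1) by simp
    also have "(\<lambda>x. ?r x * indicator A x) = (\<lambda>x. ennreal (r x) * indicator (A \<inter> {0<..}) x)"
      by (auto simp: fun_eq_iff indicator_def r(1))
    finally show ?thesis .
  qed
  have rA': "(\<lambda>x. ennreal (r x) * indicator (A \<inter> {..<0}) x) \<in> borel_measurable borel"
  proof -
    have "(\<lambda>x. (\<lambda>x. ennreal (r x) * indicator (B \<inter> {0<..}) x) (- x)) \<in> borel_measurable borel"
      by (rule measurable_compose[OF _ rB]) simp
    also have "(\<lambda>x. (\<lambda>x. ennreal (r x) * indicator (B \<inter> {0<..}) x) (- x)) = (\<lambda>x. ennreal (r x) * indicator (A \<inter> {..<0}) x)"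
      by (auto simp: fun_eq_iff indicator_def B_def r(2))
    finally show ?thesis .
  qed
  have split: "A = (A \<inter> {0<..}) \<union> (A \<inter> {..<0})" using A(2) by (auto simp: neq_iff) (metis linorder_cases)
  have "emeasure M A = emeasure M (A \<inter> {0<..}) + emeasure M (A \<inter> {..<0})"
    by (subst split, rule plus_emeasure[symmetric]) (use A(1) in auto)
  also have "\<dots> = (\<integral>\<^sup>+x. ennreal (r x) * indicator (A \<inter> {0<..}) x + ennreal (r x) * indicator (A \<inter> {..<0}) x \<partial>lborel)"
    unfolding pos[OF A(1)] neg by (rule nn_integral_add[symmetric]) (use rA rA' in auto)
  also have "\<dots> = (\<integral>\<^sup>+x\<in>A. ennreal (r x) \<partial>lborel)"
    using A(2) by (intro nn_integral_cong) (auto simp: indicator_def neq_iff not_less order.order_iff_strict)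
  finally show "emeasure M A = (\<integral>\<^sup>+x\<in>A. ennreal (r x) \<partial>lborel)" .
qed

end

text \<open>The kernel \<open>- s / (t - s)\<close> is one at \<open>t = 0\<close>, tends to zero at every other \<open>t\<close> as \<open>s = i / n\<close> tends to zero,
  and is bounded by one.\<close>

lemma (in real_distribution) cauchy_stieltjes_atom:
  "(\<lambda>n. - (\<i> / of_real (real (Suc n))) * cauchy_stieltjes M (\<i> / of_real (real (Suc n)))) \<longlonglongrightarrow> of_real (measure M {0})"
proof -
  define s where "s n = \<i> / complex_of_real (real (Suc n))" for n
  have Im: "Im (s n) = 1 / real (Suc n)" "Re (s n) = 0" for n by (simp_all add: s_def Im_divide_of_real Re_divide_of_real)
  have norm_s: "norm (s n) = 1 / real (Suc n)" for n by (simp add: s_def norm_divide del: of_nat_Suc)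
  have Im_pos: "Im (s n) > 0" for n unfolding Im by simp
  have ne: "complex_of_real t - s n \<noteq> 0" for t n
  proof
    assume "complex_of_real t - s n = 0"
    then have "Im (complex_of_real t - s n) = 0" by simp
    then show False using Im_pos[of n] by simp
  qed
  have lim_s: "s \<longlonglongrightarrow> 0"
  proof (rule tendsto_norm_zero_cancel)
    show "(\<lambda>n. norm (s n)) \<longlonglongrightarrow> 0" unfolding norm_s using LIMSEQ_Suc[OF lim_1_over_n] by simp
  qed
  have "(\<lambda>n. \<integral>t. - s n * (1 / (complex_of_real t - s n)) \<partial>M) \<longlonglongrightarrow> (\<integral>t. complex_of_real (indicator {0} t) \<partial>M)"
  proof (rule integral_dominated_convergence[where w = "\<lambda>_. 1"])
    show "AE t in M. (\<lambda>n. - s n * (1 / (complex_of_real t - s n))) \<longlonglongrightarrow> complex_of_real (indicator {0} t)"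
    proof (intro AE_I2)
      fix t :: real
      show "(\<lambda>n. - s n * (1 / (complex_of_real t - s n))) \<longlonglongrightarrow> complex_of_real (indicator {0} t)"
      proof (cases "t = 0")
        case True
        then have "- s n * (1 / (complex_of_real t - s n)) = 1" for n using ne[of t n] by simp
        then show ?thesis using True by simp
      next
        case False
        have "(\<lambda>n. - s n * (1 / (complex_of_real t - s n))) \<longlonglongrightarrow> - 0 * (1 / (complex_of_real t - 0))"
          using False by (intro tendsto_intros lim_s) auto
        then show ?thesis using False by simp
      qed
    qed
    show "AE t in M. norm (- s n * (1 / (complex_of_real t - s n))) \<le> 1" for n
    proof (intro AE_I2)
      fix t
      have "norm (s n) \<le> norm (complex_of_real t - s n)"
        using norm_of_real_minus_ge_abs_Im[of "s n" t] unfolding norm_s Im(1) by simp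
      then show "norm (- s n * (1 / (complex_of_real t - s n))) \<le> 1"
        using ne[of t n] by (simp add: norm_mult norm_divide)
    qed
  qed auto
  moreover have "(\<integral>t. complex_of_real (indicator {0} t) \<partial>M) = of_real (measure M {0})"
    unfolding integral_complex_of_real by simp
  moreover have "(\<integral>t. - s n * (1 / (complex_of_real t - s n)) \<partial>M) = - s n * cauchy_stieltjes M (s n)" for n
    unfolding cauchy_stieltjes_def by (rule integral_mult_right_zero)
  ultimately show ?thesis by (simp only: s_def)
qed

section \<open>Local inversion of the Marchenko--Pastur equation\<close>

context mean_one_distribution
begin

text \<open>The inverse function of a solution of the Marchenko--Pastur equation.\<close>

definition MP_inverse :: "complex \<Rightarrow> complex" where
  "MP_inverse w = (resolvent_mean w - 1) / w\<^sup>2"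

lemma MP_inverse_eq: "MP_graph z w \<Longrightarrow> MP_inverse w = z"
  using MP_graphD(2)[of z w] by (simp add: MP_graph_def MP_inverse_def)

lemma MP_inverse_holomorphic: "MP_inverse holomorphic_on {w. Im w > 0}"
  unfolding MP_inverse_def
  by (intro holomorphic_intros holomorphic_on_subset[OF resolvent_mean_holomorphic]) auto

text \<open>The Hoelder estimate bounds the difference quotients of the inverse from below:
  \<open>\<bar>z\<^sub>1 - z\<^sub>2\<bar> / \<bar>w\<^sub>1 - w\<^sub>2\<bar> \<ge> c \<bar>w\<^sub>1 - cnj w\<^sub>2\<bar>\<^sup>2\<close>, which tends to \<open>4 c (Im w)\<^sup>2\<close> as both points tend
  to \<open>w\<close>.\<close>

lemma MP_inverse_deriv_nonzero:
  assumes g0: "MP_graph z0 w0" "Im z0 \<ge> 0"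
    and g: "\<And>n. MP_graph (z n) (v n)" "\<And>n. Im (z n) \<ge> 0" "\<And>n. z n \<noteq> z0" and lim: "v \<longlonglongrightarrow> w0"
  shows "deriv MP_inverse w0 \<noteq> 0"
proof -
  note w0 = MP_graphD[OF g0(1)]
  have "Bseq v" using lim by (intro convergent_imp_Bseq convergentI)
  then obtain K where K: "\<And>n. norm (v n) \<le> K" by (auto simp: Bseq_def)
  define R where "R = max 1 (max K (norm w0))"
  have R: "R \<ge> 1" "norm (v n) \<le> R" "norm w0 \<le> R" for n
    using K[of n] by (auto simp: R_def)
  note c = holder_const_pos[OF R(1)]
  have ne: "v n \<noteq> w0" for n
    using MP_inverse_eq[OF g(1)[of n]] MP_inverse_eq[OF g0(1)] g(3)[of n] by auto
  have quot: "holder_const R / (2 * R\<^sup>2) * (norm (v n - cnj w0))\<^sup>2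
      \<le> norm ((MP_inverse (v n) - MP_inverse w0) / (v n - w0))" for n
  proof -
    have "holder_const R * (norm (v n - cnj w0))\<^sup>2 * norm (v n - w0) \<le> 2 * R\<^sup>2 * norm (z n - z0)"
      by (rule MP_graph_holder[OF g(1) g0(1) g(2) g0(2) R])
    then have "holder_const R * (norm (v n - cnj w0))\<^sup>2 \<le> 2 * R\<^sup>2 * (norm (z n - z0) / norm (v n - w0))"
      using ne[of n] by (simp add: field_simps)
    then show ?thesis
      unfolding MP_inverse_eq[OF g(1)] MP_inverse_eq[OF g0(1)] norm_divide
      using R(1) by (simp add: field_simps)
  qed
  have "MP_inverse field_differentiable at w0"
    using MP_inverse_holomorphic w0(1)
    by (intro holomorphic_on_imp_differentiable_at[of _ "{w. Im w > 0}"]) (auto intro: open_halfspace_Im_gt)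
  then have "((\<lambda>w. (MP_inverse w - MP_inverse w0) / (w - w0)) \<longlongrightarrow> deriv MP_inverse w0) (at w0)"
    using field_differentiable_derivI has_field_derivative_iff by blast
  moreover have "filterlim v (at w0) sequentially" using lim ne by (simp add: filterlim_at)
  ultimately have "(\<lambda>n. (MP_inverse (v n) - MP_inverse w0) / (v n - w0)) \<longlonglongrightarrow> deriv MP_inverse w0"
    by (rule filterlim_compose)
  then have "(\<lambda>n. norm ((MP_inverse (v n) - MP_inverse w0) / (v n - w0))) \<longlonglongrightarrow> norm (deriv MP_inverse w0)"
    by (rule tendsto_norm)
  moreover have "(\<lambda>n. holder_const R / (2 * R\<^sup>2) * (norm (v n - cnj w0))\<^sup>2)
      \<longlonglongrightarrow> holder_const R / (2 * R\<^sup>2) * (norm (w0 - cnj w0))\<^sup>2"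
    by (intro tendsto_intros lim)
  ultimately have "holder_const R / (2 * R\<^sup>2) * (norm (w0 - cnj w0))\<^sup>2 \<le> norm (deriv MP_inverse w0)"
    using quot by (intro LIMSEQ_le) auto
  moreover have "w0 - cnj w0 \<noteq> 0" using w0(1) by (simp add: complex_eq_iff)
  then have "0 < holder_const R / (2 * R\<^sup>2) * (norm (w0 - cnj w0))\<^sup>2"
    using c R(1) by (intro mult_pos_pos divide_pos_pos) auto
  ultimately show ?thesis by auto
qed

text \<open>Since \<open>Im w D \<le> \<bar>1 + w D\<bar>\<close>, one has
  \<open>Im w D / \<bar>1 + w D\<bar>\<^sup>2 \<le> D\<^sup>-\<^sup>1 (D / \<bar>1 + w D\<bar>)\<close>, and the claim is the Cauchy--Schwarz
  inequality, here as the arithmetic--geometric mean inequality with an optimal weight \<open>c\<close>.\<close>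

lemma moment1_le_inv_sq_moment:
  assumes g: "MP_graph (of_real x) w" and x: "x > 0" and fin: "inv_sq_moment M \<noteq> \<infinity>"
  shows "Im w * moment 1 w \<le> sqrt x * sqrt (enn2real (inv_sq_moment M))"
proof -
  note w = MP_graphD[OF g]
  let ?n = "\<lambda>d. norm (1 + w * complex_of_real d)"
  have "AE d in M. inverse (ennreal d) ^ 2 \<noteq> \<infinity>"
    using fin by (intro nn_integral_PInf_AE) (auto simp: inv_sq_moment_def)
  then have AE_pos: "AE d in M. d > 0"
  proof eventually_elim
    case (elim d)
    show ?case
    proof (rule ccontr)
      assume "\<not> d > 0"
      then have "ennreal d = 0" by (simp add: ennreal_eq_0_iff)
      then show False using elim by (simp add: power2_eq_square)
    qed
  qed
  have inv: "inv_sq_moment M = (\<integral>\<^sup>+d. ennreal (1 / d\<^sup>2) \<partial>M)"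
    unfolding inv_sq_moment_def
  proof (rule nn_integral_cong_AE)
    show "AE d in M. inverse (ennreal d) ^ 2 = ennreal (1 / d\<^sup>2)"
      using AE_pos
    proof eventually_elim
      case (elim d)
      then have "inverse (ennreal d) ^ 2 = ennreal (inverse d) ^ 2" by (simp add: inverse_ennreal)
      also have "\<dots> = ennreal (1 / d\<^sup>2)" using elim by (simp add: ennreal_power power_divide field_simps)
      finally show ?case .
    qed
  qed
  have int: "integrable M (\<lambda>d. 1 / d\<^sup>2)"
    by (rule integrableI_nonneg) (use fin inv in \<open>auto simp: less_top[symmetric]\<close>)
  define i where "i = (\<integral>d. 1 / d\<^sup>2 \<partial>M)"
  have i: "enn2real (inv_sq_moment M) = i"
    unfolding inv i_def by (rule integral_eq_nn_integral[symmetric]) auto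
  have "i > 0" unfolding i_def by (rule integral_pos[OF int]) (use AE_pos in \<open>auto elim: eventually_mono\<close>)
  \<comment> \<open>the weight that balances the two terms of the arithmetic--geometric mean inequality\<close>
  define c where "c = sqrt x / sqrt i"
  have c: "c > 0" using x \<open>i > 0\<close> by (simp add: c_def)
  have int2: "integrable M (\<lambda>d. d ^ 2 / (?n d)\<^sup>2)" by (rule integrable_moment[OF w(1)]) simp
  have "Im w * moment 1 w = (\<integral>d. Im w * (d ^ 1 / (?n d)\<^sup>2) \<partial>M)"
    unfolding moment_def by (rule integral_mult_right_zero[symmetric])
  also have "\<dots> \<le> (\<integral>d. c / 2 * (1 / d\<^sup>2) + 1 / (2 * c) * (d ^ 2 / (?n d)\<^sup>2) \<partial>M)"
  proof (rule integral_mono_AE)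
    show "integrable M (\<lambda>d. Im w * (d ^ 1 / (?n d)\<^sup>2))"
      by (intro integrable_mult_right integrable_moment w) simp
    show "integrable M (\<lambda>d. c / 2 * (1 / d\<^sup>2) + 1 / (2 * c) * (d ^ 2 / (?n d)\<^sup>2))"
      by (intro Bochner_Integration.integrable_add integrable_mult_right int int2)
    show "AE d in M. Im w * (d ^ 1 / (?n d)\<^sup>2) \<le> c / 2 * (1 / d\<^sup>2) + 1 / (2 * c) * (d ^ 2 / (?n d)\<^sup>2)"
      using AE_pos
    proof eventually_elim
      case (elim d)
      have n: "?n d > 0" by (rule norm_one_plus_mult_ge(3)[OF w(1)])
      define p where "p = 1 / d"
      define q where "q = d / ?n d"
      have "Im w * d \<le> ?n d" using norm_one_plus_mult_ge(1)[OF w(1), of d] elim by simp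
      then have "Im w * d / (?n d)\<^sup>2 \<le> ?n d / (?n d)\<^sup>2" by (intro divide_right_mono) auto
      also have "\<dots> = p * q" using n elim by (simp add: p_def q_def power2_eq_square)
      also have "\<dots> \<le> c / 2 * p\<^sup>2 + 1 / (2 * c) * q\<^sup>2"
      proof -
        have "0 \<le> (c * p - q)\<^sup>2" by simp
        then have "2 * c * (p * q) \<le> c\<^sup>2 * p\<^sup>2 + q\<^sup>2"
          by (simp add: power2_eq_square algebra_simps)
        then have "2 * c * (p * q) / (2 * c) \<le> (c\<^sup>2 * p\<^sup>2 + q\<^sup>2) / (2 * c)"
          using c by (intro divide_right_mono) auto
        then show ?thesis using c by (simp add: add_divide_distrib power2_eq_square)
      qed
      finally show ?case by (simp add: p_def q_def power_divide)
    qed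
  qed
  also have "\<dots> = c / 2 * i + 1 / (2 * c) * moment 2 w"
  proof -
    have lin: "(\<integral>d. a * f d + b * g d \<partial>M) = a * (\<integral>d. f d \<partial>M) + b * (\<integral>d. g d \<partial>M)"
      if "integrable M f" "integrable M g" for f g and a b :: real
      using that by simp
    show ?thesis unfolding moment_def i_def by (rule lin[OF int int2])
  qed
  also have "moment 2 w = x" by (rule MP_graph_real(1)[OF g x])
  also have "c / 2 * i + 1 / (2 * c) * x = sqrt x * sqrt i"
  proof -
    have "c * i = sqrt x * sqrt i"
      using \<open>i > 0\<close> real_sqrt_mult_self[of i] by (simp add: c_def field_simps)
    moreover have "x / c = sqrt x * sqrt i"
      using x \<open>i > 0\<close> real_sqrt_mult_self[of x] by (simp add: c_def field_simps)
    moreover have "c / 2 * i + 1 / (2 * c) * x = (c * i + x / c) / 2" using c by (simp add: field_simps)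
    ultimately show ?thesis by simp
  qed
  finally show ?thesis unfolding i .
qed

end

section \<open>The density and its properties\<close>

context MP_pair
begin

definition boundary_value :: "real \<Rightarrow> complex" where
  "boundary_value x = h_ext (of_real (x\<^sup>2))"

lemma boundary_value_eq: "h_boundary M (x\<^sup>2) = boundary_value x"
  by (simp add: boundary_value_def h_boundary_eq)

lemma boundary_value_minus: "boundary_value (- x) = boundary_value x"
  by (simp add: boundary_value_def)

lemma continuous_on_boundary_value: "continuous_on (- {0}) boundary_value"
  unfolding boundary_value_def
  by (intro continuous_on_compose2[OF continuous_on_h_ext] continuous_intros) auto

lemma Im_boundary_value_nonneg: "x \<noteq> 0 \<Longrightarrow> Im (boundary_value x) \<ge> 0"
  unfolding boundary_value_def by (rule Im_h_ext_nonneg) auto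

lemma boundary_value_MP_graph:
  "x \<noteq> 0 \<Longrightarrow> Im (boundary_value x) > 0 \<Longrightarrow> N.MP_graph (of_real (x\<^sup>2)) (boundary_value x)"
  unfolding boundary_value_def by (rule MP_graph_h_ext) auto

text \<open>The density of the free convolution: \<open>- Im (x h(x\<^sup>2)\<^sup>2) / \<pi>\<close> for \<open>x > 0\<close>.\<close>

definition rho :: "real \<Rightarrow> real" where
  "rho x = - 2 * Re (boundary_value x) * (\<bar>x\<bar> * (Im (boundary_value x) / pi))"

lemma rho_minus: "rho (- x) = rho x"
  by (simp add: rho_def boundary_value_minus)

lemma continuous_on_rho: "continuous_on (- {0}) rho"
  unfolding rho_def by (intro continuous_intros continuous_on_boundary_value) auto

text \<open>Where the boundary value is not real, its real part is negative, since the first moment is positive.\<close>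

lemma rho_pos_iff:
  assumes "x \<noteq> 0"
  shows "rho x > 0 \<longleftrightarrow> Im (boundary_value x) > 0"
proof (cases "Im (boundary_value x) > 0")
  case True
  have "Re (boundary_value x) < 0"
    using N.MP_graph_real(3)[OF boundary_value_MP_graph[OF assms True]] assms by simp
  then have "0 < - 2 * Re (boundary_value x)" by simp
  moreover have "0 < \<bar>x\<bar> * (Im (boundary_value x) / pi)" using True assms by simp
  ultimately have "0 < - 2 * Re (boundary_value x) * (\<bar>x\<bar> * (Im (boundary_value x) / pi))"
    by (rule mult_pos_pos)
  then show ?thesis using True by (simp add: rho_def)
next
  case False
  then have "Im (boundary_value x) = 0" using Im_boundary_value_nonneg[OF assms] by simp
  then show ?thesis by (simp add: rho_def)
qed

lemma rho_nonneg: "x \<noteq> 0 \<Longrightarrow> rho x \<ge> 0"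
proof (cases "Im (boundary_value x) > 0")
  case False
  assume "x \<noteq> 0"
  then have "Im (boundary_value x) = 0" using Im_boundary_value_nonneg[of x] False by simp
  then show ?thesis by (simp add: rho_def)
qed (use rho_pos_iff in \<open>auto simp: less_imp_le\<close>)

definition free_conv_ext :: "complex \<Rightarrow> complex" where
  "free_conv_ext s = - (1 / s + s * (h_ext (s\<^sup>2))\<^sup>2)"

lemma Im_free_conv_ext:
  assumes "x > 0"
  shows "Im (free_conv_ext (of_real x)) / pi = rho x"
proof -
  have "free_conv_ext (of_real x) = - (of_real (1 / x) + of_real x * (boundary_value x)\<^sup>2)"
    by (simp add: free_conv_ext_def boundary_value_def)
  then have "Im (free_conv_ext (of_real x)) = - (x * (2 * Re (boundary_value x) * Im (boundary_value x)))"
    by (simp add: power2_eq_square del: of_real_divide)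
  then show ?thesis using assms by (simp add: rho_def)
qed

lemma square_closed_quadrant: "Re s > 0 \<Longrightarrow> Im s \<ge> 0 \<Longrightarrow> Im (s\<^sup>2) \<ge> 0 \<and> s\<^sup>2 \<noteq> 0"
  by (auto simp: power2_eq_square)

text \<open>For \<open>Re s > 0\<close> the square \<open>s\<^sup>2\<close> stays in the upper half plane as \<open>s\<close> approaches the real axis from above, so
  the formula for the transform of the convolution extends continuously.\<close>

lemma rho_density:
  assumes conv: "is_free_mult_conv \<nu> semicircle \<mu>"
  shows "has_density_off_zero \<mu> rho"
proof -
  note conv' = conv[unfolded is_free_mult_conv_def]
  interpret \<mu>: real_distribution \<mu> using conv' by auto
  interpret stieltjes_boundary \<mu> free_conv_ext
  proof unfold_locales
    show "continuous_on {z. 0 < Re z \<and> 0 \<le> Im z} free_conv_ext"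
      unfolding free_conv_ext_def
      by (intro continuous_intros continuous_on_compose2[OF continuous_on_h_ext])
         (use square_closed_quadrant in auto)
    show "free_conv_ext z = cauchy_stieltjes \<mu> z" if "0 < Re z" "0 < Im z" for z
    proof -
      have "Im (z\<^sup>2) > 0" using that by (simp add: power2_eq_square)
      then show ?thesis
        using cauchy_stieltjes_free_conv[OF conv that(2)] by (simp add: free_conv_ext_def h_ext_eq)
    qed
    show "0 \<le> Im (free_conv_ext (of_real x))" if "x > 0" for x
      using Im_free_conv_ext[OF that] rho_nonneg[of x] that
      by (metis less_irrefl pi_gt_zero zero_le_divide_iff not_le)
  qed
  show ?thesis
    by (rule symmetric_density) (use conv' Im_free_conv_ext rho_minus in auto)
qed

subsection \<open>Real analyticity\<close>

text \<open>Where the boundary value lies in the open upper half plane it is given by the local inverse of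
  the Marchenko--Pastur equation, so \<open>x h(x\<^sup>2)\<^sup>2\<close> extends to a holomorphic function.\<close>

lemma rho_real_analytic_pos:
  assumes x: "x > 0" and pos: "rho x > 0"
  shows "real_analytic_at rho x"
proof -
  define w0 where "w0 = boundary_value x"
  have w0: "Im w0 > 0" using rho_pos_iff[of x] x pos by (simp add: w0_def)
  have g0: "N.MP_graph (of_real (x\<^sup>2)) w0"
    unfolding w0_def by (rule boundary_value_MP_graph) (use x w0 in \<open>auto simp: w0_def\<close>)
  define z where "z n = of_real (x\<^sup>2) + \<i> * of_real (1 / real (Suc n))" for n
  have Im_z: "Im (z n) > 0" for n by (simp add: z_def)
  have lim_z: "z \<longlonglongrightarrow> of_real (x\<^sup>2)"
  proof -
    have "(\<lambda>n. 1 / real (Suc n)) \<longlonglongrightarrow> 0" using LIMSEQ_Suc[OF lim_1_over_n] by simp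
    then have "z \<longlonglongrightarrow> of_real (x\<^sup>2) + \<i> * of_real 0" unfolding z_def by (intro tendsto_intros)
    then show ?thesis by simp
  qed
  have z_ne: "z n \<noteq> of_real (x\<^sup>2)" for n using Im_z[of n] by (metis Im_complex_of_real less_irrefl)
  have "filterlim z (at (of_real (x\<^sup>2)) within upper_half_plane) sequentially"
    using lim_z z_ne Im_z by (auto simp: filterlim_at upper_half_plane_def)
  then have lim_h: "(\<lambda>n. h (z n)) \<longlonglongrightarrow> w0"
    unfolding w0_def boundary_value_def using x by (intro filterlim_compose[OF h_ext_tendsto]) auto
  have "deriv N.MP_inverse w0 \<noteq> 0"
    by (rule N.MP_inverse_deriv_nonzero[OF g0 _ MP_graph_h _ _ lim_h])
       (use Im_z z_ne in \<open>auto simp: less_imp_le\<close>)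
  then obtain r where r: "r > 0" "ball w0 r \<subseteq> {w. Im w > 0}" "open (N.MP_inverse ` ball w0 r)"
      "inj_on N.MP_inverse (ball w0 r)"
    using has_complex_derivative_locally_invertible[OF N.MP_inverse_holomorphic, of w0] w0 open_halfspace_Im_gt
    by blast
  obtain k where k: "k holomorphic_on (N.MP_inverse ` ball w0 r)"
      "\<And>w. w \<in> ball w0 r \<Longrightarrow> k (N.MP_inverse w) = w"
    using holomorphic_has_inverse[OF holomorphic_on_subset[OF N.MP_inverse_holomorphic r(2)] open_ball r(4)]
    by metis
  have "isCont boundary_value x"
    using continuous_on_boundary_value x by (simp add: continuous_on_eq_continuous_at open_Compl)
  then obtain e1 where e1: "e1 > 0" "\<And>y. dist y x < e1 \<Longrightarrow> dist (boundary_value y) w0 < r"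
    unfolding w0_def continuous_at_eps_delta using r(1) by blast
  define V where "V = (\<lambda>s. s\<^sup>2) -` (N.MP_inverse ` ball w0 r)"
  have "open V" unfolding V_def by (intro open_vimage r(3) continuous_intros)
  moreover have "of_real x \<in> V"
    using r(1) N.MP_inverse_eq[OF g0] by (auto simp: V_def intro!: image_eqI[of _ _ w0])
  ultimately obtain e2 where e2: "e2 > 0" "ball (of_real x) e2 \<subseteq> V"
    using open_contains_ball by blast
  define \<Psi> where "\<Psi> s = s * (k (s\<^sup>2))\<^sup>2" for s
  have hol: "\<Psi> holomorphic_on ball (of_real x) e2"
    unfolding \<Psi>_def
    by (intro holomorphic_intros holomorphic_on_compose_gen[OF _ k(1), of "\<lambda>s. s\<^sup>2", unfolded o_def])
       (use e2 in \<open>auto intro!: holomorphic_intros simp: V_def\<close>)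
  define c where "c n = (deriv ^^ n) \<Psi> (of_real x) / fact n" for n
  define e where "e = min x (min e1 e2)"
  have "(\<lambda>n. - Im (c n) / pi * (y - x) ^ n) sums rho y" if y: "\<bar>y - x\<bar> < e" for y
  proof -
    have y0: "y > 0" using y by (auto simp: e_def)
    have "dist (boundary_value y) w0 < r" using y by (intro e1) (simp add: e_def dist_real_def)
    then have b: "boundary_value y \<in> ball w0 r" by (simp add: dist_commute)
    then have "N.MP_graph (of_real (y\<^sup>2)) (boundary_value y)"
      using r(2) y0 by (intro boundary_value_MP_graph) auto
    then have kb: "k (of_real (y\<^sup>2)) = boundary_value y"
      using k(2)[OF b] N.MP_inverse_eq by simp
    have "complex_of_real y - of_real x = of_real (y - x)" by simp
    then have "norm (complex_of_real y - of_real x) < e2" using y by (simp only: norm_of_real) (simp add: e_def)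
    then have "of_real y \<in> ball (complex_of_real x) e2"
      by (simp add: dist_norm norm_minus_commute)
    then have "(\<lambda>n. c n * (of_real y - of_real x) ^ n) sums \<Psi> (of_real y)"
      unfolding c_def by (rule holomorphic_power_series[OF hol])
    from sums_Im[OF this]
    have "(\<lambda>n. Im (c n * (of_real y - of_real x) ^ n)) sums Im (\<Psi> (of_real y))" .
    moreover have "Im (c n * (of_real y - of_real x) ^ n) = Im (c n) * (y - x) ^ n" for n
    proof -
      have "c n * (of_real y - of_real x) ^ n = c n * of_real ((y - x) ^ n)" by simp
      then show ?thesis by (simp only: times_complex.sel Re_complex_of_real Im_complex_of_real mult_zero_right add_0)
    qed
    ultimately have "(\<lambda>n. Im (c n) * (y - x) ^ n) sums Im (\<Psi> (of_real y))" by simp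
    from sums_mult[OF this, of "- 1 / pi"]
    have "(\<lambda>n. - Im (c n) / pi * (y - x) ^ n) sums (- 1 / pi * Im (\<Psi> (of_real y)))" by simp
    moreover have "- 1 / pi * Im (\<Psi> (of_real y)) = rho y"
    proof -
      have "\<Psi> (of_real y) = of_real y * (boundary_value y)\<^sup>2" using kb by (simp add: \<Psi>_def)
      then have "Im (\<Psi> (of_real y)) = y * (2 * Re (boundary_value y) * Im (boundary_value y))"
        by (simp add: power2_eq_square)
      then show ?thesis using y0 by (simp add: rho_def)
    qed
    ultimately show ?thesis by simp
  qed
  moreover have "e > 0" using x e1 e2 by (simp add: e_def)
  ultimately show ?thesis
    unfolding real_analytic_at_def by (intro exI[of _ "\<lambda>n. - Im (c n) / pi"] exI[of _ e]) auto
qed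

lemma rho_real_analytic:
  assumes x: "x \<noteq> 0" and pos: "rho x > 0"
  shows "real_analytic_at rho x"
proof (cases "x > 0")
  case False
  then have "- x > 0" "rho (- x) > 0" using x pos by (auto simp: rho_minus)
  from rho_real_analytic_pos[OF this] obtain a r where r: "r > 0"
    "\<And>y. \<bar>y - - x\<bar> < r \<Longrightarrow> (\<lambda>n. a n * (y - - x) ^ n) sums rho y"
    unfolding real_analytic_at_def by blast
  have "(\<lambda>n. a n * (- 1) ^ n * (y - x) ^ n) sums rho y" if "\<bar>y - x\<bar> < r" for y
  proof -
    have "(\<lambda>n. a n * (- y - - x) ^ n) sums rho (- y)" using that by (intro r(2)) auto
    moreover have "(- y - - x) ^ n = (- 1) ^ n * (y - x) ^ n" for n
      by (simp flip: power_mult_distrib)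
    ultimately show ?thesis by (simp add: rho_minus mult.assoc)
  qed
  then show ?thesis
    using r(1) unfolding real_analytic_at_def by (intro exI[of _ "\<lambda>n. a n * (- 1) ^ n"] exI[of _ r]) auto
qed (use rho_real_analytic_pos pos in auto)

subsection \<open>Bounds\<close>

lemma boundary_value_norm_bounds:
  assumes x: "x \<noteq> 0" and Im: "Im (boundary_value x) > 0"
  shows "\<bar>x\<bar> * norm (boundary_value x) \<le> 1" "\<bar>x\<bar>\<^sup>2 * norm (boundary_value x) \<le> 2"
proof -
  note g = boundary_value_MP_graph[OF x Im]
  have "(\<bar>x\<bar> * norm (boundary_value x))\<^sup>2 \<le> 1\<^sup>2"
    using N.MP_graph_real(4)[OF g] x by (simp add: power_mult_distrib)
  then show "\<bar>x\<bar> * norm (boundary_value x) \<le> 1" by (rule power2_le_imp_le) simp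
  show "\<bar>x\<bar>\<^sup>2 * norm (boundary_value x) \<le> 2"
    using N.MP_graph_norm_le[OF g] by (simp add: norm_mult norm_power)
qed

lemma rho_tilde_bound:
  assumes x: "x \<noteq> 0"
  shows "\<bar>x\<bar> * Im (boundary_value x) \<le> min 1 (2 / \<bar>x\<bar>)"
proof (cases "Im (boundary_value x) > 0")
  case True
  have le: "\<bar>x\<bar> * Im (boundary_value x) \<le> \<bar>x\<bar> * norm (boundary_value x)"
    using abs_Im_le_cmod[of "boundary_value x"] by (intro mult_left_mono) auto
  have "\<bar>x\<bar> * norm (boundary_value x) \<le> 2 / \<bar>x\<bar>"
    using boundary_value_norm_bounds(2)[OF x True] x by (simp add: field_simps power2_eq_square)
  then show ?thesis using le boundary_value_norm_bounds(1)[OF x True] by auto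
next
  case False
  then have "Im (boundary_value x) = 0" using Im_boundary_value_nonneg[OF x] by simp
  then show ?thesis by simp
qed

lemma rho_le_cube:
  assumes x: "x \<noteq> 0"
  shows "pi * rho x \<le> 4 / \<bar>x\<bar> ^ 3"
proof (cases "Im (boundary_value x) > 0")
  case True
  let ?w = "boundary_value x"
  have "0 \<le> (Re ?w + Im ?w)\<^sup>2" by simp
  then have "- 2 * Re ?w * Im ?w \<le> (norm ?w)\<^sup>2"
    unfolding cmod_power2 by (simp add: power2_eq_square algebra_simps)
  then have "pi * rho x \<le> \<bar>x\<bar> * (norm ?w)\<^sup>2"
    using mult_left_mono[of "- 2 * Re ?w * Im ?w" "(norm ?w)\<^sup>2" "\<bar>x\<bar>"] by (simp add: rho_def mult_ac)
  also have "\<dots> = (\<bar>x\<bar>\<^sup>2 * norm ?w)\<^sup>2 / \<bar>x\<bar> ^ 3"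
    using x by (simp add: field_simps power2_eq_square power3_eq_cube)
  also have "\<dots> \<le> 2\<^sup>2 / \<bar>x\<bar> ^ 3"
    using boundary_value_norm_bounds(2)[OF x True] by (intro divide_right_mono power_mono) auto
  finally show ?thesis by simp
next
  case False
  then have "rho x = 0" using rho_nonneg[OF x] rho_pos_iff[OF x] by auto
  then show ?thesis by simp
qed

text \<open>Since the first moment is \<open>- 2 x\<^sup>2 Re h\<close>, the density is \<open>Im h E [D / \<bar>1 + h D\<bar>\<^sup>2] / (\<pi> \<bar>x\<bar>)\<close>.\<close>

lemma rho_le_inv_sq_moment:
  assumes x: "x \<noteq> 0"
  shows "ennreal (pi * rho x) \<le> ennreal_sqrt (inv_sq_moment \<nu>)"
proof (cases "Im (boundary_value x) > 0 \<and> inv_sq_moment \<nu> \<noteq> \<infinity>")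
  case True
  let ?w = "boundary_value x"
  note g = boundary_value_MP_graph[OF x conjunct1[OF True]]
  have x2: "x\<^sup>2 > 0" using x by simp
  have "pi * rho x = \<bar>x\<bar> * (Im ?w * N.moment 1 ?w / x\<^sup>2)"
    using N.MP_graph_real(2)[OF g x2] x by (simp add: rho_def field_simps)
  also have "\<dots> = Im ?w * N.moment 1 ?w / \<bar>x\<bar>"
    using x by (cases "x > 0") (auto simp: field_simps power2_eq_square)
  also have "\<dots> \<le> sqrt (x\<^sup>2) * sqrt (enn2real (inv_sq_moment \<nu>)) / \<bar>x\<bar>"
    using True by (intro divide_right_mono N.moment1_le_inv_sq_moment[OF g x2]) auto
  also have "\<dots> = sqrt (enn2real (inv_sq_moment \<nu>))" using x by simp
  finally show ?thesis using True by (simp add: ennreal_sqrt_def ennreal_leI)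
next
  case False
  then consider "rho x = 0" | "inv_sq_moment \<nu> = \<infinity>"
    using rho_nonneg[OF x] rho_pos_iff[OF x] by fastforce
  then show ?thesis by cases (auto simp: ennreal_sqrt_def)
qed

subsection \<open>The atom at zero\<close>

text \<open>Along \<open>s = i y\<close> one has \<open>- s G(s) = E [1 / (1 + h(- y\<^sup>2) D)]\<close>. As \<open>y \<rightarrow> 0\<close> the number \<open>h(- y\<^sup>2)\<close> tends to
  infinity: if it were below \<open>K\<close> then \<open>y\<^sup>2 K \<ge> y\<^sup>2 h(- y\<^sup>2) = E [D / (1 + h(- y\<^sup>2) D)] \<ge> E [D / (1 + K D)]\<close>.\<close>

lemma atom_free_conv:
  assumes conv: "is_free_mult_conv \<nu> semicircle \<mu>"
  shows "measure \<mu> {0} = measure \<nu> {0}"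
proof -
  note conv' = conv[unfolded is_free_mult_conv_def]
  interpret \<mu>: real_distribution \<mu> using conv' by auto
  define a where "a n = (1 / real (Suc n))\<^sup>2" for n
  define H where "H n = (\<integral>t. 1 / (t + a n) \<partial>M)" for n
  have a: "a n > 0" for n by (simp add: a_def)
  have h: "h (of_real (- a n)) = of_real (H n)" for n
    unfolding H_def by (rule L.cauchy_stieltjes_negative_real[OF a])
  have H: "H n > 0" for n unfolding H_def by (rule L.integral_inverse_shift_pos[OF a])
  have bounded1: "integrable \<nu> (\<lambda>d. 1 / (1 + K * d))" if "K > 0" for K
  proof (rule N.integrable_boundedI[where B = 1])
    show "AE d in \<nu>. norm (1 / (1 + K * d)) \<le> 1"
      using N.AE_nonneg by eventually_elim (use that in \<open>simp add: divide_le_eq_1 add_pos_nonneg\<close>)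
  qed measurable
  have bounded2: "integrable \<nu> (\<lambda>d. d / (1 + K * d))" if "K > 0" for K
  proof (rule N.integrable_boundedI[where B = "1 / K"])
    show "AE d in \<nu>. norm (d / (1 + K * d)) \<le> 1 / K"
      using N.AE_nonneg
    proof eventually_elim
      case (elim d)
      have "1 + K * d > 0" using elim that by (simp add: add_pos_nonneg)
      then show ?case using elim that by (simp add: field_simps)
    qed
  qed measurable
  have res: "N.resolvent_mean (of_real K) = of_real (\<integral>d. 1 / (1 + K * d) \<partial>\<nu>)" for K
  proof -
    have "N.resolvent_mean (of_real K) = (\<integral>d. complex_of_real (1 / (1 + K * d)) \<partial>\<nu>)"
      unfolding N.resolvent_mean_def by simp
    then show ?thesis by (simp only: integral_complex_of_real)
  qed
  have eq1: "(\<integral>d. 1 / (1 + H n * d) \<partial>\<nu>) = 1 - a n * (H n)\<^sup>2" for n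
  proof -
    have "complex_of_real (\<integral>d. 1 / (1 + H n * d) \<partial>\<nu>) = of_real (1 - a n * (H n)\<^sup>2)"
      using resolvent_mean_h_negative[OF a[of n], unfolded h] res[of "H n"] by simp
    then show ?thesis by (simp only: of_real_eq_iff)
  qed
  have eq2: "(\<integral>d. d / (1 + H n * d) \<partial>\<nu>) = a n * H n" for n
  proof -
    have A: "(\<integral>d. 1 - H n * (d / (1 + H n * d)) \<partial>\<nu>) = (\<integral>d. 1 / (1 + H n * d) \<partial>\<nu>)"
    proof (rule integral_cong_AE)
      show "AE d in \<nu>. 1 - H n * (d / (1 + H n * d)) = 1 / (1 + H n * d)"
        using N.AE_nonneg
      proof eventually_elim
        case (elim d)
        have "1 + H n * d > 0" using elim H[of n] by (simp add: add_pos_nonneg)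
        then show ?case by (simp add: field_simps)
      qed
    qed measurable
    have B: "(\<integral>d. 1 - H n * (d / (1 + H n * d)) \<partial>\<nu>) = 1 - H n * (\<integral>d. d / (1 + H n * d) \<partial>\<nu>)"
    proof -
      have lin: "(\<integral>d. 1 - c * f d \<partial>\<nu>) = 1 - c * (\<integral>d. f d \<partial>\<nu>)" if "integrable \<nu> f" for f and c :: real
        using that by simp
      show ?thesis by (rule lin[OF bounded2[OF H]])
    qed
    have "1 - H n * (\<integral>d. d / (1 + H n * d) \<partial>\<nu>) = 1 - a n * (H n)\<^sup>2"
      by (rule trans[OF B[symmetric] trans[OF A eq1]])
    then have "H n * (\<integral>d. d / (1 + H n * d) \<partial>\<nu>) = H n * (a n * H n)"
      by (simp add: power2_eq_square mult_ac)
    then show ?thesis using H[of n] by simp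
  qed
  have lim_a: "a \<longlonglongrightarrow> 0"
  proof -
    have "(\<lambda>n. 1 / real (Suc n)) \<longlonglongrightarrow> 0" using LIMSEQ_Suc[OF lim_1_over_n] by simp
    then have "a \<longlonglongrightarrow> 0\<^sup>2" unfolding a_def by (intro tendsto_intros)
    then show ?thesis by simp
  qed
  have lim_H: "filterlim H at_top sequentially"
    unfolding filterlim_at_top
  proof
    fix Z :: real
    define K where "K = max 1 Z"
    have K: "K > 0" by (simp add: K_def)
    define c where "c = (\<integral>d. d / (1 + K * d) \<partial>\<nu>)"
    have "c > 0" unfolding c_def
      by (rule N.integral_pos_of_pos[OF bounded2[OF K]]) (use K in \<open>auto intro!: divide_pos_pos add_pos_pos\<close>)
    then have "eventually (\<lambda>n. a n < c / K) sequentially" using K by (intro order_tendstoD[OF lim_a]) auto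
    then show "\<forall>\<^sub>F n in sequentially. Z \<le> H n"
    proof eventually_elim
      case (elim n)
      show ?case
      proof (rule ccontr)
        assume "\<not> Z \<le> H n"
        then have HK: "H n \<le> K" by (simp add: K_def)
        have "c \<le> (\<integral>d. d / (1 + H n * d) \<partial>\<nu>)"
          unfolding c_def
        proof (rule integral_mono_AE[OF bounded2[OF K] bounded2[OF H]])
          show "AE d in \<nu>. d / (1 + K * d) \<le> d / (1 + H n * d)"
            using N.AE_nonneg
          proof eventually_elim
            case (elim d)
            have "1 + H n * d \<le> 1 + K * d" using HK elim by (simp add: mult_right_mono)
            moreover have "1 + H n * d > 0" using elim H[of n] by (simp add: add_pos_nonneg)
            ultimately show ?case using elim by (intro divide_left_mono) auto
          qed
        qed
        also have "\<dots> \<le> a n * K" unfolding eq2 using HK a[of n] by (intro mult_left_mono) auto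
        also have "\<dots> < c" using elim K by (simp add: field_simps)
        finally show False by simp
      qed
    qed
  qed
  have "(\<lambda>n. \<integral>d. 1 / (1 + H n * d) \<partial>\<nu>) \<longlonglongrightarrow> (\<integral>d. indicator {0} d \<partial>\<nu>)"
  proof (rule integral_dominated_convergence[where w = "\<lambda>_. 1"])
    show "AE d in \<nu>. (\<lambda>n. 1 / (1 + H n * d)) \<longlonglongrightarrow> indicator {0} d"
      using N.AE_nonneg
    proof eventually_elim
      case (elim d)
      show ?case
      proof (cases "d = 0")
        case False
        then have "d > 0" using elim by simp
        then have "filterlim (\<lambda>n. 1 + H n * d) at_top sequentially"
          by (intro filterlim_tendsto_add_at_top[OF tendsto_const] filterlim_at_top_mult_tendsto_pos[OF tendsto_const _ lim_H])
        then have "(\<lambda>n. 1 / (1 + H n * d)) \<longlonglongrightarrow> 0"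
          by (rule real_tendsto_divide_at_top[OF tendsto_const])
        then show ?thesis using False by simp
      qed simp
    qed
    show "AE d in \<nu>. norm (1 / (1 + H n * d)) \<le> 1" for n
      using N.AE_nonneg by eventually_elim (use H[of n] in \<open>simp add: divide_le_eq_1 add_pos_nonneg\<close>)
  qed auto
  then have lim1: "(\<lambda>n. complex_of_real (\<integral>d. 1 / (1 + H n * d) \<partial>\<nu>)) \<longlonglongrightarrow> of_real (measure \<nu> {0})"
    by (intro tendsto_of_real) simp
  have "- (\<i> / of_real (real (Suc n))) * cauchy_stieltjes \<mu> (\<i> / of_real (real (Suc n)))
      = of_real (\<integral>d. 1 / (1 + H n * d) \<partial>\<nu>)" for n
  proof -
    define s where "s = \<i> / complex_of_real (real (Suc n))"
    have s: "Im s > 0" "s \<noteq> 0" by (simp_all add: s_def Im_divide_of_real del: of_nat_Suc)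
    have s2: "s\<^sup>2 = of_real (- a n)" by (simp add: s_def a_def power_divide)
    have "- s * cauchy_stieltjes \<mu> s = 1 + s\<^sup>2 * (h (s\<^sup>2))\<^sup>2"
      unfolding cauchy_stieltjes_free_conv[OF conv s(1)] using s(2) by (simp add: power2_eq_square algebra_simps)
    also have "\<dots> = of_real (1 - a n * (H n)\<^sup>2)" unfolding s2 h by simp
    finally show ?thesis unfolding eq1 s_def .
  qed
  then have "(\<lambda>n. complex_of_real (\<integral>d. 1 / (1 + H n * d) \<partial>\<nu>)) \<longlonglongrightarrow> of_real (measure \<mu> {0})"
    using \<mu>.cauchy_stieltjes_atom by simp
  from LIMSEQ_unique[OF this lim1] show ?thesis by (simp only: of_real_eq_iff)
qed

end

theorem proposition1p8:
  fixes \<nu>D \<mu> \<mu>MP :: "real measure" and \<rho> :: "real \<Rightarrow> real"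
  assumes "real_distribution \<nu>D"
    and "supported_nonneg \<nu>D"
    and "has_bochner_integral \<nu>D (\<lambda>d. d) 1"
    and "is_free_mult_conv \<nu>D semicircle \<mu>"
    and "is_MP_limit \<nu>D \<mu>MP"
    and "\<rho> = (\<lambda>x. - 2 * Re (h_boundary \<mu>MP (x\<^sup>2)) * rho_tilde \<mu>MP x)"
  shows
    \<comment> \<open>part 1\<close>
    "(has_density_off_zero \<mu> \<rho> \<and>
      continuous_on (- {0}) \<rho> \<and>
      (\<forall>x. x \<noteq> 0 \<longrightarrow> \<rho> (- x) = \<rho> x) \<and>
      (\<forall>x. x \<noteq> 0 \<longrightarrow> \<rho> x > 0 \<longrightarrow> real_analytic_at \<rho> x)) \<and>
    \<comment> \<open>part 2\<close>
     (\<forall>x. x \<noteq> 0 \<longrightarrow>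
        (\<rho> x > 0 \<longleftrightarrow> rho_tilde \<mu>MP x > 0) \<and>
        (rho_tilde \<mu>MP x > 0 \<longleftrightarrow> rho_MP \<mu>MP (x\<^sup>2) > 0)) \<and>
    \<comment> \<open>part 3\<close>
     (\<forall>x. x \<noteq> 0 \<longrightarrow>
        pi * rho_tilde \<mu>MP x \<le> min 1 (2 / \<bar>x\<bar>) \<and>
        ennreal (pi * \<rho> x)
          \<le> min (ennreal_sqrt (inv_sq_moment \<nu>D)) (ennreal (4 / \<bar>x\<bar> ^ 3))) \<and>
    \<comment> \<open>part 4\<close>
     (measure \<nu>D {0} = 0 \<longrightarrow>
        absolutely_continuous lborel \<mu> \<and> measure \<mu> {0} = 0)"
proof -
  note conv = assms(4)
  interpret N: real_distribution \<nu>D by fact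
  interpret L: real_distribution \<mu>MP using assms(5) by (simp add: is_MP_limit_def)
  interpret MP_pair \<nu>D \<mu>MP
    by unfold_locales (use assms in \<open>auto simp: is_MP_limit_def\<close>)
  interpret \<mu>: real_distribution \<mu> using conv by (simp add: is_free_mult_conv_def)
  have \<rho>: "\<rho> = rho"
    by (simp add: assms(6) rho_def rho_tilde_def rho_MP_def boundary_value_eq fun_eq_iff)
  have tilde: "rho_tilde \<mu>MP x = \<bar>x\<bar> * Im (boundary_value x) / pi"
    "rho_MP \<mu>MP (x\<^sup>2) = Im (boundary_value x) / pi" for x
    by (simp_all add: rho_tilde_def rho_MP_def boundary_value_eq)
  note dens = rho_density[OF conv]
  have part4: "absolutely_continuous lborel \<mu> \<and> measure \<mu> {0} = 0" if "measure \<nu>D {0} = 0"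
  proof
    show atom: "measure \<mu> {0} = 0" using atom_free_conv[OF conv] that by simp
    show "absolutely_continuous lborel \<mu>"
      unfolding absolutely_continuous_def
    proof
      fix A assume A: "A \<in> null_sets (lborel :: real measure)"
      then have "A \<in> sets borel" by (simp add: null_sets_def)
      then have A': "A - {0} \<in> sets borel" "A \<in> sets borel" by (auto intro: sets.Diff)
      have "A - {0} \<in> null_sets lborel" using A by (rule null_sets_subset) (use A'(1) in auto)
      then have "(\<integral>\<^sup>+x\<in>A - {0}. ennreal (rho x) \<partial>lborel) = 0" by (rule nn_integral_null_set)
      then have 0: "emeasure \<mu> (A - {0}) = 0"
        using dens A'(1) by (auto simp: has_density_off_zero_def)
      have "emeasure \<mu> A \<le> emeasure \<mu> ((A - {0}) \<union> {0})" using A' by (intro emeasure_mono) auto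
      also have "\<dots> \<le> emeasure \<mu> (A - {0}) + emeasure \<mu> {0}" using A' by (intro emeasure_subadditive) auto
      also have "\<dots> = 0" using 0 atom by (simp add: \<mu>.emeasure_eq_measure)
      finally show "A \<in> null_sets \<mu>" using A' by (auto simp: null_sets_def)
    qed
  qed
  show ?thesis
    unfolding \<rho>
    using dens continuous_on_rho rho_minus rho_real_analytic rho_pos_iff rho_tilde_bound
      rho_le_inv_sq_moment rho_le_cube part4
    by (auto simp: tilde zero_less_mult_iff zero_less_divide_iff ennreal_leI)
qed

end
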